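(* Let $\varepsilon>0$, $\ell\ge 2$ and weights $w_1,\dots,w_\ell>0$. Let $T$ be the star-shaped tree with vertices $\{0,1,\dots,\ell\}$, central node $0$, edges $\{0,i\}$ ($1\le i\le\ell$) with weight $w_i$, so that its set of leaves is $S=\{1,\dots,\ell\}$. Let $\mu_1,\dots,\mu_\ell$ be probability measures on $\mathbb{R}^d$ such that for each $i$, $\mu_i\ll\mathrm{Leb}$ and $\mu_i$ has finite entropy. Let $r\in S$ be a leaf, assume that $\varphi_r=\mathrm{d}\mu_r/\mathrm{d}\mathrm{Leb}$ is positive, and let $\pi^0$ be the probability measure on $(\mathbb{R}^d)^{\ell+1}$ given by $$\pi^0=\pi^0_r\otimes\bigotimes_{(v,v')\in E_r}\pi^0_{v'|v},\qquad \pi^0_r=\mu_r,\qquad \pi^0_{v'|v}(\cdot\mid x_v)=\mathrm{N}\big(x_v,\tfrac{\varepsilon}{2w_{v,v'}}\mathrm{I}_d\big),$$ where $E_r=\{(r,0)\}\cup\{(0,i):i\in S\setminus\{r\}\}$ is the set of edges of $T$ directed away from $r$, and $w_{r,0}=w_r$, $w_{0,i}=w_i$. Assume that there exists a probability measure $\pi$ on $(\mathbb{R}^d)^{\ell+1}$ with $\mathrm{KL}(\pi\mid\pi^0)<\infty$ and $\pi_i=\mu_i$ for all $i\in S$. Then the doubly-regularized Wasserstein barycenter problem $$\operatorname*{arg\,min}\Big\{\sum_{i=1}^\ell w_i W^2_{2,\varepsilon/w_i}(\mu,\mu_i)+(\ell-1)\varepsilon\,\mathrm{H}(\mu)\ :\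 \mu \text{ a probability measure on }\mathbb{R}^d\Big\}$$ has a unique solution, namely $\pi^\star_0$, the marginal at the central node $0$ of the solution $\pi^\star$ of $$\pi^\star=\operatorname*{arg\,min}\{\mathrm{KL}(\pi\mid\pi^0): \pi\text{ a probability measure on }(\mathbb{R}^d)^{\ell+1},\ \pi_i=\mu_i\ \forall i\in S\}.$$
   Context: $\mathrm{Leb}$ is Lebesgue measure; $\pi_v$ denotes the $v$-th marginal of $\pi$. Entropy: $\mathrm{H}(\mu)=-\int f\log f\,\mathrm{d}\mathrm{Leb}$ if $\mu\ll\mathrm{Leb}$ with density $f$, and $\mathrm{H}(\mu)=-\infty$ if $\mu$ is not absolutely continuous. For $\eta>0$ and probability measures $\mu,\nu$ on $\mathbb{R}^d$, $$W^2_{2,\eta}(\mu,\nu)=\inf\Big\{\int\|x_1-x_0\|^2\,\mathrm{d}\pi(x_0,x_1)-\eta\,\mathrm{H}(\pi):\ \pi\text{ probability measure on }\mathbb{R}^d\times\mathbb{R}^d,\ \pi_0=\mu,\ \pi_1=\nu\Big\}.$$ $\mathrm{KL}(\mu\mid\nu)=\int\log(\mathrm{d}\mu/\mathrm{d}\nu)\,\mathrm{d}\mu$ if $\mu\ll\nu$, $+\infty$ otherwise. The minimizations are over measures for which the objective is well defined (expressions $\infty-\infty$ are treated as $+\infty$). *)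

theory Defs
  imports "HOL-Probability.Probability"
begin

text \<open>
  The \<^typ>\<open>ereal\<close> operations satisfy \<open>\<infinity> - \<infinity> = \<infinity> + (-\<infinity>) = \<infinity>\<close>, so indeterminate sums and
  differences take the value \<open>\<infinity>\<close>, which is the convention wanted for all minimizations below.
\<close>

definition ext_integral :: "'a measure \<Rightarrow> ('a \<Rightarrow> real) \<Rightarrow> ereal" where
  "ext_integral M f = enn2ereal (\<integral>\<^sup>+ x. ennreal (f x) \<partial>M) - enn2ereal (\<integral>\<^sup>+ x. ennreal (- f x) \<partial>M)"

definition ext_integral_defined :: "'a measure \<Rightarrow> ('a \<Rightarrow> real) \<Rightarrow> bool" where
  "ext_integral_defined M f \<longleftrightarrow>
     (\<integral>\<^sup>+ x. ennreal (f x) \<partial>M) < \<infinity> \<or> (\<integral>\<^sup>+ x. ennreal (- f x) \<partial>M) < \<infinity>"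

definition prob_on :: "'a measure \<Rightarrow> 'a measure \<Rightarrow> bool" where
  "prob_on M \<mu> \<longleftrightarrow> prob_space \<mu> \<and> sets \<mu> = sets M"

definition lebesgue_density :: "'a::euclidean_space measure \<Rightarrow> 'a \<Rightarrow> real" where
  "lebesgue_density \<mu> x = enn2real (RN_deriv lborel \<mu> x)"

definition entropy_defined :: "'a::euclidean_space measure \<Rightarrow> bool" where
  "entropy_defined \<mu> \<longleftrightarrow> (absolutely_continuous lborel \<mu> \<longrightarrow>
     ext_integral_defined lborel (\<lambda>x. lebesgue_density \<mu> x * ln (lebesgue_density \<mu> x)))"

text \<open>The value is meaningful only if \<open>entropy_defined \<mu>\<close>; it is \<open>-\<infinity>\<close> otherwise.\<close>

definition diff_entropy :: "'a::euclidean_space measure \<Rightarrow> ereal" where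
  "diff_entropy \<mu> =
     (if absolutely_continuous lborel \<mu>
      then - ext_integral lborel (\<lambda>x. lebesgue_density \<mu> x * ln (lebesgue_density \<mu> x))
      else -\<infinity>)"

text \<open>
  The library constant \<^const>\<open>KL_divergence\<close> takes its arguments in the opposite order and is real
  valued, hence \<open>0\<close> when the logarithm is not integrable.
\<close>

definition KL :: "'a measure \<Rightarrow> 'a measure \<Rightarrow> ereal" where
  "KL \<mu> \<nu> =
     (if absolutely_continuous \<nu> \<mu>
      then ext_integral \<mu> (\<lambda>x. ln (enn2real (RN_deriv \<nu> \<mu> x)))
      else \<infinity>)"

definition couplings ::
  "'a::euclidean_space measure \<Rightarrow> 'a measure \<Rightarrow> ('a \<times> 'a) measure set" where
  "couplings \<mu> \<nu> = {\<pi>. prob_on borel \<pi> \<and> distr \<pi> borel fst = \<mu> \<and> distr \<pi> borel snd = \<nu>}"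

definition reg_cost :: "real \<Rightarrow> ('a::euclidean_space \<times> 'a) measure \<Rightarrow> ereal" where
  "reg_cost \<eta> \<pi> =
     (if entropy_defined \<pi>
      then enn2ereal (\<integral>\<^sup>+ (x0, x1). ennreal ((norm (x1 - x0))\<^sup>2) \<partial>\<pi>) - ereal \<eta> * diff_entropy \<pi>
      else \<infinity>)"

definition W2_reg_sq :: "real \<Rightarrow> 'a::euclidean_space measure \<Rightarrow> 'a measure \<Rightarrow> ereal" where
  "W2_reg_sq \<eta> \<mu> \<nu> = (INF \<pi>\<in>couplings \<mu> \<nu>. reg_cost \<eta> \<pi>)"

text \<open>The Gaussian measure with mean \<open>m\<close> and covariance matrix \<open>v\<close> times the identity.\<close>

definition gaussian :: "real ^ 'd \<Rightarrow> real \<Rightarrow> (real ^ 'd) measure" where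
  "gaussian m v = density lborel (\<lambda>x. ennreal (\<Prod>i\<in>UNIV. normal_density (m $ i) (sqrt v) (x $ i)))"

text \<open>
  Families indexed by the nodes \<open>0, \<dots>, l\<close> of the star are points of the product space
  over \<open>{0..l}\<close>.
\<close>

abbreviation star_space :: "nat \<Rightarrow> (nat \<Rightarrow> 'a::euclidean_space) measure" where
  "star_space l \<equiv> Pi\<^sub>M {0..l} (\<lambda>_. borel)"

definition marginal :: "(nat \<Rightarrow> 'a::euclidean_space) measure \<Rightarrow> nat \<Rightarrow> 'a measure" where
  "marginal \<pi> v = distr \<pi> borel (\<lambda>x. x v)"

text \<open>
  Composition of the transition kernels along the edges directed away from the leaf \<open>r\<close>:
  sample \<open>x\<^sub>r\<close> from \<open>\<mu>\<close>, then \<open>x\<^sub>0\<close> given \<open>x\<^sub>r\<close>, then all other leaves independently given \<open>x\<^sub>0\<close>.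
\<close>

definition star_reference ::
  "real \<Rightarrow> nat \<Rightarrow> (nat \<Rightarrow> real) \<Rightarrow> nat \<Rightarrow> (real ^ 'd) measure \<Rightarrow> (nat \<Rightarrow> real ^ 'd) measure" where
  "star_reference \<epsilon> l w r \<mu> =
     \<mu> \<bind> (\<lambda>xr. gaussian xr (\<epsilon> / (2 * w r)) \<bind> (\<lambda>x0.
       distr (Pi\<^sub>M ({1..l} - {r}) (\<lambda>i. gaussian x0 (\<epsilon> / (2 * w i)))) (star_space l)
         (\<lambda>y. y(r := xr, 0 := x0))))"

definition leaf_constrained ::
  "nat \<Rightarrow> (nat \<Rightarrow> 'a::euclidean_space measure) \<Rightarrow> (nat \<Rightarrow> 'a) measure \<Rightarrow> bool" where
  "leaf_constrained l \<mu> \<pi> \<longleftrightarrow> prob_on (star_space l) \<pi> \<and> (\<forall>i\<in>{1..l}. marginal \<pi> i = \<mu> i)"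

definition barycenter_objective ::
  "real \<Rightarrow> nat \<Rightarrow> (nat \<Rightarrow> real) \<Rightarrow> (nat \<Rightarrow> 'a::euclidean_space measure) \<Rightarrow> 'a measure \<Rightarrow> ereal" where
  "barycenter_objective \<epsilon> l w \<mu> \<nu> =
     (if entropy_defined \<nu>
      then (\<Sum>i\<in>{1..l}. ereal (w i) * W2_reg_sq (\<epsilon> / w i) \<nu> (\<mu> i))
             + ereal ((real l - 1) * \<epsilon>) * diff_entropy \<nu>
      else \<infinity>)"

end

theory Submission
  imports Defs
begin

text \<open>
  Write \<open>p\<^sub>i\<close> for the density of the joint law of the centre and leaf \<open>i\<close>, and \<open>n\<close> for the
  density of the centre. Integrating the logarithm of the Gaussian reference density turns
  \<open>\<epsilon> KL(\<pi> | \<pi>\<^sup>0)\<close> into transport costs minus the entropy of \<open>\<pi>\<close>, up to the constant \<open>K\<close> below.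
  If \<open>\<pi>\<close> is glued from couplings along the centre, its density is \<open>\<Prod>\<^sub>i p\<^sub>i / n\<^sup>l\<^sup>-\<^sup>1\<close> and the result is
  exactly the barycenter functional of these couplings; a general \<open>\<pi>\<close> is only improved by gluing
  its pair marginals, by Gibbs' inequality. So minimizing over \<open>\<pi>\<close> with given centre marginal gives
  the barycenter objective.

  The infimum defining the regularized cost is never shown to be attained. Instead, near-minimizers
  of the Kullback-Leibler divergence are shown to be close in total variation to the projection
  \<open>\<pi>\<^sup>\<star>\<close>; gluing near-optimal couplings of an optimal \<open>\<nu>\<close> then forces \<open>\<nu>\<close> to be the centre marginal of \<open>\<pi>\<^sup>\<star>\<close>.

  All entropies have to be shown finite. Each logarithm is bounded one side at a time, by comparing
  the joint density with a suitable subprobability density: \<open>ln q - ln p\<close> has an integrable positive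
  part under \<open>p\<close>. Without the existence of \<open>\<pi>\<close> with finite divergence the entropy of the centre could be
  infinite.
\<close>

section \<open>One-sided integrability and Gibbs' inequality\<close>

text \<open>Since \<open>\<infinity> - \<infinity>\<close> counts as \<open>\<infinity>\<close>, the
  logarithm of a product may be split under the integral only once each term is known to be
  integrable. The bound \<open>ln t \<le> t - 1\<close> at \<open>t = q / p\<close> supplies one
  half at a time; the work lies in choosing \<open>q\<close> as a star-shaped product of pair
  densities, centre density and Gaussians whose mass can be computed. The gap above the minimal
  divergence controls the square of a total variation distance: an excess
  \<open>\<epsilon> * \<delta>\<^sup>2\<close> in the objective costs at most
  \<open>17 * \<delta>\<close> in distance and vanishes with \<open>\<delta>\<close>, which is why
  near-optimal couplings suffice. The root leaf is special in appearance only. By symmetry of the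
  Gaussian density, \<open>\<pi>\<^sup>0\<close> has a Lebesgue density with one Gaussian factor per
  edge and the single extra factor \<open>\<phi> r (x r)\<close>, whose logarithm has the same
  integral under every admissible \<open>\<pi>\<close>. The variance
  \<open>\<epsilon> / (2 * w i)\<close> is such that \<open>\<epsilon>\<close> times the Gaussian
  exponent is minus the transport cost weighted by \<open>w i\<close>.\<close>

definition upper_int :: "'a measure \<Rightarrow> ('a \<Rightarrow> real) \<Rightarrow> bool" where
  "upper_int M u \<longleftrightarrow> u \<in> borel_measurable M \<and> (\<integral>\<^sup>+x. ennreal (u x) \<partial>M) < \<infinity>"

lemma upper_int_add:
  assumes "upper_int M u" "upper_int M v"
  shows "upper_int M (\<lambda>x. u x + v x)"
proof -
  have [measurable]: "u \<in> borel_measurable M" "v \<in> borel_measurable M"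
    using assms by (auto simp: upper_int_def)
  have "(\<integral>\<^sup>+x. ennreal (u x + v x) \<partial>M) \<le> (\<integral>\<^sup>+x. ennreal (u x) + ennreal (v x) \<partial>M)"
    by (intro nn_integral_mono) (auto simp: ennreal_plus_if not_le intro: ennreal_leI)
  also have "\<dots> = (\<integral>\<^sup>+x. ennreal (u x) \<partial>M) + (\<integral>\<^sup>+x. ennreal (v x) \<partial>M)"
    by (rule nn_integral_add) auto
  also have "\<dots> < \<infinity>"
    using assms by (auto simp: upper_int_def)
  finally show ?thesis by (simp add: upper_int_def)
qed

lemma upper_int_mono:
  assumes "upper_int M v" "u \<in> borel_measurable M" "AE x in M. u x \<le> v x"
  shows "upper_int M u"
proof -
  have "(\<integral>\<^sup>+x. ennreal (u x) \<partial>M) \<le> (\<integral>\<^sup>+x. ennreal (v x) \<partial>M)"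
    using assms(3) by (intro nn_integral_mono_AE) (auto intro: ennreal_leI)
  then show ?thesis
    using assms by (auto simp: upper_int_def)
qed

lemma integrable_iff_upper_int:
  "integrable M u \<longleftrightarrow> upper_int M u \<and> upper_int M (\<lambda>x. - u x)"
  by (auto simp: upper_int_def real_integrable_def less_top)

lemmas integrable_arith =
  Bochner_Integration.integrable_add Bochner_Integration.integrable_diff
  Bochner_Integration.integrable_sum Bochner_Integration.integrable_divide integrable_mult_right

lemma AE_density_pos:
  fixes p :: "'a \<Rightarrow> real"
  assumes "p \<in> borel_measurable M"
  shows "AE x in density M (\<lambda>x. ennreal (p x)). p x > 0"
  using assms by (subst AE_density) auto

text \<open>Pointwise \<open>p * (ln q - ln p) \<le> q\<close>, so the positive part of the
  log-ratio, integrated against \<open>p\<close>, is at most the mass of \<open>q\<close>. No bound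
  on \<open>ln p\<close> enters: a test density \<open>q\<close> of finite mass yields one half of
  the integrability of a logarithm.\<close>

lemma upper_int_ln_ratio:
  fixes p q :: "'a \<Rightarrow> real"
  assumes [measurable]: "p \<in> borel_measurable M" "q \<in> borel_measurable M"
    and q: "(\<integral>\<^sup>+x. ennreal (q x) \<partial>M) < \<infinity>"
    and pos: "AE x in density M (\<lambda>x. ennreal (p x)). q x > 0"
  shows "upper_int (density M (\<lambda>x. ennreal (p x))) (\<lambda>x. ln (q x) - ln (p x))"
proof -
  have pos': "AE x in M. 0 < p x \<longrightarrow> q x > 0"
    using pos by (subst (asm) AE_density) auto
  have "(\<integral>\<^sup>+x. ennreal (ln (q x) - ln (p x)) \<partial>density M (\<lambda>x. ennreal (p x)))
    = (\<integral>\<^sup>+x. ennreal (p x) * ennreal (ln (q x) - ln (p x)) \<partial>M)"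
    by (rule nn_integral_density) auto
  also have "\<dots> \<le> (\<integral>\<^sup>+x. ennreal (q x) \<partial>M)"
  proof (rule nn_integral_mono_AE)
    show "AE x in M. ennreal (p x) * ennreal (ln (q x) - ln (p x)) \<le> ennreal (q x)"
      using pos'
    proof eventually_elim
      case (elim x)
      show ?case
      proof (cases "p x > 0")
        case True
        then have "q x > 0" using elim by auto
        then have "ln (q x) - ln (p x) = ln (q x / p x)"
          using True by (simp add: ln_div)
        also have "\<dots> \<le> q x / p x"
          using True \<open>q x > 0\<close> ln_le_minus_one[of "q x / p x"] by auto
        finally have "p x * (ln (q x) - ln (p x)) \<le> q x"
          using True by (simp add: field_simps)
        then show ?thesis
          using True by (simp add: ennreal_mult'[symmetric] ennreal_leI)
      qed (simp add: not_less ennreal_neg)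
    qed
  qed
  finally show ?thesis
    using q by (auto simp: upper_int_def)
qed

text \<open>Integrate \<open>ln t \<le> t - 1\<close> at \<open>t = q / p\<close> against
  \<open>p\<close>. The integral of \<open>q / p\<close> is at most 1, also if \<open>q\<close>
  charges the set where \<open>p\<close> vanishes.\<close>

lemma gibbs_inequality:
  fixes M :: "'a measure" and p q :: "'a \<Rightarrow> real"
  defines "\<pi> \<equiv> density M (\<lambda>x. ennreal (p x))"
  assumes [measurable]: "p \<in> borel_measurable M" "q \<in> borel_measurable M"
    and q: "(\<integral>\<^sup>+x. ennreal (q x) \<partial>M) \<le> 1"
    and prob: "prob_space \<pi>"
    and pos: "AE x in \<pi>. q x > 0"
    and int: "integrable \<pi> (\<lambda>x. ln (q x))" "integrable \<pi> (\<lambda>x. ln (p x))"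
  shows "(\<integral>x. ln (q x) \<partial>\<pi>) \<le> (\<integral>x. ln (p x) \<partial>\<pi>)"
proof -
  interpret prob_space \<pi> by fact
  have ppos: "AE x in \<pi>. p x > 0" unfolding \<pi>_def by (rule AE_density_pos) simp
  have [measurable_cong, simp]: "sets \<pi> = sets M" by (simp add: \<pi>_def)
  have nn: "(\<integral>\<^sup>+x. ennreal (q x / p x) \<partial>\<pi>) \<le> 1"
  proof -
    have "(\<integral>\<^sup>+x. ennreal (q x / p x) \<partial>\<pi>) = (\<integral>\<^sup>+x. ennreal (p x) * ennreal (q x / p x) \<partial>M)"
      unfolding \<pi>_def by (rule nn_integral_density) auto
    also have "\<dots> \<le> (\<integral>\<^sup>+x. ennreal (q x) \<partial>M)"
    proof (rule nn_integral_mono)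
      fix x
      show "ennreal (p x) * ennreal (q x / p x) \<le> ennreal (q x)"
        by (cases "p x > 0") (auto simp: ennreal_mult'[symmetric] not_less ennreal_neg)
    qed
    finally show ?thesis using q by (rule order_trans)
  qed
  have intq: "integrable \<pi> (\<lambda>x. q x / p x)"
  proof (rule integrableI_nonneg)
    show "AE x in \<pi>. 0 \<le> q x / p x" using pos ppos by eventually_elim simp
    show "(\<integral>\<^sup>+x. ennreal (q x / p x) \<partial>\<pi>) < \<infinity>" using nn by (rule le_less_trans) simp
  qed simp
  have "(\<integral>x. q x / p x \<partial>\<pi>) \<le> 1"
  proof -
    have "ennreal (\<integral>x. q x / p x \<partial>\<pi>) = (\<integral>\<^sup>+x. ennreal (q x / p x) \<partial>\<pi>)"
      using pos ppos intq by (intro nn_integral_eq_integral[symmetric]) auto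
    then have "ennreal (\<integral>x. q x / p x \<partial>\<pi>) \<le> ennreal 1" using nn by simp
    then show ?thesis by (subst (asm) ennreal_le_iff) auto
  qed
  moreover have "(\<integral>x. ln (q x) - ln (p x) \<partial>\<pi>) \<le> (\<integral>x. q x / p x - 1 \<partial>\<pi>)"
  proof (rule integral_mono_AE)
    show "AE x in \<pi>. ln (q x) - ln (p x) \<le> q x / p x - 1"
      using pos ppos
    proof eventually_elim
      case (elim x)
      then show ?case
        using ln_le_minus_one[of "q x / p x"] by (simp add: ln_div)
    qed
  qed (use int intq in auto)
  ultimately show ?thesis
    using int intq by (simp add: prob_space)
qed

lemma ext_integral_integrable:
  assumes "integrable M f"
  shows "ext_integral M f = ereal (\<integral>x. f x \<partial>M)"
proof -
  have fin: "(\<integral>\<^sup>+x. ennreal (f x) \<partial>M) \<noteq> \<infinity>" "(\<integral>\<^sup>+x. ennreal (- f x) \<partial>M) \<noteq> \<infinity>"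
    using assms by (auto simp: real_integrable_def)
  have "(\<integral>x. f x \<partial>M) = enn2real (\<integral>\<^sup>+x. ennreal (f x) \<partial>M) - enn2real (\<integral>\<^sup>+x. ennreal (- f x) \<partial>M)"
    by (rule real_lebesgue_integral_def[OF assms])
  then show ?thesis
    using fin unfolding ext_integral_def
    by (cases "\<integral>\<^sup>+x. ennreal (f x) \<partial>M"; cases "\<integral>\<^sup>+x. ennreal (- f x) \<partial>M")
       (auto simp: enn2ereal_ennreal)
qed

lemma ext_integral_less_infty_imp_upper_int:
  assumes "ext_integral M f < \<infinity>" "f \<in> borel_measurable M"
  shows "upper_int M f"
  using assms unfolding ext_integral_def upper_int_def
  by (cases "\<integral>\<^sup>+x. ennreal (f x) \<partial>M") (auto simp: less_top)

lemma ext_integral_gt_minus_infty_imp_integrable: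
  assumes "ext_integral M f \<noteq> - \<infinity>" "upper_int M f"
  shows "integrable M f"
  using assms unfolding ext_integral_def upper_int_def real_integrable_def
  by (cases "\<integral>\<^sup>+x. ennreal (f x) \<partial>M"; cases "\<integral>\<^sup>+x. ennreal (- f x) \<partial>M")
     (auto simp: less_top enn2ereal_ennreal)

lemma ext_integral_finite_imp_integrable:
  assumes "\<bar>ext_integral M f\<bar> \<noteq> \<infinity>" "f \<in> borel_measurable M"
  shows "integrable M f"
proof (rule ext_integral_gt_minus_infty_imp_integrable)
  show "upper_int M f"
    using assms by (intro ext_integral_less_infty_imp_upper_int) (auto simp: less_top[symmetric])
qed (use assms in auto)

lemma ext_integral_cong_AE:
  assumes "AE x in M. f x = g x"
  shows "ext_integral M f = ext_integral M g"
proof -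
  have "(\<integral>\<^sup>+x. ennreal (f x) \<partial>M) = (\<integral>\<^sup>+x. ennreal (g x) \<partial>M)"
    "(\<integral>\<^sup>+x. ennreal (- f x) \<partial>M) = (\<integral>\<^sup>+x. ennreal (- g x) \<partial>M)"
    using assms by (auto intro!: nn_integral_cong_AE)
  then show ?thesis by (simp add: ext_integral_def)
qed

lemma (in sigma_finite_measure) density_enn2real_RN_deriv:
  assumes "prob_space N" "absolutely_continuous M N" "sets N = sets M"
  shows "density M (\<lambda>x. ennreal (enn2real (RN_deriv M N x))) = N"
proof -
  interpret N: prob_space N by fact
  have "AE x in M. RN_deriv M N x \<noteq> \<infinity>"
    by (rule RN_deriv_finite) (use assms N.sigma_finite_measure_axioms in auto)
  then have "density M (\<lambda>x. ennreal (enn2real (RN_deriv M N x))) = density M (RN_deriv M N)"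
    by (intro density_cong) (auto simp: less_top)
  then show ?thesis
    using density_RN_deriv assms by simp
qed

lemma (in sigma_finite_measure) AE_RN_deriv_density:
  fixes f :: "'a \<Rightarrow> real"
  assumes [measurable]: "f \<in> borel_measurable M" and f: "\<And>x. f x \<ge> 0"
  shows "AE x in M. enn2real (RN_deriv M (density M (\<lambda>x. ennreal (f x))) x) = f x"
proof -
  have "AE x in M. ennreal (f x) = RN_deriv M (density M (\<lambda>x. ennreal (f x))) x"
    by (rule RN_deriv_unique) auto
  then show ?thesis
    by eventually_elim (metis enn2real_ennreal f)
qed

lemma KL_density_eq_ext_integral:
  fixes f :: "'a \<Rightarrow> real"
  assumes "sigma_finite_measure P" and [measurable]: "f \<in> borel_measurable P" and f: "\<And>x. f x \<ge> 0"
  shows "KL (density P (\<lambda>x. ennreal (f x))) P =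
    ext_integral (density P (\<lambda>x. ennreal (f x))) (\<lambda>x. ln (f x))"
proof -
  interpret sigma_finite_measure P by fact
  let ?N = "density P (\<lambda>x. ennreal (f x))"
  have ac: "absolutely_continuous P ?N" by (rule absolutely_continuousI_density) simp
  have "AE x in ?N. enn2real (RN_deriv P ?N x) = f x"
    by (subst AE_density) (use AE_RN_deriv_density[of f] f in auto)
  then have "AE x in ?N. ln (enn2real (RN_deriv P ?N x)) = ln (f x)"
    by eventually_elim simp
  then show ?thesis
    using ac by (simp add: KL_def ext_integral_cong_AE)
qed

text \<open>An infinite positive part would make \<open>ext_integral\<close> equal to
  \<open>\<infinity>\<close> whatever the negative part is, so a finite divergence bounds the
  positive part of the log-density. The negative part is controlled by comparison with the constant
  density 1, of finite mass since \<open>P\<close> is a probability measure.\<close>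

lemma KL_finite_density:
  assumes "prob_space P" "prob_on P \<pi>" "KL \<pi> P < \<infinity>"
  obtains f :: "'a \<Rightarrow> real" where "f \<in> borel_measurable P" "\<And>x. f x \<ge> 0"
    "\<pi> = density P (\<lambda>x. ennreal (f x))"
    "integrable \<pi> (\<lambda>x. ln (f x))" "KL \<pi> P = ereal (\<integral>x. ln (f x) \<partial>\<pi>)"
proof -
  interpret prob_space P by fact
  define f where "f = (\<lambda>x. enn2real (RN_deriv P \<pi> x))"
  have ac: "absolutely_continuous P \<pi>"
    using assms(3) by (auto simp: KL_def split: if_splits)
  have [measurable]: "f \<in> borel_measurable P" and f: "\<And>x. f x \<ge> 0"
    by (auto simp: f_def)
  have \<pi>: "\<pi> = density P (\<lambda>x. ennreal (f x))"
    unfolding f_def using ac assms(2)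
    by (intro density_enn2real_RN_deriv[symmetric]) (auto simp: prob_on_def)
  have KL: "KL \<pi> P = ext_integral \<pi> (\<lambda>x. ln (f x))"
    using ac by (simp add: KL_def f_def)
  have up: "upper_int \<pi> (\<lambda>x. ln (f x))"
    by (rule ext_integral_less_infty_imp_upper_int) (use assms(3) KL in \<open>auto simp: \<pi>\<close>)
  moreover have "upper_int \<pi> (\<lambda>x. ln 1 - ln (f x))"
    unfolding \<pi> by (rule upper_int_ln_ratio) (auto simp: emeasure_space_1)
  ultimately have int: "integrable \<pi> (\<lambda>x. ln (f x))"
    by (simp add: integrable_iff_upper_int)
  show thesis
    using that[of f] f \<pi> int KL ext_integral_integrable[OF int] by auto
qed

section \<open>Lebesgue densities and differential entropy\<close>

abbreviation ldens :: "'a::euclidean_space measure \<Rightarrow> 'a \<Rightarrow> real" where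
  "ldens \<equiv> lebesgue_density"

lemma lebesgue_density_measurable [measurable]:
  "ldens \<mu> \<in> borel_measurable borel"
  unfolding lebesgue_density_def by measurable

lemma lebesgue_density_nonneg [simp]: "ldens \<mu> x \<ge> 0"
  by (simp add: lebesgue_density_def)

lemma density_lebesgue_density:
  assumes "prob_on borel \<mu>" "absolutely_continuous lborel \<mu>"
  shows "density lborel (\<lambda>x. ennreal (ldens \<mu> x)) = \<mu>"
  unfolding lebesgue_density_def
  by (rule lborel.density_enn2real_RN_deriv) (use assms in \<open>auto simp: prob_on_def\<close>)

lemma nn_integral_lebesgue_density:
  assumes "prob_on borel \<nu>" "absolutely_continuous lborel \<nu>"
  shows "(\<integral>\<^sup>+x. ennreal (ldens \<nu> x) \<partial>lborel) = 1"
proof -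
  have "(\<integral>\<^sup>+x. ennreal (ldens \<nu> x) \<partial>lborel) =
    emeasure (density lborel (\<lambda>x. ennreal (ldens \<nu> x))) UNIV"
    by (subst emeasure_density) auto
  also have "\<dots> = emeasure \<nu> (space \<nu>)"
    unfolding density_lebesgue_density[OF assms]
    using assms(1) sets_eq_imp_space_eq[of \<nu> borel] by (simp add: prob_on_def)
  also have "\<dots> = 1"
    using assms(1) by (simp add: prob_on_def prob_space.emeasure_space_1)
  finally show ?thesis .
qed

lemma nn_integral_entropy_integrand:
  fixes f g :: "'a \<Rightarrow> real"
  assumes [measurable]: "f \<in> borel_measurable M" "g \<in> borel_measurable M" and f: "\<And>x. f x \<ge> 0"
  shows "(\<integral>\<^sup>+x. ennreal (f x * g x) \<partial>M) = (\<integral>\<^sup>+x. ennreal (g x) \<partial>density M (\<lambda>x. ennreal (f x)))"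
  by (subst nn_integral_density) (auto simp: f ennreal_mult')

lemma ext_integral_lebesgue_density:
  assumes "prob_on borel \<mu>" "absolutely_continuous lborel \<mu>"
  shows "ext_integral lborel (\<lambda>x. ldens \<mu> x * ln (ldens \<mu> x)) =
      ext_integral \<mu> (\<lambda>x. ln (ldens \<mu> x))"
    and "ext_integral_defined lborel (\<lambda>x. ldens \<mu> x * ln (ldens \<mu> x)) =
      ext_integral_defined \<mu> (\<lambda>x. ln (ldens \<mu> x))"
proof -
  let ?f = "ldens \<mu>"
  have 1: "(\<integral>\<^sup>+x. ennreal (?f x * ln (?f x)) \<partial>lborel) = (\<integral>\<^sup>+x. ennreal (ln (?f x)) \<partial>\<mu>)"
    by (subst nn_integral_entropy_integrand) (auto simp: density_lebesgue_density[OF assms])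
  have 2: "(\<integral>\<^sup>+x. ennreal (?f x * (- ln (?f x))) \<partial>lborel) = (\<integral>\<^sup>+x. ennreal (- ln (?f x)) \<partial>\<mu>)"
    by (subst nn_integral_entropy_integrand) (auto simp: density_lebesgue_density[OF assms])
  show "ext_integral lborel (\<lambda>x. ?f x * ln (?f x)) = ext_integral \<mu> (\<lambda>x. ln (?f x))"
    "ext_integral_defined lborel (\<lambda>x. ?f x * ln (?f x)) = ext_integral_defined \<mu> (\<lambda>x. ln (?f x))"
    using 1 2 by (auto simp: ext_integral_def ext_integral_defined_def)
qed

lemma diff_entropy_integrable:
  assumes "prob_on borel \<mu>" "absolutely_continuous lborel \<mu>"
    and "integrable \<mu> (\<lambda>x. ln (ldens \<mu> x))"
  shows "diff_entropy \<mu> = - ereal (\<integral>x. ln (ldens \<mu> x) \<partial>\<mu>)" "entropy_defined \<mu>"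
proof -
  show "diff_entropy \<mu> = - ereal (\<integral>x. ln (ldens \<mu> x) \<partial>\<mu>)"
    using assms by (simp add: diff_entropy_def ext_integral_lebesgue_density ext_integral_integrable)
  show "entropy_defined \<mu>"
    using assms(3) unfolding entropy_defined_def ext_integral_lebesgue_density[OF assms(1,2)]
    by (auto simp: ext_integral_defined_def real_integrable_def less_top)
qed

lemma prob_on_borel_measurable_iff:
  "prob_on borel \<mu> \<Longrightarrow> f \<in> borel_measurable \<mu> \<longleftrightarrow> f \<in> borel_measurable borel"
  by (metis measurable_cong_sets prob_on_def)

section \<open>Information projections\<close>

text \<open>Applying \<open>ln t \<le> t - 1\<close> at \<open>t = sqrt m / sqrt x\<close> instead
  of \<open>m / x\<close> sharpens the tangent inequality of \<open>x * ln x\<close> at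
  \<open>m\<close> by the squared difference of the roots. This surplus is what makes
  near-minimizers close.\<close>

lemma mult_ln_ge:
  fixes x m :: real
  assumes "x \<ge> 0" "m > 0"
  shows "x - m + (sqrt x - sqrt m)\<^sup>2 \<le> x * ln x - x * ln m"
proof (cases "x = 0")
  case False
  with assms have x: "x > 0" by simp
  have eq: "sqrt x * sqrt x = x" "sqrt m * sqrt m = m" using x assms by auto
  have "ln m - ln x = 2 * ln (sqrt m / sqrt x)"
    using x assms by (simp add: ln_div ln_sqrt)
  also have "\<dots> \<le> 2 * (sqrt m / sqrt x - 1)"
    using x assms by (intro mult_left_mono ln_le_minus_one) auto
  finally have "x * (ln m - ln x) \<le> x * (2 * (sqrt m / sqrt x - 1))"
    using x by (intro mult_left_mono) auto
  also have "\<dots> = 2 * (x / sqrt x * sqrt m - x)"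
    by (simp add: algebra_simps)
  also have "x / sqrt x = sqrt x" using x by (simp add: real_div_sqrt)
  finally show ?thesis
    using eq by (simp add: power2_eq_square algebra_simps)
qed (use assms in auto)

text \<open>Quantitative strict convexity of \<open>t ln t\<close>: twice the convexity gap at the midpoint \<open>m\<close>
  dominates \<open>(\<surd>x - \<surd>m)\<^sup>2\<close>, which controls \<open>\<bar>x - y\<bar>\<close> through the inequality of the means with parameter \<open>\<delta>\<close>.\<close>

lemma mult_ln_midpoint_gap:
  fixes x y \<delta> :: real
  assumes "x \<ge> 0" "y \<ge> 0" "\<delta> > 0"
  shows "\<bar>x - y\<bar> \<le> 8 * \<delta> * (x + y) +
    (x * ln x + y * ln y - 2 * ((x + y) / 2 * ln ((x + y) / 2))) / (2 * \<delta>)"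
proof (cases "x + y = 0")
  case False
  define m where "m = (x + y) / 2"
  define a b where "a = sqrt x + sqrt m" and "b = \<bar>sqrt x - sqrt m\<bar>"
  have m: "m > 0" using assms False by (auto simp: m_def)
  have "\<bar>x - m\<bar> = b * a"
  proof -
    have "x - m = (sqrt x - sqrt m) * (sqrt x + sqrt m)"
      using assms m by (simp add: algebra_simps)
    then show ?thesis using assms m by (simp add: a_def b_def abs_mult)
  qed
  also have "b * a \<le> \<delta> * a\<^sup>2 + b\<^sup>2 / (4 * \<delta>)"
  proof -
    have "0 \<le> (2 * \<delta> * a - b)\<^sup>2" by simp
    then have "4 * \<delta> * (b * a) \<le> 4 * \<delta> * (\<delta> * a\<^sup>2 + b\<^sup>2 / (4 * \<delta>))"
      using assms by (simp add: power2_eq_square algebra_simps)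
    then show ?thesis using assms by simp
  qed
  also have "a\<^sup>2 \<le> 2 * (x + m)"
  proof -
    have "0 \<le> (sqrt x - sqrt m)\<^sup>2" by simp
    then show ?thesis
      using assms m by (simp add: a_def power2_eq_square algebra_simps)
  qed
  also have "x + m \<le> 2 * (x + y)"
    using assms by (simp add: m_def)
  finally have 1: "\<bar>x - m\<bar> \<le> \<delta> * (2 * (2 * (x + y))) + b\<^sup>2 / (4 * \<delta>)"
    using assms by simp
  \<comment> \<open>Add \<open>mult_ln_ge\<close> at \<open>m\<close> for \<open>x\<close> and for
    \<open>y\<close>: the linear terms cancel because \<open>x + y = 2 * m\<close>, and the square
    belonging to \<open>y\<close> is dropped.\<close>
  have "b\<^sup>2 \<le> x * ln x + y * ln y - 2 * (m * ln m)"
  proof -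
    have "x + y = 2 * m" by (simp add: m_def)
    moreover from this have "x * ln m + y * ln m = 2 * m * ln m" by (metis distrib_right)
    ultimately show ?thesis
      using mult_ln_ge[of x m] mult_ln_ge[of y m] assms m zero_le_power2[of "sqrt y - sqrt m"]
      unfolding b_def power2_abs by linarith
  qed
  then have "b\<^sup>2 / (4 * \<delta>) \<le> (x * ln x + y * ln y - 2 * (m * ln m)) / (4 * \<delta>)"
    using assms by (intro divide_right_mono) auto
  with 1 have "2 * \<bar>x - m\<bar> \<le> 8 * \<delta> * (x + y) + 2 * ((x * ln x + y * ln y - 2 * (m * ln m)) / (4 * \<delta>))"
    (is "_ \<le> _ + 2 * ?t")
  proof -
    have "2 * \<bar>x - m\<bar> \<le> 2 * (\<delta> * (2 * (2 * (x + y))) + ?t)"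
      using 1 \<open>b\<^sup>2 / (4 * \<delta>) \<le> ?t\<close> by (intro mult_left_mono) (erule order_trans, simp_all)
    also have "\<dots> = 8 * \<delta> * (x + y) + 2 * ?t" by (simp only: distrib_left mult.assoc)
    finally show ?thesis .
  qed
  moreover have "2 * \<bar>x - m\<bar> = \<bar>x - y\<bar>" by (auto simp: m_def abs_if field_simps)
  moreover have "2 * (t / (4 * \<delta>)) = t / (2 * \<delta>)" for t :: real
    using assms by (simp add: field_simps)
  ultimately show ?thesis unfolding m_def by (simp only:)
next
  case True
  then have "x = 0" "y = 0" using assms by auto
  then show ?thesis by simp
qed

lemma mult_ln_ge_minus_one:
  fixes x :: real
  assumes "x \<ge> 0"
  shows "x * ln x \<ge> -1"
proof -
  have "x - 1 + (sqrt x - 1)\<^sup>2 \<le> x * ln x" using mult_ln_ge[of x 1] assms by simp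
  then show ?thesis using assms zero_le_power2[of "sqrt x - 1"] by linarith
qed

text \<open>\<open>ln\<close> is not continuous at 0, so the limit \<open>a = 0\<close> is squeezed:
  \<open>mult_ln_ge\<close> at \<open>m = 1\<close> gives the lower bound
  \<open>- 2 * sqrt (f n)\<close>, and \<open>ln t \<le> t - 1\<close> gives the upper bound
  \<open>f n * f n\<close>.\<close>

lemma tendsto_mult_ln:
  fixes f :: "nat \<Rightarrow> real"
  assumes f: "f \<longlonglongrightarrow> a" and nonneg: "\<And>n. f n \<ge> 0"
  shows "(\<lambda>n. f n * ln (f n)) \<longlonglongrightarrow> a * ln a"
proof (cases "a = 0")
  case True
  show ?thesis
  proof (rule tendsto_sandwich)
    show "\<forall>\<^sub>F n in sequentially. - 2 * sqrt (f n) \<le> f n * ln (f n)"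
    proof (rule always_eventually, rule allI)
      fix n
      show "- 2 * sqrt (f n) \<le> f n * ln (f n)"
        using mult_ln_ge[of "f n" 1] nonneg[of n] by (simp add: power2_eq_square algebra_simps)
    qed
    show "\<forall>\<^sub>F n in sequentially. f n * ln (f n) \<le> f n * f n"
    proof (rule always_eventually, rule allI)
      fix n
      show "f n * ln (f n) \<le> f n * f n"
        using ln_le_minus_one[of "f n"] nonneg[of n]
        by (cases "f n = 0") (auto intro!: mult_left_mono)
    qed
    have "(\<lambda>n. - 2 * sqrt (f n)) \<longlonglongrightarrow> - 2 * sqrt 0" "(\<lambda>n. f n * f n) \<longlonglongrightarrow> 0 * 0"
      using f unfolding True by (intro tendsto_intros; simp)+
    then show "(\<lambda>n. - 2 * sqrt (f n)) \<longlonglongrightarrow> a * ln a" "(\<lambda>n. f n * f n) \<longlonglongrightarrow> a * ln a"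
      by (auto simp: True)
  qed
next
  case False
  moreover have "a \<ge> 0" using f nonneg by (intro LIMSEQ_le_const[of f]) auto
  ultimately show ?thesis using f by (intro tendsto_intros) auto
qed

context prob_space
begin

text \<open>\<open>t * ln t\<close> is at least -1 and, by convexity, at most the average of its end
  values at a midpoint; the constant is integrable because the measure is finite.\<close>

lemma midpoint_entropy_integrable:
  fixes f g :: "'a \<Rightarrow> real"
  assumes f: "integrable M f" "\<And>x. f x \<ge> 0" "integrable M (\<lambda>x. f x * ln (f x))"
    and g: "integrable M g" "\<And>x. g x \<ge> 0" "integrable M (\<lambda>x. g x * ln (g x))"
  shows "integrable M (\<lambda>x. (f x + g x) / 2 * ln ((f x + g x) / 2))"
proof (rule Bochner_Integration.integrable_bound)
  show "integrable M (\<lambda>x. \<bar>f x * ln (f x)\<bar> + \<bar>g x * ln (g x)\<bar> + 1)"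
    using assms by auto
  have [measurable]: "f \<in> borel_measurable M" "g \<in> borel_measurable M" using assms by auto
  show "(\<lambda>x. (f x + g x) / 2 * ln ((f x + g x) / 2)) \<in> borel_measurable M" by measurable
  show "AE x in M. norm ((f x + g x) / 2 * ln ((f x + g x) / 2)) \<le>
    norm (\<bar>f x * ln (f x)\<bar> + \<bar>g x * ln (g x)\<bar> + 1)"
  proof (rule AE_I2)
    fix x
    define h where "h = (f x + g x) / 2 * ln ((f x + g x) / 2)"
    have "h \<ge> -1" unfolding h_def using f g by (intro mult_ln_ge_minus_one) auto
    moreover have "2 * h \<le> f x * ln (f x) + g x * ln (g x)"
    proof (cases "f x + g x = 0")
      case True
      then have "f x = 0" "g x = 0" using f(2)[of x] g(2)[of x] by auto
      then show ?thesis by (simp add: h_def)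
    next
      case False
      define m where "m = (f x + g x) / 2"
      have m: "m > 0" "f x + g x = 2 * m" using f(2)[of x] g(2)[of x] False by (auto simp: m_def)
      then have "f x * ln m + g x * ln m = 2 * m * ln m" by (metis distrib_right)
      then show ?thesis
        using mult_ln_ge[OF f(2) m(1), of x] mult_ln_ge[OF g(2) m(1), of x] m(2)
          zero_le_power2[of "sqrt (f x) - sqrt m"] zero_le_power2[of "sqrt (g x) - sqrt m"]
        unfolding h_def m_def[symmetric] by linarith
    qed
    ultimately show "norm h \<le> norm (\<bar>f x * ln (f x)\<bar> + \<bar>g x * ln (g x)\<bar> + 1)"
      by (simp add: abs_le_iff) linarith
  qed
qed

text \<open>A parallelogram argument: the midpoint cannot go below \<open>V\<close>, so the
  integrated convexity gap is at most \<open>2 * \<delta>\<^sup>2\<close>. In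
  \<open>mult_ln_midpoint_gap\<close> the linear term then integrates to
  \<open>16 * \<delta>\<close>, both densities having mass 1, and the gap contributes another
  \<open>\<delta>\<close>; hence 17.\<close>

lemma near_minimizers_close:
  fixes f g :: "'a \<Rightarrow> real"
  assumes f: "integrable M f" "\<And>x. f x \<ge> 0" "integrable M (\<lambda>x. f x * ln (f x))" "(\<integral>x. f x \<partial>M) = 1"
    and g: "integrable M g" "\<And>x. g x \<ge> 0" "integrable M (\<lambda>x. g x * ln (g x))" "(\<integral>x. g x \<partial>M) = 1"
    and V: "(\<integral>x. f x * ln (f x) \<partial>M) \<le> V + \<delta>\<^sup>2" "(\<integral>x. g x * ln (g x) \<partial>M) \<le> V + \<delta>\<^sup>2"
      "V \<le> (\<integral>x. (f x + g x) / 2 * ln ((f x + g x) / 2) \<partial>M)"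
    and \<delta>: "\<delta> > 0"
  shows "(\<integral>x. \<bar>f x - g x\<bar> \<partial>M) \<le> 17 * \<delta>"
proof -
  define h where "h x = (f x + g x) / 2 * ln ((f x + g x) / 2)" for x
  have m: "integrable M h"
    using midpoint_entropy_integrable[OF f(1-3) g(1-3)] unfolding h_def .
  have "(\<integral>x. \<bar>f x - g x\<bar> \<partial>M) \<le>
    (\<integral>x. 8 * \<delta> * (f x + g x) + (f x * ln (f x) + g x * ln (g x) - 2 * h x) / (2 * \<delta>) \<partial>M)"
  proof (rule integral_mono)
    show "\<bar>f x - g x\<bar> \<le> 8 * \<delta> * (f x + g x) + (f x * ln (f x) + g x * ln (g x) - 2 * h x) / (2 * \<delta>)" for x
      unfolding h_def using f(2) g(2) \<delta> by (rule mult_ln_midpoint_gap)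
  qed (use f g m in auto)
  also have "\<dots> = 16 * \<delta> + ((\<integral>x. f x * ln (f x) \<partial>M) + (\<integral>x. g x * ln (g x) \<partial>M) - 2 * (\<integral>x. h x \<partial>M)) / (2 * \<delta>)"
    using f g m by simp
  also have "((\<integral>x. f x * ln (f x) \<partial>M) + (\<integral>x. g x * ln (g x) \<partial>M) - 2 * (\<integral>x. h x \<partial>M)) / (2 * \<delta>)
      \<le> (2 * \<delta>\<^sup>2) / (2 * \<delta>)"
    using V \<delta> unfolding h_def by (intro divide_right_mono) auto
  also have "\<dots> = \<delta>" using \<delta> by (simp add: power2_eq_square)
  finally show ?thesis by simp
qed

lemma measure_density_eq_integral:
  fixes f :: "'a \<Rightarrow> real"
  assumes "integrable M f" "\<And>x. f x \<ge> 0" "A \<in> sets M"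
  shows "measure (density M f) A = (\<integral>x. f x * indicator A x \<partial>M)"
proof -
  have "emeasure (density M f) A = (\<integral>\<^sup>+x. ennreal (f x * indicator A x) \<partial>M)"
    using assms by (subst emeasure_density) (auto intro!: nn_integral_cong simp: indicator_def)
  also have "\<dots> = ennreal (\<integral>x. f x * indicator A x \<partial>M)"
    using assms by (intro nn_integral_eq_integral integrable_real_mult_indicator) auto
  finally show ?thesis
    using assms by (simp add: measure_def integral_nonneg_AE)
qed

lemma measure_density_diff_le:
  fixes f g :: "'a \<Rightarrow> real"
  assumes f: "integrable M f" "\<And>x. f x \<ge> 0" and g: "integrable M g" "\<And>x. g x \<ge> 0"
    and A: "A \<in> sets M"
  shows "\<bar>measure (density M f) A - measure (density M g) A\<bar> \<le> (\<integral>x. \<bar>f x - g x\<bar> \<partial>M)"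
proof -
  have "measure (density M f) A - measure (density M g) A = (\<integral>x. (f x - g x) * indicator A x \<partial>M)"
    using f g A
    by (simp add: measure_density_eq_integral left_diff_distrib integrable_real_mult_indicator)
  also have "\<bar>\<dots>\<bar> \<le> (\<integral>x. \<bar>(f x - g x) * indicator A x\<bar> \<partial>M)"
    by (rule integral_abs_bound)
  also have "\<dots> \<le> (\<integral>x. \<bar>f x - g x\<bar> \<partial>M)"
    using f g A by (intro integral_mono integrable_abs integrable_real_mult_indicator)
      (auto simp: abs_mult indicator_def)
  finally show ?thesis .
qed

end

text \<open>Consecutive distances are summable, so the whole sequence converges almost everywhere,
  without passing to a subsequence. Fatou's lemma in \<open>m\<close> carries the rate over to the
  limit.\<close>

lemma (in prob_space) L1_limit_of_rapidly_Cauchy: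
  fixes f :: "nat \<Rightarrow> 'a \<Rightarrow> real"
  assumes f: "\<And>n. integrable M (f n)" "\<And>n x. f n x \<ge> 0"
    and Cauchy: "\<And>m n. n \<le> m \<Longrightarrow> (\<integral>x. \<bar>f m x - f n x\<bar> \<partial>M) \<le> c / 2 ^ n"
  obtains F where "integrable M F" "\<And>x. F x \<ge> 0" "AE x in M. (\<lambda>n. f n x) \<longlonglongrightarrow> F x"
    "\<And>n. (\<integral>x. \<bar>F x - f n x\<bar> \<partial>M) \<le> c / 2 ^ n"
proof -
  have [measurable]: "f n \<in> borel_measurable M" for n using f by auto
  have c: "c \<ge> 0"
    using Cauchy[of 0 0] by simp
  have nnC: "(\<integral>\<^sup>+x. ennreal \<bar>f m x - f n x\<bar> \<partial>M) \<le> ennreal (c / 2 ^ n)" if "n \<le> m" for m n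
  proof -
    have "(\<integral>\<^sup>+x. ennreal \<bar>f m x - f n x\<bar> \<partial>M) = ennreal (\<integral>x. \<bar>f m x - f n x\<bar> \<partial>M)"
      using f by (intro nn_integral_eq_integral) auto
    then show ?thesis using Cauchy[OF that] by (auto intro: ennreal_leI)
  qed
  have "(\<integral>\<^sup>+x. (\<Sum>n. ennreal \<bar>f (Suc n) x - f n x\<bar>) \<partial>M) = (\<Sum>n. \<integral>\<^sup>+x. ennreal \<bar>f (Suc n) x - f n x\<bar> \<partial>M)"
    by (rule nn_integral_suminf) auto
  also have "\<dots> \<le> (\<Sum>n. ennreal (c / 2 ^ n))"
    by (intro suminf_le nnC) auto
  also have "\<dots> = (\<Sum>n. ennreal (c * (1 / 2) ^ n))"
    by (simp add: power_divide)
  also have "\<dots> = ennreal (\<Sum>n. c * (1 / 2) ^ n)"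
    using c by (intro suminf_ennreal2 summable_mult summable_geometric) auto
  finally have "(\<integral>\<^sup>+x. (\<Sum>n. ennreal \<bar>f (Suc n) x - f n x\<bar>) \<partial>M) \<noteq> \<infinity>"
    by (auto simp: top_unique)
  then have "AE x in M. (\<Sum>n. ennreal \<bar>f (Suc n) x - f n x\<bar>) \<noteq> \<infinity>"
    by (intro nn_integral_PInf_AE) auto
  then have conv: "AE x in M. convergent (\<lambda>n. f n x)"
  proof eventually_elim
    case (elim x)
    then have "summable (\<lambda>n. \<bar>f (Suc n) x - f n x\<bar>)"
      by (intro summable_suminf_not_top) auto
    then have "summable (\<lambda>n. f (Suc n) x - f n x)" by (rule summable_rabs_cancel)
    then have "convergent (\<lambda>n. \<Sum>k<n. f (Suc k) x - f k x)"
      by (simp add: summable_iff_convergent)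
    then have "convergent (\<lambda>n. f n x - f 0 x)"
      using sum_lessThan_telescope[of "\<lambda>k. f k x"] by simp
    then show ?case
      by (simp add: convergent_diff_const_right_iff)
  qed
  \<comment> \<open>Where the sequence diverges \<open>lim\<close> is arbitrary; the maximum with 0
    makes \<open>F\<close> nonnegative at every point and changes nothing on the convergence
    set.\<close>
  define F where "F x = max 0 (lim (\<lambda>n. f n x))" for x
  have [measurable]: "F \<in> borel_measurable M" unfolding F_def by measurable
  have F0: "F x \<ge> 0" for x by (simp add: F_def)
  have lim: "AE x in M. (\<lambda>n. f n x) \<longlonglongrightarrow> F x"
    using conv
  proof eventually_elim
    case (elim x)
    then have "(\<lambda>n. f n x) \<longlonglongrightarrow> lim (\<lambda>n. f n x)" by (simp add: convergent_LIMSEQ_iff)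
    moreover from this have "lim (\<lambda>n. f n x) \<ge> 0" using f(2) by (intro LIMSEQ_le_const) auto
    ultimately show ?case by (simp add: F_def)
  qed
  have fatou: "(\<integral>\<^sup>+x. ennreal \<bar>F x - f n x\<bar> \<partial>M) \<le> ennreal (c / 2 ^ n)" for n
  proof -
    have "(\<integral>\<^sup>+x. ennreal \<bar>F x - f n x\<bar> \<partial>M) = (\<integral>\<^sup>+x. liminf (\<lambda>m. ennreal \<bar>f m x - f n x\<bar>) \<partial>M)"
    proof (rule nn_integral_cong_AE)
      show "AE x in M. ennreal \<bar>F x - f n x\<bar> = liminf (\<lambda>m. ennreal \<bar>f m x - f n x\<bar>)"
        using lim
      proof eventually_elim
        case (elim x)
        then have "(\<lambda>m. ennreal \<bar>f m x - f n x\<bar>) \<longlonglongrightarrow> ennreal \<bar>F x - f n x\<bar>"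
          by (intro tendsto_intros) auto
        then show ?case by (intro lim_imp_Liminf[symmetric]) simp_all
      qed
    qed
    also have "\<dots> \<le> liminf (\<lambda>m. \<integral>\<^sup>+x. ennreal \<bar>f m x - f n x\<bar> \<partial>M)"
      by (rule nn_integral_liminf) auto
    also have "\<dots> \<le> liminf (\<lambda>m. ennreal (c / 2 ^ n))"
      by (intro Liminf_mono eventually_sequentiallyI[of n] nnC)
    also have "\<dots> = ennreal (c / 2 ^ n)" by (simp add: Liminf_const)
    finally show ?thesis .
  qed
  have intd: "integrable M (\<lambda>x. F x - f n x)" for n
  proof (rule integrableI_bounded)
    show "(\<integral>\<^sup>+x. ennreal (norm (F x - f n x)) \<partial>M) < \<infinity>"
      using fatou[of n] by (auto simp: less_top[symmetric] top_unique)
  qed auto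
  have "integrable M (\<lambda>x. (F x - f 0 x) + f 0 x)"
    by (intro integrable_arith intd f)
  then have intF: "integrable M F" by simp
  have "(\<integral>x. \<bar>F x - f n x\<bar> \<partial>M) \<le> c / 2 ^ n" for n
  proof -
    have "ennreal (\<integral>x. \<bar>F x - f n x\<bar> \<partial>M) = (\<integral>\<^sup>+x. ennreal \<bar>F x - f n x\<bar> \<partial>M)"
      using intd by (intro nn_integral_eq_integral[symmetric]) auto
    then have "ennreal (\<integral>x. \<bar>F x - f n x\<bar> \<partial>M) \<le> ennreal (c / 2 ^ n)"
      using fatou[of n] by simp
    then show ?thesis using c by (subst (asm) ennreal_le_iff) auto
  qed
  then show thesis using that[of F] intF F0 lim by blast
qed

lemma prob_space_density_iff:
  fixes f :: "'a \<Rightarrow> real"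
  assumes "integrable M f" "\<And>x. f x \<ge> 0"
  shows "prob_space (density M (\<lambda>x. ennreal (f x))) \<longleftrightarrow> (\<integral>x. f x \<partial>M) = 1"
proof -
  have "emeasure (density M (\<lambda>x. ennreal (f x))) (space M) = ennreal (\<integral>x. f x \<partial>M)"
    using assms by (subst emeasure_density) (auto simp: nn_integral_eq_integral cong: nn_integral_cong)
  moreover have "prob_space N \<longleftrightarrow> emeasure N (space N) = 1" for N :: "'a measure"
    by (auto intro: prob_spaceI dest: prob_space.emeasure_space_1)
  ultimately show ?thesis by simp
qed

text \<open>Convexity and closedness of \<open>C\<close> are asked for in terms of values on single
  sets, a form in which marginal constraints satisfy them at once. A minimizing sequence is Cauchy
  in L1 by \<open>near_minimizers_close\<close>, so no weak compactness is involved, and Fatou's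
  lemma gives lower semicontinuity. The last conclusion is a quantitative form of
  uniqueness.\<close>

theorem (in prob_space) information_projection:
  assumes C: "\<And>\<pi>. C \<pi> \<Longrightarrow> prob_on M \<pi>"
    and mid: "\<And>\<pi>1 \<pi>2 \<pi>. C \<pi>1 \<Longrightarrow> C \<pi>2 \<Longrightarrow> prob_on M \<pi> \<Longrightarrow>
      (\<And>A. A \<in> sets M \<Longrightarrow> measure \<pi> A = (measure \<pi>1 A + measure \<pi>2 A) / 2) \<Longrightarrow> C \<pi>"
    and lim: "\<And>\<pi>s \<pi>. (\<And>n::nat. C (\<pi>s n)) \<Longrightarrow> prob_on M \<pi> \<Longrightarrow>
      (\<And>A. A \<in> sets M \<Longrightarrow> (\<lambda>n. measure (\<pi>s n) A) \<longlonglongrightarrow> measure \<pi> A) \<Longrightarrow> C \<pi>"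
    and ex: "\<exists>\<pi>. C \<pi> \<and> KL \<pi> M < \<infinity>"
  obtains \<pi>' V where "C \<pi>'" "KL \<pi>' M = ereal V" "\<And>\<pi>. C \<pi> \<Longrightarrow> ereal V \<le> KL \<pi> M"
    "\<And>\<pi> A \<delta>. C \<pi> \<Longrightarrow> \<delta> > 0 \<Longrightarrow> KL \<pi> M \<le> ereal (V + \<delta>\<^sup>2) \<Longrightarrow> A \<in> sets M \<Longrightarrow>
      \<bar>measure \<pi> A - measure \<pi>' A\<bar> \<le> 17 * \<delta>"
proof -
  \<comment> \<open>Admissible measures of finite divergence are replaced by their densities;
    \<open>KLD\<close> and \<open>DKL\<close> translate between the two.\<close>
  define D where "D = {f :: 'a \<Rightarrow> real. integrable M f \<and> (\<forall>x. f x \<ge> 0) \<and> (\<integral>x. f x \<partial>M) = 1 \<and>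
    integrable M (\<lambda>x. f x * ln (f x)) \<and> C (density M (\<lambda>x. ennreal (f x)))}"
  define val where "val f = (\<integral>x. f x * ln (f x) \<partial>M)" for f :: "'a \<Rightarrow> real"
  have KLD: "KL (density M (\<lambda>x. ennreal (f x))) M = ereal (val f)" if "f \<in> D" for f
  proof -
    have f: "integrable M f" "\<And>x. f x \<ge> 0" "integrable M (\<lambda>x. f x * ln (f x))"
      using that by (auto simp: D_def)
    then have [measurable]: "f \<in> borel_measurable M" by auto
    have "integrable (density M (\<lambda>x. ennreal (f x))) (\<lambda>x. ln (f x))"
      using f by (subst integrable_real_density) auto
    moreover have "(\<integral>x. ln (f x) \<partial>density M (\<lambda>x. ennreal (f x))) = val f"
      using f by (subst integral_real_density) (auto simp: val_def)
    ultimately show ?thesis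
      using KL_density_eq_ext_integral[OF sigma_finite_measure_axioms, of f] f by (simp add: ext_integral_integrable)
  qed
  have DKL: "\<exists>f\<in>D. \<pi> = density M (\<lambda>x. ennreal (f x)) \<and> KL \<pi> M = ereal (val f)"
    if "C \<pi>" "KL \<pi> M < \<infinity>" for \<pi>
  proof -
    from KL_finite_density[OF prob_space_axioms C[OF that(1)] that(2)]
    obtain f :: "'a \<Rightarrow> real" where f: "f \<in> borel_measurable M" "\<And>x. f x \<ge> 0"
      "\<pi> = density M (\<lambda>x. ennreal (f x))" "integrable \<pi> (\<lambda>x. ln (f x))" by metis
    interpret \<pi>: prob_space \<pi> using C[OF that(1)] by (simp add: prob_on_def)
    have "integrable M f"
    proof (rule integrableI_nonneg)
      have "(\<integral>\<^sup>+x. ennreal (f x) \<partial>M) = emeasure \<pi> (space \<pi>)"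
        unfolding f(3) using f by (subst emeasure_density) (auto cong: nn_integral_cong)
      then show "(\<integral>\<^sup>+x. ennreal (f x) \<partial>M) < \<infinity>" using \<pi>.emeasure_space_1 by simp
    qed (use f in auto)
    moreover have "integrable M (\<lambda>x. f x * ln (f x))"
      using f(4) f(1,2) unfolding f(3) by (subst (asm) integrable_real_density) auto
    ultimately have "f \<in> D"
      using f that prob_space_density_iff[of M f] \<pi>.prob_space_axioms by (auto simp: D_def)
    then show ?thesis using f(3) KLD by auto
  qed
  have Dmid: "(\<lambda>x. (f x + g x) / 2) \<in> D" if "f \<in> D" "g \<in> D" for f g
  proof -
    let ?m = "\<lambda>x. (f x + g x) / 2"
    have fg: "integrable M f" "\<And>x. f x \<ge> 0" "integrable M (\<lambda>x. f x * ln (f x))" "(\<integral>x. f x \<partial>M) = 1"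
      "integrable M g" "\<And>x. g x \<ge> 0" "integrable M (\<lambda>x. g x * ln (g x))" "(\<integral>x. g x \<partial>M) = 1"
      "C (density M (\<lambda>x. ennreal (f x)))" "C (density M (\<lambda>x. ennreal (g x)))"
      using that by (auto simp: D_def)
    have m: "integrable M ?m" "\<And>x. ?m x \<ge> 0" "(\<integral>x. ?m x \<partial>M) = 1" using fg by auto
    have meas: "measure (density M (\<lambda>x. ennreal (k x))) A = (\<integral>x. k x * indicator A x \<partial>M)"
      if "integrable M k" "\<And>x. k x \<ge> 0" "A \<in> sets M" for k A
      using that by (rule measure_density_eq_integral)
    have "C (density M (\<lambda>x. ennreal (?m x)))"
    proof (rule mid[OF fg(9,10)])
      show "prob_on M (density M (\<lambda>x. ennreal (?m x)))"
        using prob_space_density_iff[of M ?m] m by (auto simp: prob_on_def)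
      fix A assume A: "A \<in> sets M"
      show "measure (density M (\<lambda>x. ennreal (?m x))) A =
        (measure (density M (\<lambda>x. ennreal (f x))) A + measure (density M (\<lambda>x. ennreal (g x))) A) / 2"
        using fg m A integrable_real_mult_indicator[OF A fg(1)] integrable_real_mult_indicator[OF A fg(5)]
        by (simp add: meas distrib_right)
    qed
    then show ?thesis
      using m midpoint_entropy_integrable[OF fg(1-3) fg(5-7)] fg by (auto simp: D_def)
  qed
  have val_ge: "val f \<ge> -1" if "f \<in> D" for f
  proof -
    have "(\<integral>x. -1 \<partial>M) \<le> val f"
      unfolding val_def using that by (intro integral_mono mult_ln_ge_minus_one) (auto simp: D_def)
    then show ?thesis by (simp add: prob_space)
  qed
  define V where "V = (INF f\<in>D. val f)"
  have Dne: "D \<noteq> {}" using ex DKL by blast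
  have bdd: "bdd_below (val ` D)" using val_ge by (intro bdd_belowI[of _ "-1"]) auto
  have V_le: "V \<le> val f" if "f \<in> D" for f
    unfolding V_def using bdd that by (rule cINF_lower)
  have close: "(\<integral>x. \<bar>f x - g x\<bar> \<partial>M) \<le> 17 * \<delta>"
    if "f \<in> D" "g \<in> D" "val f \<le> V + \<delta>\<^sup>2" "val g \<le> V + \<delta>\<^sup>2" "\<delta> > 0" for f g \<delta>
    using that V_le[OF Dmid[OF that(1,2)]]
    by (intro near_minimizers_close) (auto simp: D_def val_def)
  \<comment> \<open>The excess is a square because \<open>close\<close> takes its root: all terms
    from index \<open>n\<close> on are within \<open>17 / 2 ^ n\<close> of each other, the rate that
    \<open>L1_limit_of_rapidly_Cauchy\<close> expects.\<close>
  have "\<exists>f\<in>D. val f < V + (1 / 2 ^ n)\<^sup>2" for n :: nat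
  proof -
    have "V < V + (1 / 2 ^ n)\<^sup>2" by simp
    then show ?thesis
      unfolding V_def by (subst (asm) cINF_less_iff[OF Dne bdd])
  qed
  then obtain f where f: "\<And>n::nat. f n \<in> D" "\<And>n. val (f n) < V + (1 / 2 ^ n)\<^sup>2" by metis
  have fD: "integrable M (f n)" "f n x \<ge> 0" "(\<integral>x. f n x \<partial>M) = 1"
    "integrable M (\<lambda>x. f n x * ln (f n x))" "C (density M (\<lambda>x. ennreal (f n x)))" for n x
    using f(1)[of n] by (auto simp: D_def)
  have "(\<integral>x. \<bar>f m x - f n x\<bar> \<partial>M) \<le> 17 / 2 ^ n" if "n \<le> m" for m n
  proof -
    have "(1 / 2 ^ m)\<^sup>2 \<le> (1 / 2 ^ n :: real)\<^sup>2"
      using that by (intro power_mono) (auto simp: field_simps)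
    then have "val (f m) \<le> V + (1 / 2 ^ n)\<^sup>2" using f(2)[of m] by linarith
    then have "(\<integral>x. \<bar>f m x - f n x\<bar> \<partial>M) \<le> 17 * (1 / 2 ^ n)"
      using f(2)[of n] by (intro close f) auto
    then show ?thesis by simp
  qed
  from L1_limit_of_rapidly_Cauchy[OF fD(1,2) this]
  obtain F where F: "integrable M F" "\<And>x. F x \<ge> 0" "AE x in M. (\<lambda>n. f n x) \<longlonglongrightarrow> F x"
    "\<And>n. (\<integral>x. \<bar>F x - f n x\<bar> \<partial>M) \<le> 17 / 2 ^ n" by auto
  have [measurable]: "F \<in> borel_measurable M" "\<And>n. f n \<in> borel_measurable M" using F fD by auto
  have small: "(\<lambda>n. 17 / 2 ^ n :: real) \<longlonglongrightarrow> 0"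
    using tendsto_mult_right[OF LIMSEQ_power_zero[of "1 / 2 :: real"], of 17] by (simp add: power_divide)
  have setwise: "(\<lambda>n. measure (density M (f n)) A) \<longlonglongrightarrow> measure (density M F) A" if "A \<in> sets M" for A
  proof (rule LIM_zero_cancel, rule Lim_null_comparison[OF _ small])
    show "\<forall>\<^sub>F n in sequentially. norm (measure (density M (f n)) A - measure (density M F) A) \<le> 17 / 2 ^ n"
    proof (rule always_eventually, rule allI)
      fix n
      show "norm (measure (density M (f n)) A - measure (density M F) A) \<le> 17 / 2 ^ n"
        using measure_density_diff_le[OF F(1,2) fD(1,2)[of n] that] F(4)[of n] by (simp add: abs_minus_commute)
    qed
  qed
  have F1: "(\<integral>x. F x \<partial>M) = 1"
  proof -
    have "(\<lambda>n. measure (density M (f n)) (space M)) \<longlonglongrightarrow> measure (density M F) (space M)"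
      by (rule setwise) auto
    moreover have "measure (density M (f n)) (space M) = 1" for n
      using prob_space.prob_space[of "density M (f n)"] prob_space_density_iff[of M "f n"] fD by simp
    ultimately have "measure (density M F) (space M) = 1"
      by (simp add: LIMSEQ_const_iff)
    then show ?thesis
      using F by (subst (asm) measure_density_eq_integral) (auto cong: Bochner_Integration.integral_cong)
  qed
  have CF: "C (density M F)"
  proof (rule lim[of "\<lambda>n. density M (\<lambda>x. ennreal (f n x))"])
    show "prob_on M (density M (\<lambda>x. ennreal (F x)))"
      using F F1 prob_space_density_iff[of M F] by (auto simp: prob_on_def)
  qed (use fD setwise in auto)
  \<comment> \<open>Fatou's lemma requires nonnegative integrands; the added 1 has integral 1 and is
    removed at the end.\<close>
  have hge: "t * ln t + 1 \<ge> 0" if "t \<ge> 0" for t :: real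
    using mult_ln_ge_minus_one[OF that] by simp
  have "(\<integral>\<^sup>+x. ennreal (F x * ln (F x) + 1) \<partial>M) = (\<integral>\<^sup>+x. liminf (\<lambda>n. ennreal (f n x * ln (f n x) + 1)) \<partial>M)"
  proof (rule nn_integral_cong_AE)
    show "AE x in M. ennreal (F x * ln (F x) + 1) = liminf (\<lambda>n. ennreal (f n x * ln (f n x) + 1))"
      using F(3)
    proof eventually_elim
      case (elim x)
      then have "(\<lambda>n. ennreal (f n x * ln (f n x) + 1)) \<longlonglongrightarrow> ennreal (F x * ln (F x) + 1)"
        by (intro tendsto_ennrealI tendsto_add tendsto_mult_ln tendsto_const fD)
      then show ?case by (intro lim_imp_Liminf[symmetric]) simp_all
    qed
  qed
  also have "\<dots> \<le> liminf (\<lambda>n. \<integral>\<^sup>+x. ennreal (f n x * ln (f n x) + 1) \<partial>M)"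
    by (rule nn_integral_liminf) auto
  also have "\<dots> \<le> liminf (\<lambda>n. ennreal (V + (1 / 2 ^ n)\<^sup>2 + 1))"
  proof (rule Liminf_mono, rule always_eventually, rule allI)
    fix n
    have "(\<integral>\<^sup>+x. ennreal (f n x * ln (f n x) + 1) \<partial>M) = ennreal (\<integral>x. f n x * ln (f n x) + 1 \<partial>M)"
      using fD by (intro nn_integral_eq_integral) (auto intro!: hge)
    also have "(\<integral>x. f n x * ln (f n x) + 1 \<partial>M) = val (f n) + 1"
      using fD by (simp add: val_def prob_space)
    finally show "(\<integral>\<^sup>+x. ennreal (f n x * ln (f n x) + 1) \<partial>M) \<le> ennreal (V + (1 / 2 ^ n)\<^sup>2 + 1)"
      using f(2)[of n] by (auto intro: ennreal_leI)
  qed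
  also have "\<dots> = ennreal (V + 0\<^sup>2 + 1)"
  proof (rule lim_imp_Liminf)
    have "(\<lambda>n. 1 / 2 ^ n :: real) \<longlonglongrightarrow> 0"
      using LIMSEQ_power_zero[of "1 / 2 :: real"] by (simp add: power_divide)
    then show "(\<lambda>n. ennreal (V + (1 / 2 ^ n)\<^sup>2 + 1)) \<longlonglongrightarrow> ennreal (V + 0\<^sup>2 + 1)"
      by (intro tendsto_ennrealI tendsto_intros)
  qed simp
  finally have le: "(\<integral>\<^sup>+x. ennreal (F x * ln (F x) + 1) \<partial>M) \<le> ennreal (V + 1)" by simp
  have "integrable M (\<lambda>x. F x * ln (F x) + 1)"
    using le F by (intro integrableI_nonneg) (auto intro!: hge simp: less_top[symmetric] top_unique)
  from Bochner_Integration.integrable_diff[OF this integrable_const[of 1]]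
  have intF: "integrable M (\<lambda>x. F x * ln (F x))" by simp
  have FD: "F \<in> D" using F F1 CF intF by (auto simp: D_def)
  have "ennreal (val F + 1) = (\<integral>\<^sup>+x. ennreal (F x * ln (F x) + 1) \<partial>M)"
    using F intF by (subst nn_integral_eq_integral) (auto intro!: hge simp: val_def prob_space)
  then have "ennreal (val F + 1) \<le> ennreal (V + 1)" using le by simp
  moreover have "-1 \<le> V" unfolding V_def using val_ge by (intro cINF_greatest Dne) auto
  ultimately have valF: "val F = V"
    using V_le[OF FD] by (subst (asm) ennreal_le_iff) auto
  show thesis
  proof (rule that[of "density M F" V])
    show "C (density M F)" by fact
    show "KL (density M F) M = ereal V" using KLD[OF FD] valF by simp
    show "ereal V \<le> KL \<pi> M" if "C \<pi>" for \<pi>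
    proof (cases "KL \<pi> M < \<infinity>")
      case True
      then show ?thesis using DKL[OF that] V_le by auto
    qed simp
    fix \<pi> A \<delta> assume *: "C \<pi>" "(0::real) < \<delta>" "KL \<pi> M \<le> ereal (V + \<delta>\<^sup>2)" "A \<in> sets M"
    then have "KL \<pi> M < \<infinity>" by (auto simp: less_top[symmetric] top_ereal_def)
    from DKL[OF *(1) this] obtain g where g: "g \<in> D" "\<pi> = density M (\<lambda>x. ennreal (g x))" "KL \<pi> M = ereal (val g)"
      by auto
    have "\<bar>measure \<pi> A - measure (density M F) A\<bar> \<le> (\<integral>x. \<bar>g x - F x\<bar> \<partial>M)"
      unfolding g(2) using g(1) F *(4) by (intro measure_density_diff_le) (auto simp: D_def)
    also have "\<dots> \<le> 17 * \<delta>"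
      using * g valF by (intro close FD) auto
    finally show "\<bar>measure \<pi> A - measure (density M F) A\<bar> \<le> 17 * \<delta>" .
  qed
qed

section \<open>Gaussian kernels on the star\<close>

definition gauss_density :: "real \<Rightarrow> real ^ 'd \<Rightarrow> real ^ 'd \<Rightarrow> real" where
  "gauss_density v m x = (\<Prod>i\<in>UNIV. normal_density (m $ i) (sqrt v) (x $ i))"

lemma gaussian_eq_density: "gaussian m v = density lborel (\<lambda>x. ennreal (gauss_density v m x))"
  by (simp add: gaussian_def gauss_density_def)

lemma gauss_density_sym: "gauss_density v m x = gauss_density v x m"
  by (simp add: gauss_density_def normal_density_def power2_commute)

lemma gauss_density_pos: "v > 0 \<Longrightarrow> gauss_density v m x > 0"
  by (auto simp: gauss_density_def intro!: prod_pos normal_density_pos)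

lemma gauss_density_nonneg [simp]: "gauss_density v m x \<ge> 0"
  by (auto simp: gauss_density_def intro!: prod_nonneg)

lemma gauss_density_measurable [measurable]:
  assumes [measurable]: "f \<in> M \<rightarrow>\<^sub>M borel" "g \<in> M \<rightarrow>\<^sub>M borel"
  shows "(\<lambda>x. gauss_density v (f x :: real ^ 'd) (g x)) \<in> borel_measurable M"
  unfolding gauss_density_def normal_density_def cart_eq_inner_axis by measurable

lemma nn_integral_normal_density:
  "\<sigma> > 0 \<Longrightarrow> (\<integral>\<^sup>+x. ennreal (normal_density m \<sigma> x) \<partial>lborel) = 1"
  by (subst nn_integral_eq_integral) auto

lemma nn_integral_gauss_density:
  fixes m :: "real ^ 'd"
  assumes "v > 0"
  shows "(\<integral>\<^sup>+x. ennreal (gauss_density v m x) \<partial>lborel) = 1"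
    and "(\<integral>\<^sup>+x. ennreal (gauss_density v x m) \<partial>lborel) = 1"
proof -
  have Basis: "(\<Prod>b\<in>(Basis :: (real ^ 'd) set). h b) = (\<Prod>i\<in>UNIV. h (axis i 1))" for h :: "real ^ 'd \<Rightarrow> ennreal"
  proof (rule prod.reindex_cong)
    show "inj_on (\<lambda>i :: 'd. axis i (1 :: real)) UNIV" by (auto simp: inj_on_def axis_eq_axis)
    show "(Basis :: (real ^ 'd) set) = range (\<lambda>i. axis i 1)" by (auto simp: Basis_vec_def)
  qed simp
  have "(\<integral>\<^sup>+x. ennreal (gauss_density v m x) \<partial>lborel) =
    (\<integral>\<^sup>+x. (\<Prod>b\<in>Basis. ennreal (normal_density (m \<bullet> b) (sqrt v) (x \<bullet> b))) \<partial>lborel)"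
    unfolding Basis gauss_density_def cart_eq_inner_axis[symmetric] by (simp add: prod_ennreal)
  also have "\<dots> = (\<Prod>b\<in>(Basis :: (real ^ 'd) set). (\<integral>\<^sup>+x. ennreal (normal_density (m \<bullet> b) (sqrt v) x) \<partial>lborel))"
    by (rule nn_integral_lborel_prod) auto
  also have "\<dots> = 1"
    using assms by (simp add: nn_integral_normal_density)
  finally show "(\<integral>\<^sup>+x. ennreal (gauss_density v m x) \<partial>lborel) = 1" .
  then show "(\<integral>\<^sup>+x. ennreal (gauss_density v x m) \<partial>lborel) = 1"
    by (simp add: gauss_density_sym[of v m])
qed

lemma norm_vec_power2: "(norm (x :: real ^ 'd))\<^sup>2 = (\<Sum>i\<in>UNIV. (x $ i)\<^sup>2)"
  by (simp add: norm_vec_def L2_set_def sum_nonneg)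

lemma gauss_density_eq_exp:
  fixes m x :: "real ^ 'd"
  assumes "v > 0"
  shows "gauss_density v m x = (1 / sqrt (2 * pi * v)) ^ CARD('d) * exp (- (norm (x - m))\<^sup>2 / (2 * v))"
proof -
  have "gauss_density v m x =
    (\<Prod>i\<in>UNIV. (1 / sqrt (2 * pi * v)) * exp (- (x $ i - m $ i)\<^sup>2 / (2 * v)))"
    using assms by (simp add: gauss_density_def normal_density_def)
  also have "\<dots> = (1 / sqrt (2 * pi * v)) ^ CARD('d) * exp (\<Sum>i\<in>UNIV. - (x $ i - m $ i)\<^sup>2 / (2 * v))"
    by (simp only: prod.distrib prod_constant exp_sum finite)
  also have "(\<Sum>i\<in>UNIV. - (x $ i - m $ i)\<^sup>2 / (2 * v)) = - (norm (x - m))\<^sup>2 / (2 * v)"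
    by (simp only: norm_vec_power2 sum_divide_distrib[symmetric] sum_negf vector_minus_component)
  finally show ?thesis .
qed

lemma ln_gauss_density:
  fixes m x :: "real ^ 'd"
  assumes "v > 0"
  shows "ln (gauss_density v m x) = CARD('d) * ln (1 / sqrt (2 * pi * v)) - (norm (x - m))\<^sup>2 / (2 * v)"
  using assms unfolding gauss_density_eq_exp[OF assms]
  by (subst ln_mult) (auto simp: ln_realpow)

text \<open>The exponents combine as
  \<open>- 1 / (2 * v) + 1 / (4 * v) = - 1 / (2 * (2 * v))\<close>, so tilting doubles the variance,
  and the normalising constants differ by \<open>sqrt 2\<close> per coordinate. Hence this
  exponential moment of the squared distance is finite.\<close>

lemma gauss_density_mult_exp:
  fixes m :: "real ^ 'd"
  assumes "v > 0"
  shows "gauss_density v m x * exp ((norm (x - m))\<^sup>2 / (4 * v)) = sqrt 2 ^ CARD('d) * gauss_density (2 * v) m x"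
proof -
  have "1 / sqrt (2 * pi * v) = sqrt 2 * (1 / sqrt (2 * pi * (2 * v)))"
  proof -
    have "sqrt (2 * pi * (2 * v)) = sqrt 2 * sqrt (2 * pi * v)"
      unfolding real_sqrt_mult[symmetric] by (simp only: mult_ac)
    then show ?thesis by simp
  qed
  moreover have "exp (- (norm (x - m))\<^sup>2 / (2 * v)) * exp ((norm (x - m))\<^sup>2 / (4 * v)) =
    exp (- (norm (x - m))\<^sup>2 / (2 * (2 * v)))"
    using assms by (simp add: exp_add[symmetric] field_simps)
  moreover have "2 * v > 0" using assms by simp
  ultimately show ?thesis
    using assms by (simp only: gauss_density_eq_exp power_mult_distrib mult.assoc)
qed

lemma prob_space_gaussian: "v > 0 \<Longrightarrow> prob_space (gaussian m v)"
  by (rule prob_spaceI) (simp add: gaussian_eq_density emeasure_density nn_integral_gauss_density)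

lemma sets_gaussian [simp, measurable_cong]: "sets (gaussian m v) = sets borel"
  by (simp add: gaussian_eq_density)

lemma space_gaussian [simp]: "space (gaussian m v) = UNIV"
  by (simp add: gaussian_eq_density)

lemma gaussian_measurable:
  assumes "v > 0"
  shows "(\<lambda>m. gaussian m v) \<in> borel \<rightarrow>\<^sub>M subprob_algebra borel"
proof (rule measurable_subprob_algebra)
  fix A :: "(real ^ 'd) set" assume [measurable]: "A \<in> sets borel"
  have "emeasure (gaussian m v) A = (\<integral>\<^sup>+x. ennreal (gauss_density v m x) * indicator A x \<partial>lborel)" for m
    unfolding gaussian_eq_density by (subst emeasure_density) auto
  then show "(\<lambda>m. emeasure (gaussian m v) A) \<in> borel_measurable borel" by simp
qed (auto intro: prob_space_imp_subprob_space prob_space_gaussian assms)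

lemma PiM_density:
  fixes f :: "'i \<Rightarrow> 'a \<Rightarrow> ennreal"
  assumes "finite I" "\<And>i. sigma_finite_measure (M i)"
    and [measurable]: "\<And>i. i \<in> I \<Longrightarrow> f i \<in> borel_measurable (M i)"
    and prob: "\<And>i. prob_space (density (M i) (f i))"
  shows "Pi\<^sub>M I (\<lambda>i. density (M i) (f i)) = density (Pi\<^sub>M I M) (\<lambda>x. \<Prod>i\<in>I. f i (x i))"
proof -
  interpret M: product_sigma_finite M using assms by (simp add: product_sigma_finite_def)
  interpret D: product_sigma_finite "\<lambda>i. density (M i) (f i)"
    using prob by (auto simp: product_sigma_finite_def prob_space_imp_sigma_finite)
  have "density (Pi\<^sub>M I M) (\<lambda>x. \<Prod>i\<in>I. f i (x i)) = Pi\<^sub>M I (\<lambda>i. density (M i) (f i))"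
  proof (rule D.PiM_eqI)
    show "sets (density (Pi\<^sub>M I M) (\<lambda>x. \<Prod>i\<in>I. f i (x i))) = sets (Pi\<^sub>M I (\<lambda>i. density (M i) (f i)))"
      by (auto intro!: sets_PiM_cong)
    fix A assume A: "\<And>i. i \<in> I \<Longrightarrow> A i \<in> sets (density (M i) (f i))"
    then have [measurable]: "\<And>i. i \<in> I \<Longrightarrow> A i \<in> sets (M i)" by simp
    have "Pi\<^sub>E I A \<in> sets (Pi\<^sub>M I M)"
      using assms(1) A by (intro sets_PiM_I_finite) auto
    then have "emeasure (density (Pi\<^sub>M I M) (\<lambda>x. \<Prod>i\<in>I. f i (x i))) (Pi\<^sub>E I A) =
      (\<integral>\<^sup>+x. (\<Prod>i\<in>I. f i (x i)) * indicator (Pi\<^sub>E I A) x \<partial>Pi\<^sub>M I M)"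
      by (intro emeasure_density) auto
    also have "\<dots> = (\<integral>\<^sup>+x. (\<Prod>i\<in>I. f i (x i) * indicator (A i) (x i)) \<partial>Pi\<^sub>M I M)"
    proof (rule nn_integral_cong)
      fix x assume "x \<in> space (Pi\<^sub>M I M)"
      then have "indicator (Pi\<^sub>E I A) x = (\<Prod>i\<in>I. indicator (A i) (x i) :: ennreal)"
        using assms(1) by (auto simp: indicator_def space_PiM PiE_iff prod_zero_iff)
      then show "(\<Prod>i\<in>I. f i (x i)) * indicator (Pi\<^sub>E I A) x = (\<Prod>i\<in>I. f i (x i) * indicator (A i) (x i))"
        by (simp add: prod.distrib)
    qed
    also have "\<dots> = (\<Prod>i\<in>I. \<integral>\<^sup>+x. f i x * indicator (A i) x \<partial>M i)"
      using assms(1) by (intro M.product_nn_integral_prod) auto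
    also have "\<dots> = (\<Prod>i\<in>I. emeasure (density (M i) (f i)) (A i))"
      by (intro prod.cong) (auto simp: emeasure_density)
    finally show "emeasure (density (Pi\<^sub>M I M) (\<lambda>x. \<Prod>i\<in>I. f i (x i))) (Pi\<^sub>E I A) =
      (\<Prod>i\<in>I. emeasure (density (M i) (f i)) (A i))" .
  qed fact
  then show ?thesis by simp
qed

section \<open>Lebesgue measure on the star and the density of the reference measure\<close>

definition star_lborel :: "nat \<Rightarrow> (nat \<Rightarrow> 'a::euclidean_space) measure" where
  "star_lborel l = Pi\<^sub>M {0..l} (\<lambda>_. lborel)"

lemma sets_star_lborel [simp, measurable_cong]: "sets (star_lborel l) = sets (star_space l)"
  unfolding star_lborel_def by (intro sets_PiM_cong) auto

text \<open>With the centre fixed the leaves separate, so integrating the centre last turns the leaf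
  integral into a product. The masses of star-shaped densities below are computed this way.\<close>

lemma nn_integral_star_lborel:
  fixes f :: "'a::euclidean_space \<Rightarrow> ennreal" and h :: "nat \<Rightarrow> 'a \<Rightarrow> 'a \<Rightarrow> ennreal"
  assumes [measurable]: "f \<in> borel_measurable borel"
    and h [measurable]: "\<And>i. i \<in> {1..l} \<Longrightarrow> (\<lambda>(y, z). h i y z) \<in> borel_measurable (borel \<Otimes>\<^sub>M borel)"
  shows "(\<integral>\<^sup>+x. f (x 0) * (\<Prod>i\<in>{1..l}. h i (x 0) (x i)) \<partial>star_lborel l) =
    (\<integral>\<^sup>+y. f y * (\<Prod>i\<in>{1..l}. \<integral>\<^sup>+z. h i y z \<partial>lborel) \<partial>lborel)"
proof -
  interpret product_sigma_finite "\<lambda>_::nat. lborel :: 'a measure"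
    by (simp add: product_sigma_finite_def lborel.sigma_finite_measure_axioms)
  have I: "{0..l} = insert 0 {1..l}" by auto
  have hm [measurable]: "(\<lambda>x. h i (p x) (q x)) \<in> borel_measurable N"
    if "i \<in> {1..l}" "p \<in> N \<rightarrow>\<^sub>M borel" "q \<in> N \<rightarrow>\<^sub>M borel" for i p q and N :: "'b measure"
    using measurable_compose[OF measurable_Pair[OF that(2,3)] h[OF that(1)]] by simp
  have "(\<integral>\<^sup>+x. f (x 0) * (\<Prod>i\<in>{1..l}. h i (x 0) (x i)) \<partial>star_lborel l) =
    (\<integral>\<^sup>+y. (\<integral>\<^sup>+x. f ((x(0 := y)) 0) * (\<Prod>i\<in>{1..l}. h i ((x(0 := y)) 0) ((x(0 := y)) i)) \<partial>Pi\<^sub>M {1..l} (\<lambda>_. lborel)) \<partial>lborel)"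
    unfolding star_lborel_def I by (rule product_nn_integral_insert_rev) auto
  also have "\<dots> = (\<integral>\<^sup>+y. (\<integral>\<^sup>+x. f y * (\<Prod>i\<in>{1..l}. h i y (x i)) \<partial>Pi\<^sub>M {1..l} (\<lambda>_. lborel)) \<partial>lborel)"
    by (intro nn_integral_cong arg_cong2[where f="(*)"] prod.cong) auto
  also have "\<dots> = (\<integral>\<^sup>+y. f y * (\<integral>\<^sup>+x. (\<Prod>i\<in>{1..l}. h i y (x i)) \<partial>Pi\<^sub>M {1..l} (\<lambda>_. lborel)) \<partial>lborel)"
    by (intro nn_integral_cong nn_integral_cmult) auto
  also have "\<dots> = (\<integral>\<^sup>+y. f y * (\<Prod>i\<in>{1..l}. \<integral>\<^sup>+z. h i y z \<partial>lborel) \<partial>lborel)"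
    by (intro nn_integral_cong arg_cong2[where f="(*)"] refl product_nn_integral_prod) auto
  finally show ?thesis .
qed

lemma PiM_gaussian:
  fixes m :: "real ^ 'd"
  assumes "finite I" "\<And>i. i \<in> I \<Longrightarrow> v i > 0"
  shows "Pi\<^sub>M I (\<lambda>i. gaussian m (v i)) =
    density (Pi\<^sub>M I (\<lambda>_. lborel)) (\<lambda>x. ennreal (\<Prod>i\<in>I. gauss_density (v i) m (x i)))"
proof -
  \<comment> \<open>\<open>PiM_density\<close> wants a probability density at every index, also
    outside \<open>I\<close>; the variance 1 there is a dummy.\<close>
  define v' where "v' i = (if i \<in> I then v i else 1)" for i
  have v': "v' i > 0" for i using assms by (auto simp: v'_def)
  have "Pi\<^sub>M I (\<lambda>i. gaussian m (v i)) = Pi\<^sub>M I (\<lambda>i. density lborel (\<lambda>x. ennreal (gauss_density (v' i) m x)))"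
    by (intro PiM_cong) (auto simp: v'_def gaussian_eq_density)
  also have "\<dots> = density (Pi\<^sub>M I (\<lambda>_. lborel)) (\<lambda>x. \<Prod>i\<in>I. ennreal (gauss_density (v' i) m (x i)))"
    using assms v' by (intro PiM_density) (auto simp: lborel.sigma_finite_measure_axioms
        gaussian_eq_density[symmetric] prob_space_gaussian)
  also have "(\<lambda>x. \<Prod>i\<in>I. ennreal (gauss_density (v' i) m (x i))) =
    (\<lambda>x. ennreal (\<Prod>i\<in>I. gauss_density (v i) m (x i)))"
    by (auto simp: v'_def prod_ennreal[symmetric])
  finally show ?thesis .
qed

text \<open>The kernel on the edge from \<open>r\<close> to the centre is a Gaussian density in
  \<open>x 0\<close> centred at \<open>x r\<close>; being symmetric, it is also the factor of edge
  \<open>r\<close> seen from the centre. The orientation of the tree thus disappears, and the root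
  leaves only the factor \<open>ldens \<mu> (x r)\<close>.\<close>

lemma star_reference_eq_density:
  fixes \<mu> :: "(real ^ 'd) measure"
  assumes \<epsilon>: "\<epsilon> > 0" and w: "\<And>i. i \<in> {1..l} \<Longrightarrow> w i > 0" and r: "r \<in> {1..l}"
    and \<mu>: "prob_on borel \<mu>" "absolutely_continuous lborel \<mu>"
  shows "star_reference \<epsilon> l w r \<mu> = density (star_lborel l)
    (\<lambda>x. ennreal (ldens \<mu> (x r) * (\<Prod>i\<in>{1..l}. gauss_density (\<epsilon> / (2 * w i)) (x 0) (x i))))"
proof -
  define s where "s i = \<epsilon> / (2 * w i)" for i
  define J where "J = {1..l} - {r}"
  define \<phi> where "\<phi> = ldens \<mu>"
  define L where "L = (\<lambda>_::nat. lborel :: (real ^ 'd) measure)"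
  define upd where "upd y xr x0 = y(r := xr, 0 := x0)" for y :: "nat \<Rightarrow> real ^ 'd" and xr x0
  define K where "K xr x0 = distr (Pi\<^sub>M J (\<lambda>i. gaussian x0 (s i))) (star_space l) (\<lambda>y. upd y xr x0)" for xr x0
  interpret product_sigma_finite L
    by (simp add: L_def product_sigma_finite_def lborel.sigma_finite_measure_axioms)
  interpret \<mu>: prob_space \<mu> using \<mu> by (simp add: prob_on_def)
  have sets_\<mu> [measurable_cong, simp]: "sets \<mu> = sets borel" using \<mu> by (simp add: prob_on_def)
  have s: "s i > 0" if "i \<in> {1..l}" for i using that \<epsilon> w by (simp add: s_def)
  have J [simp]: "finite J" "0 \<notin> J" "r \<notin> J" "r \<noteq> 0" using r by (auto simp: J_def)
  have sJ: "s i > 0" if "i \<in> J" for i using that s by (auto simp: J_def)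
  have I: "{0..l} = insert r (insert 0 J)" "{1..l} = insert r J" using r by (auto simp: J_def)
  have [measurable_cong]: "sets (Pi\<^sub>M X L) = sets (Pi\<^sub>M X (\<lambda>_. borel))" for X
    by (intro sets_PiM_cong) (auto simp: L_def)
  interpret J: sigma_finite_measure "Pi\<^sub>M J L" by (rule sigma_finite) simp
  have [measurable]: "\<phi> \<in> borel_measurable borel" by (simp add: \<phi>_def)
  have upd [measurable]: "(\<lambda>z. upd (a z) (b z) (c z)) \<in> N \<rightarrow>\<^sub>M star_space l"
    if [measurable]: "a \<in> N \<rightarrow>\<^sub>M Pi\<^sub>M J (\<lambda>_. borel)" "b \<in> borel_measurable N" "c \<in> borel_measurable N"
    for a b c and N :: "'b measure"
    unfolding upd_def
    by (rule measurable_fun_upd[where J="insert r J"], use I in blast,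
        rule measurable_fun_upd[where J=J], auto)
  have Jpi: "Pi\<^sub>M J (\<lambda>i. gaussian x0 (s i)) =
    density (Pi\<^sub>M J L) (\<lambda>x. ennreal (\<Prod>i\<in>J. gauss_density (s i) x0 (x i)))" for x0 :: "real ^ 'd"
    unfolding L_def by (rule PiM_gaussian) (auto simp: sJ)
  have [measurable_cong]: "sets (Pi\<^sub>M J (\<lambda>i. gaussian x0 (s i))) = sets (Pi\<^sub>M J (\<lambda>_. borel))" for x0 :: "real ^ 'd"
    by (intro sets_PiM_cong) auto
  have emK: "emeasure (K xr x0) A =
    (\<integral>\<^sup>+y. ennreal (\<Prod>i\<in>J. gauss_density (s i) x0 (y i)) * indicator A (upd y xr x0) \<partial>Pi\<^sub>M J L)"
    if [measurable]: "A \<in> sets (star_space l)" for A xr x0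
  proof -
    have "emeasure (K xr x0) A = (\<integral>\<^sup>+x. indicator A x \<partial>K xr x0)"
      by (subst nn_integral_indicator) (auto simp: K_def)
    also have "\<dots> = (\<integral>\<^sup>+y. indicator A (upd y xr x0) \<partial>Pi\<^sub>M J (\<lambda>i. gaussian x0 (s i)))"
      unfolding K_def by (rule nn_integral_distr) auto
    also have "\<dots> = (\<integral>\<^sup>+y. ennreal (\<Prod>i\<in>J. gauss_density (s i) x0 (y i)) * indicator A (upd y xr x0) \<partial>Pi\<^sub>M J L)"
      unfolding Jpi by (rule nn_integral_density) auto
    finally show ?thesis .
  qed
  have probK: "prob_space (K xr x0)" for xr x0
  proof -
    interpret P: prob_space "Pi\<^sub>M J (\<lambda>i. gaussian x0 (s i))"
      by (intro prob_space_PiM prob_space_gaussian sJ)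
    show ?thesis unfolding K_def by (rule P.prob_space_distr) measurable
  qed
  \<comment> \<open>The outer bind demands joint measurability in both parameters. By
    \<open>emK\<close> they occur only in the integrand over a fixed base measure.\<close>
  have Kmeas: "(\<lambda>z. K (fst z) (snd z)) \<in> borel \<Otimes>\<^sub>M borel \<rightarrow>\<^sub>M subprob_algebra (star_space l)"
  proof (rule measurable_subprob_algebra)
    fix A :: "(nat \<Rightarrow> real ^ 'd) set" assume [measurable]: "A \<in> sets (star_space l)"
    show "(\<lambda>z. emeasure (K (fst z) (snd z)) A) \<in> borel_measurable (borel \<Otimes>\<^sub>M borel)"
      unfolding emK[OF \<open>A \<in> _\<close>] by measurable
  next
    show "subprob_space (K (fst z) (snd z))" for z
      by (intro prob_space_imp_subprob_space probK)
    show "sets (K (fst z) (snd z)) = sets (star_space l)" for z by (simp add: K_def)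
  qed
  have Kmeas1 [measurable]: "K xr \<in> borel \<rightarrow>\<^sub>M subprob_algebra (star_space l)" for xr
    using measurable_compose[OF measurable_Pair1'[of xr borel borel] Kmeas] by simp
  have Kgauss: "K xr \<in> gaussian xr (s r) \<rightarrow>\<^sub>M subprob_algebra (star_space l)" for xr
    using Kmeas1 by (simp cong: measurable_cong_sets)
  have bindm: "(\<lambda>xr. gaussian xr (s r) \<bind> K xr) \<in> borel \<rightarrow>\<^sub>M subprob_algebra (star_space l)"
    using Kmeas s[OF r]
    by (intro measurable_bind[where N=borel] gaussian_measurable) (auto simp: case_prod_beta')
  have ref: "star_reference \<epsilon> l w r \<mu> = \<mu> \<bind> (\<lambda>xr. gaussian xr (s r) \<bind> K xr)"
    unfolding star_reference_def K_def upd_def J_def s_def ..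
  have bindm': "(\<lambda>xr. gaussian xr (s r) \<bind> K xr) \<in> \<mu> \<rightarrow>\<^sub>M subprob_algebra (star_space l)"
    using bindm by (simp cong: measurable_cong_sets)
  show ?thesis
  proof (rule measure_eqI)
    show "sets (star_reference \<epsilon> l w r \<mu>) = sets (density (star_lborel l)
      (\<lambda>x. ennreal (ldens \<mu> (x r) * (\<Prod>i\<in>{1..l}. gauss_density (\<epsilon> / (2 * w i)) (x 0) (x i)))))"
      unfolding ref by (subst sets_bind[OF sets_kernel[OF bindm']]) (auto simp: \<mu>.not_empty)
    fix A assume "A \<in> sets (star_reference \<epsilon> l w r \<mu>)"
    then have A [measurable]: "A \<in> sets (star_space l)"
      unfolding ref by (subst (asm) sets_bind[OF sets_kernel[OF bindm']]) (auto simp: \<mu>.not_empty)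
    let ?F = "\<lambda>x. ennreal (\<phi> (x r) * (\<Prod>i\<in>{1..l}. gauss_density (s i) (x 0) (x i))) * indicator A x"
    let ?G = "\<lambda>xr x0 y. ennreal (\<Prod>i\<in>J. gauss_density (s i) x0 (y i)) * indicator A (upd y xr x0)"
    have comp: "(\<lambda>x. x i) \<in> borel_measurable (star_space l)" if "i \<in> {0..l}" for i
      using that by (rule measurable_component_singleton)
    have F [measurable]: "?F \<in> borel_measurable (star_space l)"
      using r by (intro borel_measurable_times_ennreal measurable_compose[OF _ measurable_ennreal]
          borel_measurable_times borel_measurable_prod gauss_density_measurable
          measurable_compose[OF comp \<open>\<phi> \<in> _\<close>] comp borel_measurable_indicator A) auto
    have "emeasure (star_reference \<epsilon> l w r \<mu>) A = (\<integral>\<^sup>+xr. emeasure (gaussian xr (s r) \<bind> K xr) A \<partial>\<mu>)"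
      unfolding ref by (rule emeasure_bind[OF \<mu>.not_empty bindm' A])
    also have "\<dots> = (\<integral>\<^sup>+xr. (\<integral>\<^sup>+x0. emeasure (K xr x0) A \<partial>gaussian xr (s r)) \<partial>\<mu>)"
      by (intro nn_integral_cong emeasure_bind[OF _ Kgauss A]) simp
    also have "\<dots> = (\<integral>\<^sup>+xr. (\<integral>\<^sup>+x0. (\<integral>\<^sup>+y. ?G xr x0 y \<partial>Pi\<^sub>M J L) \<partial>gaussian xr (s r)) \<partial>\<mu>)"
      by (simp add: emK[OF A])
    also have "\<dots> = (\<integral>\<^sup>+xr. (\<integral>\<^sup>+x0. ennreal (gauss_density (s r) xr x0) * (\<integral>\<^sup>+y. ?G xr x0 y \<partial>Pi\<^sub>M J L) \<partial>lborel) \<partial>\<mu>)"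
      unfolding gaussian_eq_density by (intro nn_integral_cong nn_integral_density) measurable
    also have "\<dots> = (\<integral>\<^sup>+xr. ennreal (\<phi> xr) *
        (\<integral>\<^sup>+x0. ennreal (gauss_density (s r) xr x0) * (\<integral>\<^sup>+y. ?G xr x0 y \<partial>Pi\<^sub>M J L) \<partial>lborel) \<partial>lborel)"
      by (subst density_lebesgue_density[OF \<mu>, symmetric], unfold \<phi>_def[symmetric],
          subst nn_integral_density) measurable
    also have "\<dots> = (\<integral>\<^sup>+xr. (\<integral>\<^sup>+x0. (\<integral>\<^sup>+y. ?F (upd y xr x0) \<partial>Pi\<^sub>M J L) \<partial>lborel) \<partial>lborel)"
    proof (rule nn_integral_cong)
      fix xr
      have F': "?F (upd y xr x0) = ennreal (\<phi> xr) * (ennreal (gauss_density (s r) xr x0) * ?G xr x0 y)" for x0 y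
      proof -
        have "(\<Prod>i\<in>{1..l}. gauss_density (s i) (upd y xr x0 0) (upd y xr x0 i)) =
          gauss_density (s r) x0 xr * (\<Prod>i\<in>J. gauss_density (s i) x0 (y i))"
          unfolding I(2) by (subst prod.insert) (auto simp: upd_def intro!: arg_cong2[where f="(*)"] prod.cong)
        moreover have "upd y xr x0 r = xr" by (simp add: upd_def)
        ultimately show ?thesis
          by (simp add: \<phi>_def ennreal_mult prod_nonneg mult.assoc gauss_density_sym[of _ x0 xr])
      qed
      show "ennreal (\<phi> xr) * (\<integral>\<^sup>+x0. ennreal (gauss_density (s r) xr x0) * (\<integral>\<^sup>+y. ?G xr x0 y \<partial>Pi\<^sub>M J L) \<partial>lborel)
        = (\<integral>\<^sup>+x0. (\<integral>\<^sup>+y. ?F (upd y xr x0) \<partial>Pi\<^sub>M J L) \<partial>lborel)"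
        unfolding F' by (simp add: nn_integral_cmult)
    qed
    \<comment> \<open>Coordinate \<open>r\<close> and then coordinate 0 are split off the product,
      matching the order of the two binds; \<open>fun_upd_twist\<close> reconciles the order of the
      updates.\<close>
    also have "\<dots> = (\<integral>\<^sup>+x. ?F x \<partial>Pi\<^sub>M {0..l} L)"
    proof -
      have "(\<integral>\<^sup>+x. ?F x \<partial>Pi\<^sub>M {0..l} L) =
        (\<integral>\<^sup>+xr. (\<integral>\<^sup>+x. ?F (x(r := xr)) \<partial>Pi\<^sub>M (insert 0 J) L) \<partial>L r)"
        unfolding I(1) by (rule product_nn_integral_insert_rev) (use F in \<open>auto simp: I(1) cong: measurable_cong_sets\<close>)
      also have "\<dots> = (\<integral>\<^sup>+xr. (\<integral>\<^sup>+x0. (\<integral>\<^sup>+y. ?F (y(0 := x0, r := xr)) \<partial>Pi\<^sub>M J L) \<partial>L 0) \<partial>L r)"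
      proof (intro nn_integral_cong product_nn_integral_insert_rev)
        fix xr :: "real ^ 'd"
        have [measurable]: "(\<lambda>x. x(r := xr)) \<in> Pi\<^sub>M (insert 0 J) (\<lambda>_. borel) \<rightarrow>\<^sub>M star_space l"
          by (rule measurable_fun_upd[where J="insert 0 J"]) (auto simp: I(1))
        show "(\<lambda>x. ?F (x(r := xr))) \<in> borel_measurable (Pi\<^sub>M (insert 0 J) L)"
          by (rule measurable_compose[OF _ F]) measurable
      qed auto
      finally show ?thesis by (simp add: upd_def L_def fun_upd_twist[of r 0])
    qed
    also have "\<dots> = emeasure (density (star_lborel l) (\<lambda>x. ennreal (\<phi> (x r) * (\<Prod>i\<in>{1..l}. gauss_density (s i) (x 0) (x i))))) A"
    proof (subst emeasure_density)
      show "(\<lambda>x. ennreal (\<phi> (x r) * (\<Prod>i\<in>{1..l}. gauss_density (s i) (x 0) (x i)))) \<in> borel_measurable (star_lborel l)"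
        using r by (intro measurable_compose[OF _ measurable_ennreal]
          borel_measurable_times borel_measurable_prod gauss_density_measurable
          measurable_compose[OF comp \<open>\<phi> \<in> _\<close>]) (auto simp: cong: measurable_cong_sets intro!: comp)
    qed (auto simp: star_lborel_def L_def)
    finally show "emeasure (star_reference \<epsilon> l w r \<mu>) A = emeasure (density (star_lborel l)
      (\<lambda>x. ennreal (ldens \<mu> (x r) * (\<Prod>i\<in>{1..l}. gauss_density (\<epsilon> / (2 * w i)) (x 0) (x i))))) A"
      unfolding \<phi>_def s_def .
  qed
qed

section \<open>Marginals and gluing\<close>

lemma absolutely_continuous_distr:
  assumes "absolutely_continuous M N" "f \<in> M \<rightarrow>\<^sub>M K" "sets N = sets M"
  shows "absolutely_continuous (distr M K f) (distr N K f)"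
proof -
  have "f \<in> N \<rightarrow>\<^sub>M K" using assms by (simp cong: measurable_cong_sets)
  then show ?thesis
    using assms sets_eq_imp_space_eq[OF assms(3)]
    by (auto simp: absolutely_continuous_def null_sets_distr_iff)
qed

lemma absolutely_continuous_trans:
  "absolutely_continuous M N \<Longrightarrow> absolutely_continuous N K \<Longrightarrow> absolutely_continuous M K"
  by (auto simp: absolutely_continuous_def)

lemma borel_measurable_prodI:
  fixes f :: "'a::euclidean_space \<times> 'b::euclidean_space \<Rightarrow> 'c::topological_space"
  shows "f \<in> borel_measurable (borel \<Otimes>\<^sub>M borel) \<Longrightarrow> f \<in> borel_measurable borel"
  by (simp add: borel_prod)

lemma nn_integral_lborel_pair:
  fixes f :: "'a::euclidean_space \<times> 'b::euclidean_space \<Rightarrow> ennreal"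
  assumes "f \<in> borel_measurable borel"
  shows "(\<integral>\<^sup>+x. f x \<partial>lborel) = (\<integral>\<^sup>+y. \<integral>\<^sup>+z. f (y, z) \<partial>lborel \<partial>lborel)"
    and "(\<integral>\<^sup>+x. f x \<partial>lborel) = (\<integral>\<^sup>+z. \<integral>\<^sup>+y. f (y, z) \<partial>lborel \<partial>lborel)"
proof -
  have f: "f \<in> borel_measurable (lborel \<Otimes>\<^sub>M lborel)" using assms by (simp add: lborel_prod)
  show 1: "(\<integral>\<^sup>+x. f x \<partial>lborel) = (\<integral>\<^sup>+y. \<integral>\<^sup>+z. f (y, z) \<partial>lborel \<partial>lborel)"
    using lborel.nn_integral_fst[OF f] by (simp add: lborel_prod)
  have "(\<lambda>(y, z). f (y, z)) \<in> borel_measurable (lborel \<Otimes>\<^sub>M lborel)" using f by simp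
  then show "(\<integral>\<^sup>+x. f x \<partial>lborel) = (\<integral>\<^sup>+z. \<integral>\<^sup>+y. f (y, z) \<partial>lborel \<partial>lborel)"
    unfolding 1 by (rule lborel_pair.Fubini'[symmetric])
qed

text \<open>The fibre over a null set is null by Tonelli. The image measure is not sigma-finite and
  serves only through its null sets: it passes absolute continuity from a joint law to its first
  marginal.\<close>

lemma absolutely_continuous_lborel_fst:
  "absolutely_continuous lborel (distr (lborel :: ('a::euclidean_space \<times> 'b::euclidean_space) measure) borel fst)"
  unfolding absolutely_continuous_def
proof
  fix N :: "'a set" assume N: "N \<in> null_sets lborel"
  then have [measurable]: "N \<in> sets borel" by auto
  have [measurable]: "(fst :: 'a \<times> 'b \<Rightarrow> 'a) \<in> borel_measurable borel"
    by (rule borel_measurable_prodI) measurable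
  have "emeasure (distr (lborel :: ('a \<times> 'b) measure) borel fst) N = (\<integral>\<^sup>+x. indicator N (fst x) \<partial>(lborel :: ('a \<times> 'b) measure))"
    by (subst nn_integral_indicator[symmetric], simp, subst nn_integral_distr) auto
  also have "\<dots> = (\<integral>\<^sup>+z. \<integral>\<^sup>+y. indicator N y \<partial>lborel \<partial>(lborel :: 'b measure))"
    by (subst nn_integral_lborel_pair(2)) auto
  also have "\<dots> = 0" using N by (simp add: nn_integral_indicator null_setsD1)
  finally show "N \<in> null_sets (distr (lborel :: ('a \<times> 'b) measure) borel fst)" by auto
qed

lemma AE_lborel_pair_snd:
  assumes "AE z in (lborel :: 'b::euclidean_space measure). Q z" "Measurable.pred borel Q"
  shows "AE x in (lborel :: ('a::euclidean_space \<times> 'b) measure). Q (snd x)"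
proof -
  note [measurable] = assms(2)
  have [measurable]: "(snd :: 'a \<times> 'b \<Rightarrow> 'b) \<in> borel_measurable borel"
    by (rule borel_measurable_prodI) measurable
  have null: "(\<integral>\<^sup>+z. indicator {z. \<not> Q z} z \<partial>lborel) = 0"
    using assms by (subst nn_integral_0_iff_AE) (auto simp: indicator_def)
  have "(\<integral>\<^sup>+x. indicator {x. \<not> Q (snd x)} x \<partial>(lborel :: ('a \<times> 'b) measure)) =
    (\<integral>\<^sup>+y. \<integral>\<^sup>+z. indicator {z. \<not> Q z} z \<partial>lborel \<partial>(lborel :: 'a measure))"
  proof -
    have m: "(\<lambda>x :: 'a \<times> 'b. indicator {x. \<not> Q (snd x)} x :: ennreal) \<in> borel_measurable borel"
      by auto
    show ?thesis
      unfolding nn_integral_lborel_pair(1)[OF m] by (simp only: indicator_def mem_Collect_eq snd_conv)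
  qed
  also have "\<dots> = 0" unfolding null by simp
  finally have "emeasure lborel {x :: 'a \<times> 'b. \<not> Q (snd x)} = 0"
    by (subst (asm) nn_integral_indicator) auto
  then show ?thesis
    by (intro AE_I[of _ _ "{x. \<not> Q (snd x)}"]) auto
qed

lemma measurable_star_pair [measurable]:
  assumes "i \<in> {0..l}"
  shows "(\<lambda>x. (x 0, x i)) \<in> star_space l \<rightarrow>\<^sub>M (borel :: ('a::euclidean_space \<times> 'a) measure)"
  unfolding borel_prod[symmetric] using assms
  by (intro measurable_Pair measurable_component_singleton) auto

lemma absolutely_continuous_star_pair:
  assumes i: "i \<in> {1..l}"
  shows "absolutely_continuous lborel
    (distr (star_lborel l) borel (\<lambda>x. (x 0, x i)) :: ('a::euclidean_space \<times> 'a) measure)"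
  unfolding absolutely_continuous_def
proof
  let ?pr = "\<lambda>x :: nat \<Rightarrow> 'a. (x 0, x i)"
  have [measurable]: "?pr \<in> star_space l \<rightarrow>\<^sub>M borel" using i by (intro measurable_star_pair) auto
  fix N :: "('a \<times> 'a) set" assume N: "N \<in> null_sets lborel"
  then have Nm: "N \<in> sets borel" by auto
  then have [measurable]: "N \<in> sets (borel \<Otimes>\<^sub>M borel)" unfolding borel_prod .
  have "(\<integral>\<^sup>+y. \<integral>\<^sup>+z. indicator N (y, z) \<partial>lborel \<partial>lborel) = 0"
    using N Nm by (subst nn_integral_lborel_pair(1)[symmetric]) (auto simp: null_setsD1)
  then have AE0: "AE y in lborel. (\<integral>\<^sup>+z. indicator N (y, z) \<partial>lborel) = 0"
    by (subst (asm) nn_integral_0_iff_AE) auto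
  define h :: "nat \<Rightarrow> 'a \<Rightarrow> 'a \<Rightarrow> ennreal" where "h j y z = (if j = i then indicator N (y, z) else 1)" for j y z
  have "emeasure (distr (star_lborel l) borel ?pr) N = (\<integral>\<^sup>+x. indicator N (?pr x) \<partial>star_lborel l)"
    using Nm by (subst nn_integral_indicator[symmetric], simp, subst nn_integral_distr) auto
  also have "\<dots> = (\<integral>\<^sup>+x. 1 * (\<Prod>j\<in>{1..l}. h j (x 0) (x j)) \<partial>star_lborel l)"
    using i by (simp add: h_def prod.delta)
  also have "\<dots> = (\<integral>\<^sup>+y. 1 * (\<Prod>j\<in>{1..l}. \<integral>\<^sup>+z. h j y z \<partial>lborel) \<partial>lborel)"
    by (rule nn_integral_star_lborel) (auto simp: h_def)
  also have "\<dots> = (\<integral>\<^sup>+y. 0 \<partial>(lborel :: 'a measure))"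
  \<comment> \<open>For leaves other than \<open>i\<close> the inner integral is that of 1 over the
    whole space, hence infinite; the product still vanishes because
    \<open>0 * \<infinity> = 0\<close> in \<open>ennreal\<close>.\<close>
  proof (rule nn_integral_cong_AE)
    show "AE y in lborel. 1 * (\<Prod>j\<in>{1..l}. \<integral>\<^sup>+z. h j y z \<partial>lborel) = 0"
      using AE0 by eventually_elim (use i in \<open>auto simp: h_def prod_zero_iff intro!: bexI[of _ i]\<close>)
  qed
  finally show "N \<in> null_sets (distr (star_lborel l) borel ?pr)" using Nm by auto
qed

lemma AE_fst_marginal_density:
  fixes p :: "'a::euclidean_space \<times> 'b::euclidean_space \<Rightarrow> ennreal"
  assumes p: "p \<in> borel_measurable borel" and n: "n \<in> borel_measurable borel"
    and eq: "distr (density lborel p) borel fst = density lborel n"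
  shows "AE y in lborel. (\<integral>\<^sup>+z. p (y, z) \<partial>lborel) = n y"
proof -
  have [measurable]: "p \<in> borel_measurable (borel \<Otimes>\<^sub>M borel)" using p by (simp add: borel_prod)
  have fst [measurable]: "(fst :: 'a \<times> 'b \<Rightarrow> 'a) \<in> borel_measurable borel"
    by (rule borel_measurable_prodI) measurable
  have "density lborel (\<lambda>y. \<integral>\<^sup>+z. p (y, z) \<partial>lborel) = density lborel n"
  proof (rule measure_eqI)
    fix A assume "A \<in> sets (density lborel (\<lambda>y. \<integral>\<^sup>+z. p (y, z) \<partial>lborel))"
    then have A [measurable]: "A \<in> sets borel" by simp
    have "emeasure (density lborel n) A = (\<integral>\<^sup>+x. indicator A (fst x) \<partial>density lborel p)"
      unfolding eq[symmetric]
      by (subst nn_integral_indicator[symmetric], simp, subst nn_integral_distr) auto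
    also have "\<dots> = (\<integral>\<^sup>+x. p x * indicator A (fst x) \<partial>lborel)"
      using p by (intro nn_integral_density) auto
    also have "\<dots> = (\<integral>\<^sup>+y. \<integral>\<^sup>+z. p (y, z) * indicator A y \<partial>lborel \<partial>lborel)"
      using p by (subst nn_integral_lborel_pair(1)) auto
    also have "\<dots> = (\<integral>\<^sup>+y. (\<integral>\<^sup>+z. p (y, z) \<partial>lborel) * indicator A y \<partial>lborel)"
      by (intro nn_integral_cong nn_integral_multc) measurable
    finally show "emeasure (density lborel (\<lambda>y. \<integral>\<^sup>+z. p (y, z) \<partial>lborel)) A = emeasure (density lborel n) A"
      by (subst emeasure_density) auto
  qed simp
  then show ?thesis
    using n by (intro sigma_finite_measure.density_unique[OF lborel.sigma_finite_measure_axioms]) auto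
qed

text \<open>At points with \<open>n y = 0\<close> the factor \<open>inverse (n y ^ (l - 1))\<close> is \<open>0\<close>, provided \<open>l \<ge> 2\<close>.\<close>

definition glued_density ::
  "nat \<Rightarrow> ('a \<Rightarrow> real) \<Rightarrow> (nat \<Rightarrow> 'a \<times> 'a \<Rightarrow> real) \<Rightarrow> (nat \<Rightarrow> 'a) \<Rightarrow> real" where
  "glued_density l n p x = inverse (n (x 0) ^ (l - 1)) * (\<Prod>i\<in>{1..l}. p i (x 0, x i))"

lemma glued_density_measurable:
  fixes n :: "'a::euclidean_space \<Rightarrow> real"
  assumes [measurable]: "n \<in> borel_measurable borel"
    and p: "\<And>i. i \<in> {1..l} \<Longrightarrow> p i \<in> borel_measurable borel"
  shows "glued_density l n p \<in> borel_measurable (star_space l)"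
proof -
  have [measurable]: "(\<lambda>x. x 0) \<in> borel_measurable (star_space l)"
    by (rule measurable_component_singleton) simp
  have [measurable]: "(\<lambda>x. p i (x 0, x i)) \<in> borel_measurable (star_space l)" if "i \<in> {1..l}" for i
    using that by (intro measurable_compose[OF measurable_star_pair p]) auto
  show ?thesis unfolding glued_density_def by measurable
qed

locale gluing =
  fixes l :: nat and n :: "'a::euclidean_space \<Rightarrow> real" and p :: "nat \<Rightarrow> 'a \<times> 'a \<Rightarrow> real"
  assumes l: "l \<ge> 2"
    and n_meas [measurable]: "n \<in> borel_measurable borel" and n_nonneg: "\<And>y. n y \<ge> 0"
    and p_meas: "\<And>i. i \<in> {1..l} \<Longrightarrow> p i \<in> borel_measurable borel"
    and p_nonneg: "\<And>i x. i \<in> {1..l} \<Longrightarrow> p i x \<ge> 0"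
    and fst_marginal: "\<And>i. i \<in> {1..l} \<Longrightarrow> distr (density lborel (p i)) borel fst = density lborel n"
begin

abbreviation "Q \<equiv> density (star_lborel l) (glued_density l n p)"

lemma p_measurable [measurable]:
  assumes "i \<in> {1..l}" "f \<in> borel_measurable M" "g \<in> borel_measurable M"
  shows "(\<lambda>x. p i (f x, g x)) \<in> borel_measurable M"
proof -
  have "(\<lambda>x. (f x, g x)) \<in> M \<rightarrow>\<^sub>M borel \<Otimes>\<^sub>M borel" using assms by (intro measurable_Pair) auto
  then show ?thesis using p_meas[OF assms(1)] by (auto simp: borel_prod intro: measurable_compose)
qed

lemma AE_marginal: "AE y in lborel. \<forall>i\<in>{1..l}. (\<integral>\<^sup>+z. ennreal (p i (y, z)) \<partial>lborel) = ennreal (n y)"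
proof (rule AE_finite_allI)
  fix i assume "i \<in> {1..l}"
  then show "AE y in lborel. (\<integral>\<^sup>+z. ennreal (p i (y, z)) \<partial>lborel) = ennreal (n y)"
    using p_meas fst_marginal by (intro AE_fst_marginal_density) auto
qed simp

text \<open>Integrating out the leaves other than \<open>i\<close> produces
  \<open>n y ^ (l - 1)\<close>, which the inverse power cancels. Where \<open>n y = 0\<close>
  nothing cancels, but there the fibre of \<open>p i\<close> has mass 0, so both sides
  vanish.\<close>

lemma glued_pair_marginal:
  assumes i: "i \<in> {1..l}"
  shows "distr Q borel (\<lambda>x. (x 0, x i)) = density lborel (p i)"
proof (rule measure_eqI)
  let ?pr = "\<lambda>x :: nat \<Rightarrow> 'a. (x 0, x i)"
  have pr [measurable]: "?pr \<in> star_space l \<rightarrow>\<^sub>M borel" using i by (intro measurable_star_pair) auto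
  have [measurable]: "glued_density l n p \<in> borel_measurable (star_space l)"
    by (intro glued_density_measurable p_meas) auto
  fix B assume "B \<in> sets (distr Q borel ?pr)"
  then have B: "B \<in> sets borel" by simp
  then have [measurable]: "B \<in> sets (borel \<Otimes>\<^sub>M borel)" unfolding borel_prod .
  define h where "h j y z = ennreal (p j (y, z)) * (if j = i then indicator B (y, z) else 1)" for j y z
  have "emeasure (distr Q borel ?pr) B = (\<integral>\<^sup>+x. indicator B (?pr x) \<partial>Q)"
    using B by (subst nn_integral_indicator[symmetric], simp, subst nn_integral_distr) auto
  also have "\<dots> = (\<integral>\<^sup>+x. ennreal (glued_density l n p x) * indicator B (?pr x) \<partial>star_lborel l)"
    using B by (intro nn_integral_density) auto
  also have "\<dots> = (\<integral>\<^sup>+x. ennreal (inverse (n (x 0) ^ (l - 1))) * (\<Prod>j\<in>{1..l}. h j (x 0) (x j)) \<partial>star_lborel l)"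
  proof (rule nn_integral_cong)
    fix x
    have "(\<Prod>j\<in>{1..l}. h j (x 0) (x j)) = ennreal (\<Prod>j\<in>{1..l}. p j (x 0, x j)) * indicator B (?pr x)"
    proof -
      have "(\<Prod>j\<in>{1..l}. ennreal (p j (x 0, x j))) = ennreal (\<Prod>j\<in>{1..l}. p j (x 0, x j))"
        by (intro prod_ennreal p_nonneg)
      then show ?thesis using i by (simp add: h_def prod.distrib prod.delta)
    qed
    moreover have "ennreal (glued_density l n p x) =
      ennreal (inverse (n (x 0) ^ (l - 1))) * ennreal (\<Prod>j\<in>{1..l}. p j (x 0, x j))"
      unfolding glued_density_def by (intro ennreal_mult) (auto intro!: prod_nonneg p_nonneg n_nonneg zero_le_power)
    ultimately show "ennreal (glued_density l n p x) * indicator B (?pr x) =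
      ennreal (inverse (n (x 0) ^ (l - 1))) * (\<Prod>j\<in>{1..l}. h j (x 0) (x j))"
      by (simp only: mult.assoc)
  qed
  also have "\<dots> = (\<integral>\<^sup>+y. ennreal (inverse (n y ^ (l - 1))) * (\<Prod>j\<in>{1..l}. \<integral>\<^sup>+z. h j y z \<partial>lborel) \<partial>lborel)"
    by (rule nn_integral_star_lborel) (auto simp: h_def)
  also have "\<dots> = (\<integral>\<^sup>+y. (\<integral>\<^sup>+z. h i y z \<partial>lborel) \<partial>lborel)"
  proof (rule nn_integral_cong_AE)
    show "AE y in lborel. ennreal (inverse (n y ^ (l - 1))) * (\<Prod>j\<in>{1..l}. \<integral>\<^sup>+z. h j y z \<partial>lborel) =
      (\<integral>\<^sup>+z. h i y z \<partial>lborel)"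
      using AE_marginal
    proof eventually_elim
      case (elim y)
      let ?H = "\<integral>\<^sup>+z. h i y z \<partial>lborel"
      have "(\<Prod>j\<in>{1..l}. \<integral>\<^sup>+z. h j y z \<partial>lborel) = ?H * (\<Prod>j\<in>{1..l} - {i}. \<integral>\<^sup>+z. h j y z \<partial>lborel)"
        using i by (intro prod.remove) auto
      also have "(\<Prod>j\<in>{1..l} - {i}. \<integral>\<^sup>+z. h j y z \<partial>lborel) = (\<Prod>j\<in>{1..l} - {i}. ennreal (n y))"
        using elim by (intro prod.cong) (auto simp: h_def)
      also have "\<dots> = ennreal (n y ^ (l - 1))"
        using i n_nonneg by (simp add: ennreal_power)
      finally have prod: "(\<Prod>j\<in>{1..l}. \<integral>\<^sup>+z. h j y z \<partial>lborel) = ?H * ennreal (n y ^ (l - 1))" .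
      show ?case
      proof (cases "n y = 0")
        case True
        have "?H \<le> (\<integral>\<^sup>+z. ennreal (p i (y, z)) \<partial>lborel)"
          by (intro nn_integral_mono) (auto simp: h_def indicator_def)
        then have "?H = 0" using elim i True by simp
        then show ?thesis using True l unfolding prod by (simp add: power_0_left)
      next
        case False
        then have "n y > 0" using n_nonneg[of y] by simp
        then have "ennreal (inverse (n y ^ (l - 1))) * ennreal (n y ^ (l - 1)) = 1"
          by (simp add: ennreal_mult[symmetric])
        then show ?thesis unfolding prod by (metis mult.assoc mult.commute mult.right_neutral)
      qed
    qed
  qed
  also have "\<dots> = (\<integral>\<^sup>+x. ennreal (p i x) * indicator B x \<partial>lborel)"
    using B p_meas[OF i] by (subst nn_integral_lborel_pair(1)) (auto simp: h_def[abs_def])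
  also have "\<dots> = emeasure (density lborel (p i)) B"
    using B p_meas[OF i] by (subst emeasure_density) auto
  finally show "emeasure (distr Q borel ?pr) B = emeasure (density lborel (p i)) B" .
qed simp

lemma emeasure_glued:
  assumes "i \<in> {1..l}"
  shows "emeasure Q (space Q) = emeasure (density lborel (p i)) UNIV"
proof -
  have "(\<lambda>x. (x 0, x i)) \<in> star_space l \<rightarrow>\<^sub>M (borel :: ('a \<times> 'a) measure)"
    using assms by (intro measurable_star_pair) auto
  then have "(\<lambda>x. (x 0, x i)) \<in> Q \<rightarrow>\<^sub>M borel" by (simp cong: measurable_cong_sets)
  then show ?thesis
    unfolding glued_pair_marginal[OF assms, symmetric] by (subst emeasure_distr) auto
qed

end

lemma star_product_measurable:
  fixes f :: "'a::euclidean_space \<Rightarrow> real" and h :: "nat \<Rightarrow> 'a \<Rightarrow> 'a \<Rightarrow> real"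
  assumes [measurable]: "f \<in> borel_measurable borel"
    and h: "\<And>i. i \<in> {1..l} \<Longrightarrow> (\<lambda>(y, z). h i y z) \<in> borel_measurable (borel \<Otimes>\<^sub>M borel)"
  shows "(\<lambda>x. f (x 0)) \<in> borel_measurable (star_space l)"
    and "i \<in> {1..l} \<Longrightarrow> (\<lambda>x. h i (x 0) (x i)) \<in> borel_measurable (star_space l)"
    and "(\<lambda>x. f (x 0) * (\<Prod>i\<in>{1..l}. h i (x 0) (x i))) \<in> borel_measurable (star_space l)"
proof -
  have c: "(\<lambda>x. x i) \<in> borel_measurable (star_space l)" if "i \<in> {0..l}" for i
    using that by (rule measurable_component_singleton)
  show f: "(\<lambda>x. f (x 0)) \<in> borel_measurable (star_space l)"
    by (rule measurable_compose[OF c]) auto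
  have hm: "(\<lambda>x. h i (x 0) (x i)) \<in> borel_measurable (star_space l)" if "i \<in> {1..l}" for i
    using measurable_compose[OF measurable_Pair[OF c c] h[OF that], of 0 i] that by simp
  then show "i \<in> {1..l} \<Longrightarrow> (\<lambda>x. h i (x 0) (x i)) \<in> borel_measurable (star_space l)" .
  show "(\<lambda>x. f (x 0) * (\<Prod>i\<in>{1..l}. h i (x 0) (x i))) \<in> borel_measurable (star_space l)"
    by (intro borel_measurable_times borel_measurable_prod f hm)
qed

lemma nn_integral_star_product:
  fixes f :: "'a::euclidean_space \<Rightarrow> real" and h :: "nat \<Rightarrow> 'a \<Rightarrow> 'a \<Rightarrow> real"
  assumes [measurable]: "f \<in> borel_measurable borel"
    and h: "\<And>i. i \<in> {1..l} \<Longrightarrow> (\<lambda>(y, z). h i y z) \<in> borel_measurable (borel \<Otimes>\<^sub>M borel)"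
    and nonneg: "\<And>y. f y \<ge> 0" "\<And>i y z. i \<in> {1..l} \<Longrightarrow> h i y z \<ge> 0"
  shows "(\<integral>\<^sup>+x. ennreal (f (x 0) * (\<Prod>i\<in>{1..l}. h i (x 0) (x i))) \<partial>star_lborel l) =
    (\<integral>\<^sup>+y. ennreal (f y) * (\<Prod>i\<in>{1..l}. \<integral>\<^sup>+z. ennreal (h i y z) \<partial>lborel) \<partial>lborel)"
proof -
  have "ennreal (f (x 0) * (\<Prod>i\<in>{1..l}. h i (x 0) (x i))) =
    ennreal (f (x 0)) * (\<Prod>i\<in>{1..l}. ennreal (h i (x 0) (x i)))" for x
  proof -
    have "(\<Prod>i\<in>{1..l}. ennreal (h i (x 0) (x i))) = ennreal (\<Prod>i\<in>{1..l}. h i (x 0) (x i))"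
      by (intro prod_ennreal nonneg)
    then show ?thesis by (simp only:) (intro ennreal_mult nonneg prod_nonneg)
  qed
  moreover have "(\<lambda>(y, z). ennreal (h i y z)) \<in> borel_measurable (borel \<Otimes>\<^sub>M borel)" if "i \<in> {1..l}" for i
    using h[OF that] by (simp add: case_prod_beta')
  ultimately show ?thesis
    by (simp only:) (intro nn_integral_star_lborel; simp)
qed

lemma upper_int_distr:
  assumes "f \<in> M \<rightarrow>\<^sub>M N" "u \<in> borel_measurable N"
  shows "upper_int (distr M N f) u \<longleftrightarrow> upper_int M (\<lambda>x. u (f x))"
  using assms by (auto simp: upper_int_def nn_integral_distr)

lemma AE_lebesgue_density_pos:
  assumes "prob_on borel \<mu>" "absolutely_continuous lborel \<mu>"
  shows "AE x in \<mu>. ldens \<mu> x > 0"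
  using AE_density_pos[of "ldens \<mu>" lborel]
  unfolding density_lebesgue_density[OF assms] by simp

section \<open>Divergence from the reference measure\<close>

abbreviation edge_cost :: "nat \<Rightarrow> (nat \<Rightarrow> 'a::real_normed_vector) \<Rightarrow> real" where
  "edge_cost i x \<equiv> (norm (x i - x 0))\<^sup>2"

locale star_problem =
  fixes \<epsilon> :: real and l r :: nat and w :: "nat \<Rightarrow> real" and \<mu> :: "nat \<Rightarrow> (real ^ 'd) measure"
  assumes eps: "\<epsilon> > 0" and l: "l \<ge> 2"
    and w: "\<And>i. i \<in> {1..l} \<Longrightarrow> w i > 0"
    and \<mu>_prob: "\<And>i. i \<in> {1..l} \<Longrightarrow> prob_on borel (\<mu> i)"
    and \<mu>_ac: "\<And>i. i \<in> {1..l} \<Longrightarrow> absolutely_continuous lborel (\<mu> i)"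
    and \<mu>_entropy: "\<And>i. i \<in> {1..l} \<Longrightarrow> \<bar>diff_entropy (\<mu> i)\<bar> \<noteq> \<infinity>"
    and r: "r \<in> {1..l}"
    and \<mu>_pos: "AE x in lborel. RN_deriv lborel (\<mu> r) x > 0"
begin

text \<open>Variance per coordinate on the edge between 0 and \<open>i\<close>. It satisfies
  \<open>\<epsilon> / (2 * v i) = w i\<close>, which matches the Gaussian exponent with the weighted
  cost, and \<open>\<epsilon> / w i = 2 * v i\<close>, the regularization parameter of that
  edge.\<close>

definition v :: "nat \<Rightarrow> real" where "v i = \<epsilon> / (2 * w i)"

definition \<phi> :: "nat \<Rightarrow> real ^ 'd \<Rightarrow> real" where "\<phi> i = ldens (\<mu> i)"

definition neg_entropy :: "nat \<Rightarrow> real" where "neg_entropy i = (\<integral>x. ln (\<phi> i x) \<partial>\<mu> i)"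

text \<open>Logarithm of the normalising constant of the Gaussian with variance
  \<open>v i\<close>.\<close>

definition c :: "nat \<Rightarrow> real" where "c i = CARD('d) * ln (1 / sqrt (2 * pi * v i))"

definition ref_density :: "(nat \<Rightarrow> real ^ 'd) \<Rightarrow> real" where
  "ref_density x = \<phi> r (x r) * (\<Prod>i\<in>{1..l}. gauss_density (v i) (x 0) (x i))"

abbreviation "g i \<equiv> gauss_density (v i) :: real ^ 'd \<Rightarrow> _"

abbreviation "P \<equiv> star_reference \<epsilon> l w r (\<mu> r)"

lemma v_pos: "i \<in> {1..l} \<Longrightarrow> v i > 0"
  using eps w by (simp add: v_def)

lemma w_v: "i \<in> {1..l} \<Longrightarrow> \<epsilon> / w i = 2 * v i"
  by (simp add: v_def)

lemma \<phi>_measurable [measurable]: "\<phi> i \<in> borel_measurable borel"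
  by (simp add: \<phi>_def)

lemma \<phi>_nonneg [simp]: "\<phi> i x \<ge> 0"
  by (simp add: \<phi>_def)

lemma sets_\<mu>: "i \<in> {1..l} \<Longrightarrow> sets (\<mu> i) = sets borel"
  using \<mu>_prob by (simp add: prob_on_def)

lemma \<mu>_density: "i \<in> {1..l} \<Longrightarrow> density lborel (\<phi> i) = \<mu> i"
  unfolding \<phi>_def by (intro density_lebesgue_density \<mu>_prob \<mu>_ac)

lemma AE_\<phi>_pos: "i \<in> {1..l} \<Longrightarrow> AE x in \<mu> i. \<phi> i x > 0"
  unfolding \<phi>_def by (intro AE_lebesgue_density_pos \<mu>_prob \<mu>_ac)

lemma integrable_ln_\<phi>:
  assumes "i \<in> {1..l}"
  shows "integrable (\<mu> i) (\<lambda>x. ln (\<phi> i x))"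
proof (rule ext_integral_finite_imp_integrable)
  show "\<bar>ext_integral (\<mu> i) (\<lambda>x. ln (\<phi> i x))\<bar> \<noteq> \<infinity>"
    using \<mu>_entropy[OF assms] \<mu>_ac[OF assms]
    by (simp add: diff_entropy_def ext_integral_lebesgue_density[OF \<mu>_prob \<mu>_ac, OF assms assms] \<phi>_def)
qed (use assms in \<open>simp add: prob_on_borel_measurable_iff \<mu>_prob\<close>)

lemma nn_integral_\<phi>: "i \<in> {1..l} \<Longrightarrow> (\<integral>\<^sup>+x. ennreal (\<phi> i x) \<partial>lborel) = 1"
  unfolding \<phi>_def by (intro nn_integral_lebesgue_density \<mu>_prob \<mu>_ac)

text \<open>Exchanging the order lets the Gaussian, symmetric in its arguments, integrate to 1 in
  \<open>y\<close>. The integrand is the joint law that draws the leaf from \<open>\<mu> i\<close>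
  and the centre from a Gaussian around the leaf; it recurs as a test density that involves no
  centre marginal.\<close>

lemma nn_integral_\<phi>_gauss:
  assumes i: "i \<in> {1..l}" and "s > 0"
  shows "(\<integral>\<^sup>+y. \<integral>\<^sup>+z. ennreal (\<phi> i z * gauss_density s y z) \<partial>lborel \<partial>lborel) = 1"
proof -
  have "(\<lambda>(y, z). ennreal (\<phi> i z * gauss_density s y z)) \<in> borel_measurable (lborel \<Otimes>\<^sub>M lborel)" by measurable
  from lborel_pair.Fubini'[OF this]
  have "(\<integral>\<^sup>+y. \<integral>\<^sup>+z. ennreal (\<phi> i z * gauss_density s y z) \<partial>lborel \<partial>lborel) =
    (\<integral>\<^sup>+z. \<integral>\<^sup>+y. ennreal (\<phi> i z * gauss_density s y z) \<partial>lborel \<partial>lborel)" by simp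
  also have "\<dots> = (\<integral>\<^sup>+z. ennreal (\<phi> i z) * (\<integral>\<^sup>+y. ennreal (gauss_density s y z) \<partial>lborel) \<partial>lborel)"
    by (intro nn_integral_cong) (simp add: ennreal_mult nn_integral_cmult)
  also have "\<dots> = 1"
    using \<open>s > 0\<close> by (simp add: nn_integral_gauss_density nn_integral_\<phi>[OF i])
  finally show ?thesis .
qed

lemma ln_g: "i \<in> {1..l} \<Longrightarrow> ln (g i y z) = c i - (norm (z - y))\<^sup>2 / (2 * v i)"
  by (simp add: ln_gauss_density v_pos c_def)

lemma ref_density_nonneg [simp]: "ref_density x \<ge> 0"
  by (simp add: ref_density_def prod_nonneg)

text \<open>The variances are arbitrary because the lemma serves twice: with \<open>v\<close> for
  the mass of \<open>P\<close>, and with one variance doubled for an exponential moment of the cost.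
  The factor \<open>\<phi> r\<close> is absorbed into edge \<open>r\<close>, and every other edge
  integrates to 1 in its leaf.\<close>

lemma nn_integral_ref_density:
  fixes s :: "nat \<Rightarrow> real"
  assumes s: "\<And>i. i \<in> {1..l} \<Longrightarrow> s i > 0"
  shows "(\<integral>\<^sup>+x. ennreal (\<phi> r (x r) * (\<Prod>i\<in>{1..l}. gauss_density (s i) (x 0) (x i))) \<partial>star_lborel l) = 1"
proof -
  let ?h = "\<lambda>i y z. (if i = r then \<phi> r z else 1) * gauss_density (s i) y z"
  have "(\<integral>\<^sup>+x. ennreal (\<phi> r (x r) * (\<Prod>i\<in>{1..l}. gauss_density (s i) (x 0) (x i))) \<partial>star_lborel l) =
    (\<integral>\<^sup>+x. ennreal (1 * (\<Prod>i\<in>{1..l}. ?h i (x 0) (x i))) \<partial>star_lborel l)"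
    using r by (simp add: prod.distrib prod.delta)
  also have "\<dots> = (\<integral>\<^sup>+y. ennreal 1 * (\<Prod>i\<in>{1..l}. \<integral>\<^sup>+z. ennreal (?h i y z) \<partial>lborel) \<partial>lborel)"
    by (rule nn_integral_star_product) (auto intro!: measurable_If simp: case_prod_beta')
  also have "\<dots> = (\<integral>\<^sup>+y. \<integral>\<^sup>+z. ennreal (\<phi> r z * gauss_density (s r) y z) \<partial>lborel \<partial>lborel)"
  proof (rule nn_integral_cong)
    fix y
    have "(\<Prod>i\<in>{1..l}. \<integral>\<^sup>+z. ennreal (?h i y z) \<partial>lborel) =
      (\<Prod>i\<in>{1..l}. if i = r then \<integral>\<^sup>+z. ennreal (\<phi> r z * gauss_density (s r) y z) \<partial>lborel else 1)"
      using s by (intro prod.cong) (auto simp: nn_integral_gauss_density)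
    then show "ennreal 1 * (\<Prod>i\<in>{1..l}. \<integral>\<^sup>+z. ennreal (?h i y z) \<partial>lborel) =
      (\<integral>\<^sup>+z. ennreal (\<phi> r z * gauss_density (s r) y z) \<partial>lborel)"
      using r by (simp add: prod.delta)
  qed
  also have "\<dots> = 1" by (rule nn_integral_\<phi>_gauss[OF r s[OF r]])
  finally show ?thesis .
qed

lemma leaf_gauss_measurable:
  "(\<lambda>x. \<phi> r (x r) * (\<Prod>i\<in>{1..l}. gauss_density (s i) (x 0) (x i))) \<in> borel_measurable (star_space l)"
proof -
  have "(\<lambda>x. x r) \<in> borel_measurable (star_space l)"
    using r by (intro measurable_component_singleton) auto
  then have "(\<lambda>x. \<phi> r (x r)) \<in> borel_measurable (star_space l)" by measurable
  moreover have "(\<lambda>x. 1 * (\<Prod>i\<in>{1..l}. gauss_density (s i) (x 0) (x i :: real ^ 'd))) \<in> borel_measurable (star_space l)"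
    by (rule star_product_measurable(3)) auto
  ultimately show ?thesis by simp
qed

lemma ref_density_measurable [measurable]: "ref_density \<in> borel_measurable (star_space l)"
  unfolding ref_density_def[abs_def] by (rule leaf_gauss_measurable)

lemma P_eq: "P = density (star_lborel l) ref_density"
  using star_reference_eq_density[OF eps w r \<mu>_prob[OF r] \<mu>_ac[OF r]]
  by (simp add: ref_density_def[abs_def] \<phi>_def v_def)

lemma sets_P [simp, measurable_cong]: "sets P = sets (star_space l)"
  by (simp add: P_eq)

lemma prob_space_P: "prob_space P"
proof (rule prob_spaceI)
  have "emeasure P (space P) = (\<integral>\<^sup>+x. ennreal (ref_density x) \<partial>star_lborel l)"
    unfolding P_eq space_density by (subst emeasure_density[OF _ sets.top]) (auto intro!: nn_integral_cong)
  also have "\<dots> = 1"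
    unfolding ref_density_def by (rule nn_integral_ref_density[OF v_pos])
  finally show "emeasure P (space P) = 1" .
qed

text \<open>Positivity of \<open>\<phi> r\<close> lifts from the leaf to the star through a pair
  projection, and Gaussians are positive everywhere. Thus \<open>P\<close> and
  \<open>star_lborel l\<close> have the same null sets, and Lebesgue densities may be divided by
  \<open>ref_density\<close>.\<close>

lemma AE_ref_density_pos: "AE x in star_lborel l. ref_density x > 0"
proof -
  have "AE x in lborel. \<phi> r x > 0"
  proof -
    have "sigma_finite_measure (\<mu> r)"
      using \<mu>_prob[OF r] by (simp add: prob_on_def prob_space_imp_sigma_finite)
    from sigma_finite_measure.RN_deriv_finite[OF lborel.sigma_finite_measure_axioms this \<mu>_ac[OF r]] have "AE x in lborel. RN_deriv lborel (\<mu> r) x \<noteq> \<infinity>"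
      by (simp add: sets_\<mu>[OF r])
    with \<mu>_pos show "AE x in lborel. \<phi> r x > 0"
      by eventually_elim (simp add: \<phi>_def lebesgue_density_def enn2real_positive_iff less_top[symmetric])
  qed
  then have "AE x in (lborel :: ((real ^ 'd) \<times> (real ^ 'd)) measure). \<phi> r (snd x) > 0"
    by (rule AE_lborel_pair_snd) measurable
  then have AE: "AE x in distr (star_lborel l) borel (\<lambda>x. (x 0, x r)). \<phi> r (snd x) > 0"
    by (intro absolutely_continuous_AE[OF _ absolutely_continuous_star_pair[OF r]]) simp_all
  have "(\<lambda>x. (x 0, x r)) \<in> star_lborel l \<rightarrow>\<^sub>M (borel :: ((real ^ 'd) \<times> (real ^ 'd)) measure)"
    unfolding measurable_cong_sets[OF sets_star_lborel refl] using r by (intro measurable_star_pair) auto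
  from AE_distrD[OF this AE] have "AE x in star_lborel l. \<phi> r (x r) > 0" by simp
  then show ?thesis
    by eventually_elim (unfold ref_density_def, intro mult_pos_pos prod_pos gauss_density_pos v_pos)
qed

lemma ln_ref_density:
  assumes "\<phi> r (x r) > 0"
  shows "ln (ref_density x) = ln (\<phi> r (x r)) + (\<Sum>i\<in>{1..l}. c i - edge_cost i x / (2 * v i))"
proof -
  have "ln (ref_density x) = ln (\<phi> r (x r)) + ln (\<Prod>i\<in>{1..l}. g i (x 0) (x i))"
    unfolding ref_density_def using assms
    by (intro ln_mult_pos prod_pos gauss_density_pos v_pos) auto
  also have "ln (\<Prod>i\<in>{1..l}. g i (x 0) (x i)) = (\<Sum>i\<in>{1..l}. ln (g i (x 0) (x i)))"
  proof (rule ln_prod)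
    show "g i (x 0) (x i) \<noteq> 0" if "i \<in> {1..l}" for i
      using gauss_density_pos[OF v_pos[OF that], of "x 0" "x i"] by simp
  qed simp
  finally show ?thesis by (simp add: ln_g)
qed

lemma cost_measurable: "i \<in> {1..l} \<Longrightarrow> (\<lambda>x :: nat \<Rightarrow> real ^ 'd. edge_cost i x) \<in> borel_measurable (star_space l)"
  by (rule star_product_measurable(2)[where f="\<lambda>_. 0" and h="\<lambda>_ y z. (norm (z - y))\<^sup>2"]) auto

lemma leaf_constrainedD:
  assumes "leaf_constrained l \<mu> \<pi>"
  shows "prob_space \<pi>" "sets \<pi> = sets (star_space l)"
    "i \<in> {1..l} \<Longrightarrow> distr \<pi> borel (\<lambda>x. x i) = \<mu> i"
    "i \<in> {0..l} \<Longrightarrow> (\<lambda>x. x i) \<in> borel_measurable \<pi>"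
proof -
  show *: "prob_space \<pi>" "sets \<pi> = sets (star_space l)"
    "i \<in> {1..l} \<Longrightarrow> distr \<pi> borel (\<lambda>x. x i) = \<mu> i"
    using assms by (auto simp: leaf_constrained_def prob_on_def marginal_def)
  show "i \<in> {0..l} \<Longrightarrow> (\<lambda>x. x i) \<in> borel_measurable \<pi>"
    unfolding measurable_cong_sets[OF *(2) refl] by (rule measurable_component_singleton)
qed

text \<open>A function of leaf \<open>i\<close> alone has the same integral under every admissible
  measure; hence the root density contributes only a constant to the divergence.\<close>

lemma leaf_constrained_\<phi>:
  assumes "leaf_constrained l \<mu> \<pi>" "i \<in> {1..l}"
  shows "AE x in \<pi>. \<phi> i (x i) > 0" "integrable \<pi> (\<lambda>x. ln (\<phi> i (x i)))"
    "(\<integral>x. ln (\<phi> i (x i)) \<partial>\<pi>) = neg_entropy i"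
proof -
  note D = leaf_constrainedD[OF assms(1)]
  have m: "(\<lambda>x. x i) \<in> borel_measurable \<pi>" using assms(2) by (intro D) auto
  show "AE x in \<pi>. \<phi> i (x i) > 0"
    using AE_\<phi>_pos[OF assms(2)] unfolding D(3)[OF assms(2), symmetric] by (rule AE_distrD[OF m])
  show "integrable \<pi> (\<lambda>x. ln (\<phi> i (x i)))"
    using integrable_ln_\<phi>[OF assms(2)] m unfolding D(3)[OF assms(2), symmetric]
    by (subst (asm) integrable_distr_eq) auto
  show "(\<integral>x. ln (\<phi> i (x i)) \<partial>\<pi>) = neg_entropy i"
    using m unfolding neg_entropy_def D(3)[OF assms(2), symmetric]
    by (subst integral_distr) auto
qed

lemma integral_ln_ref_density:
  assumes \<pi>: "leaf_constrained l \<mu> \<pi>"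
    and cost: "\<And>i. i \<in> {1..l} \<Longrightarrow> integrable \<pi> (\<lambda>x. edge_cost i x)"
  shows "integrable \<pi> (\<lambda>x. ln (ref_density x))"
    and "(\<integral>x. ln (ref_density x) \<partial>\<pi>) =
      neg_entropy r + (\<Sum>i\<in>{1..l}. c i - (\<integral>x. edge_cost i x \<partial>\<pi>) / (2 * v i))"
proof -
  interpret prob_space \<pi> using leaf_constrainedD(1)[OF \<pi>] .
  note \<phi>r = leaf_constrained_\<phi>[OF \<pi> r]
  let ?u = "\<lambda>x. ln (\<phi> r (x r)) + (\<Sum>i\<in>{1..l}. c i - edge_cost i x / (2 * v i))"
  have eq: "AE x in \<pi>. ln (ref_density x) = ?u x"
    using \<phi>r(1) by eventually_elim (rule ln_ref_density)
  have int: "integrable \<pi> ?u"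
    by (intro integrable_arith \<phi>r integrable_const cost)
  have meas: "(\<lambda>x. ln (ref_density x)) \<in> borel_measurable \<pi>"
    using leaf_constrainedD(2)[OF \<pi>] by (simp cong: measurable_cong_sets)
  show "integrable \<pi> (\<lambda>x. ln (ref_density x))"
    using int eq meas by (subst integrable_cong_AE[where g="?u"]) (auto intro: borel_measurable_integrable)
  have "(\<integral>x. ln (ref_density x) \<partial>\<pi>) = (\<integral>x. ?u x \<partial>\<pi>)"
    using int eq meas by (intro integral_cong_AE) (auto intro: borel_measurable_integrable)
  also have "\<dots> = neg_entropy r + (\<Sum>i\<in>{1..l}. c i - (\<integral>x. edge_cost i x \<partial>\<pi>) / (2 * v i))"
  proof -
    have intc: "integrable \<pi> (\<lambda>x. c i - edge_cost i x / (2 * v i))" if "i \<in> {1..l}" for i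
      by (intro integrable_arith integrable_const cost that)
    have "(\<integral>x. c i - edge_cost i x / (2 * v i) \<partial>\<pi>) = c i - (\<integral>x. edge_cost i x \<partial>\<pi>) / (2 * v i)"
      if "i \<in> {1..l}" for i
      using cost[OF that] by (simp add: prob_space)
    then have "(\<integral>x. (\<Sum>i\<in>{1..l}. c i - edge_cost i x / (2 * v i)) \<partial>\<pi>) =
      (\<Sum>i\<in>{1..l}. c i - (\<integral>x. edge_cost i x \<partial>\<pi>) / (2 * v i))"
      using intc by (subst Bochner_Integration.integral_sum) auto
    then show ?thesis
      unfolding \<phi>r(3)[symmetric]
      using intc by (subst Bochner_Integration.integral_add) (auto intro!: \<phi>r Bochner_Integration.integrable_sum)
  qed
  finally show "(\<integral>x. ln (ref_density x) \<partial>\<pi>) =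
      neg_entropy r + (\<Sum>i\<in>{1..l}. c i - (\<integral>x. edge_cost i x \<partial>\<pi>) / (2 * v i))" .
qed

text \<open>The density of \<open>\<pi>\<close> relative to \<open>P\<close> is
  \<open>p / ref_density\<close>. Both logarithms are assumed integrable separately so that the
  difference splits without \<open>\<infinity> - \<infinity>\<close>.\<close>

lemma KL_eq_of_density:
  assumes p: "p \<in> borel_measurable (star_space l)" "\<And>x. p x \<ge> 0"
    and \<pi>: "\<pi> = density (star_lborel l) (\<lambda>x. ennreal (p x))"
    and int: "integrable \<pi> (\<lambda>x. ln (p x))" "integrable \<pi> (\<lambda>x. ln (ref_density x))"
  shows "KL \<pi> P = ereal ((\<integral>x. ln (p x) \<partial>\<pi>) - (\<integral>x. ln (ref_density x) \<partial>\<pi>))"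
proof -
  interpret P: prob_space P by (rule prob_space_P)
  have [measurable]: "p \<in> borel_measurable (star_lborel l)" using p by (simp cong: measurable_cong_sets)
  have pos: "AE x in \<pi>. p x > 0" unfolding \<pi> by (rule AE_density_pos) simp
  have rpos: "AE x in \<pi>. ref_density x > 0"
    unfolding \<pi> by (rule absolutely_continuous_AE[OF _ absolutely_continuousI_density AE_ref_density_pos]) auto
  have "density P (\<lambda>x. ennreal (p x / ref_density x)) =
    density (star_lborel l) (\<lambda>x. ennreal (ref_density x) * ennreal (p x / ref_density x))"
    unfolding P_eq by (rule density_density_eq) auto
  also have "\<dots> = \<pi>" unfolding \<pi>
  proof (rule density_cong)
    show "AE x in star_lborel l. ennreal (ref_density x) * ennreal (p x / ref_density x) = ennreal (p x)"
      using AE_ref_density_pos by eventually_elim (simp add: ennreal_mult[symmetric] p)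
  qed auto
  finally have eq: "density P (\<lambda>x. ennreal (p x / ref_density x)) = \<pi>" .
  have "KL \<pi> P = ext_integral \<pi> (\<lambda>x. ln (p x / ref_density x))"
    using KL_density_eq_ext_integral[OF P.sigma_finite_measure_axioms, of "\<lambda>x. p x / ref_density x"] p
    unfolding eq by (simp cong: measurable_cong_sets)
  also have "\<dots> = ext_integral \<pi> (\<lambda>x. ln (p x) - ln (ref_density x))"
    by (rule ext_integral_cong_AE) (use pos rpos in \<open>eventually_elim; simp add: ln_div\<close>)
  also have "\<dots> = ereal ((\<integral>x. ln (p x) \<partial>\<pi>) - (\<integral>x. ln (ref_density x) \<partial>\<pi>))"
    using int by (subst ext_integral_integrable) auto
  finally show ?thesis .
qed

text \<open>Finiteness of the costs is the entropy inequality \<open>\<integral> u d\<pi> \<le> KL + ln \<integral> exp u dP\<close> for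
  \<open>u = \<bar>x\<^sub>i - x\<^sub>0\<bar>\<^sup>2 / (4 v\<^sub>i)\<close>.\<close>

lemma KL_finite_obtain_density:
  assumes \<pi>: "leaf_constrained l \<mu> \<pi>" and KL: "KL \<pi> P < \<infinity>"
  obtains p where "p \<in> borel_measurable (star_space l)" "\<And>x. p x \<ge> 0"
    "\<pi> = density (star_lborel l) (\<lambda>x. ennreal (p x))" "integrable \<pi> (\<lambda>x. ln (p x))"
    "\<And>i. i \<in> {1..l} \<Longrightarrow> integrable \<pi> (\<lambda>x. edge_cost i x)"
proof -
  have "prob_on P \<pi>" using leaf_constrainedD(1,2)[OF \<pi>] by (simp add: prob_on_def)
  from KL_finite_density[OF prob_space_P this KL] obtain f :: "(nat \<Rightarrow> real ^ 'd) \<Rightarrow> real" where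
    fP: "f \<in> borel_measurable P" and f: "\<And>x. f x \<ge> 0" "\<pi> = density P (\<lambda>x. ennreal (f x))" "integrable \<pi> (\<lambda>x. ln (f x))"
    by metis
  have fm [measurable]: "f \<in> borel_measurable (star_space l)" using fP by (simp cong: measurable_cong_sets)
  have cost: "integrable \<pi> (\<lambda>x. edge_cost i x)" if i: "i \<in> {1..l}" for i
  proof -
    define u where "u x = edge_cost i x / (4 * v i)" for x :: "nat \<Rightarrow> real ^ 'd"
    have um [measurable]: "u \<in> borel_measurable (star_space l)"
      unfolding u_def using cost_measurable[OF i] by measurable
    have u_nonneg: "u x \<ge> 0" for x using v_pos[OF i] by (simp add: u_def)
    have "(\<integral>\<^sup>+x. ennreal (exp (u x)) \<partial>P) = (\<integral>\<^sup>+x. ennreal (ref_density x) * ennreal (exp (u x)) \<partial>star_lborel l)"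
      unfolding P_eq by (rule nn_integral_density) auto
    \<comment> \<open>Tilting by \<open>exp u\<close> touches the Gaussian of edge \<open>i\<close>
      only, so the integrand is again of reference type, with variance \<open>2 * v i\<close> on
      that edge, up to the factor \<open>sqrt 2 ^ CARD('d)\<close>.\<close>
    also have "\<dots> = (\<integral>\<^sup>+x. ennreal (sqrt 2 ^ CARD('d)) *
      ennreal (\<phi> r (x r) * (\<Prod>j\<in>{1..l}. gauss_density ((v(i := 2 * v i)) j) (x 0) (x j))) \<partial>star_lborel l)"
    proof (rule nn_integral_cong)
      fix x
      have "ref_density x * exp (u x) =
        \<phi> r (x r) * ((g i (x 0) (x i) * exp (u x)) * (\<Prod>j\<in>{1..l} - {i}. g j (x 0) (x j)))"
        unfolding ref_density_def using i by (subst prod.remove[of _ i]) (simp_all only: mult_ac finite_atLeastAtMost)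
      also have "g i (x 0) (x i) * exp (u x) = sqrt 2 ^ CARD('d) * gauss_density (2 * v i) (x 0) (x i)"
        unfolding u_def by (rule gauss_density_mult_exp[OF v_pos[OF i]])
      also have "(\<Prod>j\<in>{1..l} - {i}. g j (x 0) (x j)) =
          (\<Prod>j\<in>{1..l} - {i}. gauss_density ((v(i := 2 * v i)) j) (x 0) (x j))"
        by (intro prod.cong) auto
      also have "\<phi> r (x r) * (sqrt 2 ^ CARD('d) * gauss_density (2 * v i) (x 0) (x i) * \<dots>) =
        sqrt 2 ^ CARD('d) * (\<phi> r (x r) * (\<Prod>j\<in>{1..l}. gauss_density ((v(i := 2 * v i)) j) (x 0) (x j)))"
        using i by (subst prod.remove[of "{1..l}" i]) (simp_all only: mult_ac finite_atLeastAtMost fun_upd_same)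
      finally show "ennreal (ref_density x) * ennreal (exp (u x)) = ennreal (sqrt 2 ^ CARD('d)) *
        ennreal (\<phi> r (x r) * (\<Prod>j\<in>{1..l}. gauss_density ((v(i := 2 * v i)) j) (x 0) (x j)))"
        by (simp only: ennreal_mult[symmetric] ref_density_nonneg exp_ge_zero) (simp add: ennreal_mult prod_nonneg)
    qed
    also have "\<dots> = ennreal (sqrt 2 ^ CARD('d)) * 1"
    proof -
      have "(\<lambda>x. \<phi> r (x r) * (\<Prod>j\<in>{1..l}. gauss_density ((v(i := 2 * v i)) j) (x 0) (x j))) \<in> borel_measurable (star_lborel l)"
        unfolding measurable_cong_sets[OF sets_star_lborel refl] by (rule leaf_gauss_measurable)
      moreover have "(\<integral>\<^sup>+x. ennreal (\<phi> r (x r) *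
          (\<Prod>j\<in>{1..l}. gauss_density ((v(i := 2 * v i)) j) (x 0) (x j))) \<partial>star_lborel l) = 1"
        using v_pos i by (intro nn_integral_ref_density) auto
      ultimately show ?thesis
        by (subst nn_integral_cmult) (simp_all del: fun_upd_apply)
    qed
    \<comment> \<open>The base measure is \<open>P\<close>, the density \<open>f\<close>, and the
      test density \<open>exp u\<close>, just shown to have finite mass. Adding back the integrable
      \<open>ln f\<close> leaves \<open>u\<close>.\<close>
    finally have "upper_int \<pi> (\<lambda>x. ln (exp (u x)) - ln (f x))"
      unfolding f(2) using fP by (intro upper_int_ln_ratio) auto
    moreover have "upper_int \<pi> (\<lambda>x. ln (f x))"
      using f(3) unfolding integrable_iff_upper_int by blast
    ultimately have "upper_int \<pi> (\<lambda>x. (ln (exp (u x)) - ln (f x)) + ln (f x))"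
      by (rule upper_int_add)
    then have "upper_int \<pi> u" by simp
    moreover from this have "upper_int \<pi> (\<lambda>x. - u x)"
      using u_nonneg by (simp add: upper_int_def ennreal_neg)
    ultimately have "integrable \<pi> u"
      using \<open>upper_int \<pi> u\<close> unfolding integrable_iff_upper_int by blast
    then have "integrable \<pi> (\<lambda>x. 4 * v i * u x)"
      by (rule integrable_mult_right)
    then show ?thesis using v_pos[OF i] by (simp add: u_def)
  qed
  note ref = integral_ln_ref_density(1)[OF \<pi> cost]
  have \<pi>_eq: "\<pi> = density (star_lborel l) (\<lambda>x. ennreal (ref_density x * f x))"
    using f fm unfolding f(2) P_eq
    by (subst density_density_eq) (auto simp: ennreal_mult cong: measurable_cong_sets)
  have "AE x in \<pi>. ref_density x * f x > 0"
    using fm unfolding \<pi>_eq by (intro AE_density_pos) (simp cong: measurable_cong_sets)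
  then have ln: "AE x in \<pi>. ln (ref_density x) + ln (f x) = ln (ref_density x * f x)"
  proof eventually_elim
    case (elim x)
    then have "ref_density x > 0" "f x > 0"
      using ref_density_nonneg[of x] f(1)[of x] by (auto simp: zero_less_mult_iff)
    then show ?case by (simp add: ln_mult)
  qed
  have sets: "sets \<pi> = sets (star_space l)" using leaf_constrainedD(2)[OF \<pi>] .
  have "integrable \<pi> (\<lambda>x. ln (ref_density x * f x))"
    by (rule integrable_cong_AE_imp[OF Bochner_Integration.integrable_add[OF ref f(3)] _ ln])
      (unfold measurable_cong_sets[OF sets refl], use fm in measurable)
  then show thesis
    using that[of "\<lambda>x. ref_density x * f x"] \<pi>_eq f(1) fm cost by simp
qed

end

section \<open>Regularized transport costs\<close>

lemma couplingsD:
  fixes \<nu> \<kappa> :: "'a::euclidean_space measure"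
  assumes "\<rho> \<in> couplings \<nu> \<kappa>"
  shows "prob_on borel \<rho>" "prob_space \<rho>" "sets \<rho> = sets borel"
    "distr \<rho> borel fst = \<nu>" "distr \<rho> borel snd = \<kappa>"
    "fst \<in> borel_measurable \<rho>" "snd \<in> borel_measurable \<rho>"
proof -
  show *: "prob_on borel \<rho>" "prob_space \<rho>" "sets \<rho> = sets borel"
    "distr \<rho> borel fst = \<nu>" "distr \<rho> borel snd = \<kappa>"
    using assms by (auto simp: couplings_def prob_on_def)
  show "fst \<in> borel_measurable \<rho>" "snd \<in> borel_measurable \<rho>"
    unfolding measurable_cong_sets[OF *(3) refl] by (auto intro!: borel_measurable_prodI)
qed

lemma absolutely_continuous_fst_marginal:
  fixes \<nu> \<kappa> :: "'a::euclidean_space measure"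
  assumes "\<rho> \<in> couplings \<nu> \<kappa>" "absolutely_continuous lborel \<rho>"
  shows "absolutely_continuous lborel \<nu>"
proof -
  have "absolutely_continuous lborel (distr \<rho> borel fst)"
    by (rule absolutely_continuous_trans[OF absolutely_continuous_lborel_fst absolutely_continuous_distr[OF assms(2)]])
      (use couplingsD(3)[OF assms(1)] in \<open>auto intro!: borel_measurable_prodI\<close>)
  then show ?thesis using couplingsD(4)[OF assms(1)] by simp
qed

abbreviation pair_cost :: "'a::real_normed_vector \<times> 'a \<Rightarrow> real" where
  "pair_cost x \<equiv> (norm (snd x - fst x))\<^sup>2"

lemma reg_cost_eq:
  assumes \<rho>: "\<rho> \<in> couplings \<nu> \<kappa>" and ac: "absolutely_continuous lborel \<rho>"
    and cost: "integrable \<rho> (\<lambda>x. pair_cost x)"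
    and ln: "integrable \<rho> (\<lambda>x. ln (ldens \<rho> x))"
  shows "reg_cost \<eta> \<rho> = ereal ((\<integral>x. pair_cost x \<partial>\<rho>) + \<eta> * (\<integral>x. ln (ldens \<rho> x) \<partial>\<rho>))"
proof -
  note ent = diff_entropy_integrable[OF couplingsD(1)[OF \<rho>] ac ln]
  have "(\<integral>\<^sup>+x. ennreal (pair_cost x) \<partial>\<rho>) = ennreal (\<integral>x. pair_cost x \<partial>\<rho>)"
    by (rule nn_integral_eq_integral[OF cost]) simp
  then show ?thesis
    using ent by (simp add: reg_cost_def case_prod_beta' enn2ereal_ennreal)
qed

text \<open>Entropy \<open>-\<infinity>\<close> makes the regularized cost
  \<open>\<infinity>\<close>, and so does an infinite transport cost, by the convention for
  \<open>\<infinity> - \<infinity>\<close>. This gives the upper half of the integrability of the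
  logarithm; the lower half comes from the leaf marginal in \<open>coupling_gibbs\<close>.\<close>

lemma reg_cost_finite:
  assumes \<rho>: "\<rho> \<in> couplings \<nu> \<kappa>" and \<eta>: "\<eta> > 0" and fin: "reg_cost \<eta> \<rho> < \<infinity>"
  shows "absolutely_continuous lborel \<rho>" "integrable \<rho> (\<lambda>x. pair_cost x)"
    "upper_int \<rho> (\<lambda>x. ln (ldens \<rho> x))"
proof -
  note D = couplingsD[OF \<rho>]
  define C where "C = (\<integral>\<^sup>+x. ennreal (pair_cost x) \<partial>\<rho>)"
  have fin': "enn2ereal C - ereal \<eta> * diff_entropy \<rho> < \<infinity>"
    using fin by (auto simp: reg_cost_def C_def case_prod_beta' split: if_splits)
  have ent: "diff_entropy \<rho> \<noteq> - \<infinity>"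
  proof
    assume "diff_entropy \<rho> = - \<infinity>"
    with fin' \<eta> show False by (cases C) auto
  qed
  then show ac: "absolutely_continuous lborel \<rho>" by (auto simp: diff_entropy_def split: if_splits)
  have "C \<noteq> \<infinity>"
    using fin' by (cases "ereal \<eta> * diff_entropy \<rho>") auto
  moreover have "(\<lambda>x. pair_cost x) \<in> borel_measurable \<rho>"
    using D(6,7) by measurable
  ultimately show "integrable \<rho> (\<lambda>x. pair_cost x)"
    unfolding C_def by (intro integrableI_nonneg) (auto simp: less_top[symmetric])
  have "ext_integral \<rho> (\<lambda>x. ln (ldens \<rho> x)) < \<infinity>"
    using ent ac by (auto simp: diff_entropy_def ext_integral_lebesgue_density[OF D(1) ac] less_top[symmetric])
  then show "upper_int \<rho> (\<lambda>x. ln (ldens \<rho> x))"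
    using D(1) by (intro ext_integral_less_infty_imp_upper_int) (auto simp: prob_on_borel_measurable_iff)
qed

context star_problem
begin

lemma coupling_\<phi>:
  assumes \<rho>: "\<rho> \<in> couplings \<nu> (\<mu> i)" and i: "i \<in> {1..l}"
  shows "AE x in \<rho>. \<phi> i (snd x) > 0" "integrable \<rho> (\<lambda>x. ln (\<phi> i (snd x)))"
    "(\<integral>x. ln (\<phi> i (snd x)) \<partial>\<rho>) = neg_entropy i"
proof -
  note D = couplingsD(5,7)[OF \<rho>]
  show "AE x in \<rho>. \<phi> i (snd x) > 0"
    using AE_\<phi>_pos[OF i] unfolding D(1)[symmetric] by (rule AE_distrD[OF D(2)])
  show "integrable \<rho> (\<lambda>x. ln (\<phi> i (snd x)))"
    using integrable_ln_\<phi>[OF i] D(2) unfolding D(1)[symmetric]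
    by (subst (asm) integrable_distr_eq) auto
  show "(\<integral>x. ln (\<phi> i (snd x)) \<partial>\<rho>) = neg_entropy i"
    using D(2) unfolding neg_entropy_def D(1)[symmetric]
    by (subst integral_distr) auto
qed

text \<open>The test density is \<open>\<phi> i z * g i y z\<close>, of mass 1. It does not involve
  \<open>\<nu>\<close>, so nothing about the centre marginal has to be known, and its logarithm is
  integrable by the finite entropy of \<open>\<mu> i\<close> and the finite cost.\<close>

lemma coupling_gibbs:
  assumes \<rho>: "\<rho> \<in> couplings \<nu> (\<mu> i)" and i: "i \<in> {1..l}"
    and ac: "absolutely_continuous lborel \<rho>"
    and cost: "integrable \<rho> (\<lambda>x. pair_cost x)"
  shows "upper_int \<rho> (\<lambda>x. - ln (ldens \<rho> x))"
    and "integrable \<rho> (\<lambda>x. ln (ldens \<rho> x)) \<Longrightarrow>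
      neg_entropy i + c i - (\<integral>x. pair_cost x \<partial>\<rho>) / (2 * v i) \<le>
      (\<integral>x. ln (ldens \<rho> x) \<partial>\<rho>)"
proof -
  note D = couplingsD[OF \<rho>] and \<phi>i = coupling_\<phi>[OF \<rho> i]
  interpret prob_space \<rho> by (rule D(2))
  note \<rho>_eq = density_lebesgue_density[OF D(1) ac]
  define q where "q x = \<phi> i (snd x) * g i (fst x) (snd x)" for x
  have qm [measurable]: "q \<in> borel_measurable borel"
    unfolding q_def by (rule borel_measurable_prodI) measurable
  have q1: "(\<integral>\<^sup>+x. ennreal (q x) \<partial>lborel) = 1"
    unfolding nn_integral_lborel_pair(1)[OF measurable_compose[OF qm measurable_ennreal]]
    by (simp add: q_def nn_integral_\<phi>_gauss[OF i v_pos[OF i]])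
  have qpos: "AE x in \<rho>. q x > 0"
    using \<phi>i(1) by eventually_elim (auto simp: q_def intro!: mult_pos_pos gauss_density_pos v_pos i)
  let ?u = "\<lambda>x. ln (\<phi> i (snd x)) + (c i - pair_cost x / (2 * v i))"
  have lnq: "AE x in \<rho>. ?u x = ln (q x)"
    using \<phi>i(1)
  proof eventually_elim
    case (elim x)
    then show ?case
      using gauss_density_pos[OF v_pos[OF i], of "fst x" "snd x"]
      by (simp add: q_def ln_mult_pos ln_g[OF i])
  qed
  have intu: "integrable \<rho> ?u"
    by (intro integrable_arith \<phi>i integrable_const cost)
  have lnqm: "(\<lambda>x. ln (q x)) \<in> borel_measurable \<rho>"
    using D(1) by (simp add: prob_on_borel_measurable_iff)
  have intq: "integrable \<rho> (\<lambda>x. ln (q x))"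
    by (rule integrable_cong_AE_imp[OF intu lnqm lnq])
  have "(\<integral>x. ln (q x) \<partial>\<rho>) = (\<integral>x. ?u x \<partial>\<rho>)"
    using lnq lnqm intu by (intro integral_cong_AE) auto
  also have "\<dots> = neg_entropy i + c i - (\<integral>x. pair_cost x \<partial>\<rho>) / (2 * v i)"
    using \<phi>i cost by (simp add: prob_space)
  finally have lnq_int: "(\<integral>x. ln (q x) \<partial>\<rho>) = \<dots>" .
  have "upper_int \<rho> (\<lambda>x. ln (q x) - ln (ldens \<rho> x))"
    using upper_int_ln_ratio[of "ldens \<rho>" lborel q] qpos q1 unfolding \<rho>_eq by simp
  moreover have "upper_int \<rho> (\<lambda>x. - ln (q x))"
    using intq unfolding integrable_iff_upper_int by blast
  ultimately have "upper_int \<rho> (\<lambda>x. (ln (q x) - ln (ldens \<rho> x)) + - ln (q x))"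
    by (rule upper_int_add)
  then show "upper_int \<rho> (\<lambda>x. - ln (ldens \<rho> x))" by simp
  assume "integrable \<rho> (\<lambda>x. ln (ldens \<rho> x))"
  then show "neg_entropy i + c i - (\<integral>x. pair_cost x \<partial>\<rho>) / (2 * v i) \<le>
      (\<integral>x. ln (ldens \<rho> x) \<partial>\<rho>)"
    using gibbs_inequality[of "ldens \<rho>" lborel q] qpos q1 D(2) intq
    unfolding \<rho>_eq lnq_int by simp
qed

lemma coupling_finite:
  assumes \<rho>: "\<rho> \<in> couplings \<nu> (\<mu> i)" and i: "i \<in> {1..l}" and fin: "reg_cost (\<epsilon> / w i) \<rho> < \<infinity>"
  shows "absolutely_continuous lborel \<rho>" "integrable \<rho> (\<lambda>x. pair_cost x)"
    "integrable \<rho> (\<lambda>x. ln (ldens \<rho> x))"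
proof -
  have "\<epsilon> / w i > 0" using eps w[OF i] by simp
  note f = reg_cost_finite[OF \<rho> this fin]
  then show "absolutely_continuous lborel \<rho>" "integrable \<rho> (\<lambda>x. pair_cost x)" by auto
  show "integrable \<rho> (\<lambda>x. ln (ldens \<rho> x))"
    unfolding integrable_iff_upper_int using f coupling_gibbs(1)[OF \<rho> i f(1,2)] by simp
qed

text \<open>Multiplying the Gibbs bound by \<open>2 * v i = \<epsilon> / w i\<close> moves the
  transport term to the other side, where it completes the regularized cost. The bound depends on
  neither \<open>\<rho>\<close> nor \<open>\<nu>\<close>, so the infimum over couplings cannot be
  \<open>-\<infinity>\<close>.\<close>

lemma reg_cost_ge:
  assumes \<rho>: "\<rho> \<in> couplings \<nu> (\<mu> i)" and i: "i \<in> {1..l}"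
  shows "ereal (\<epsilon> / w i * (neg_entropy i + c i)) \<le> reg_cost (\<epsilon> / w i) \<rho>"
proof (cases "reg_cost (\<epsilon> / w i) \<rho> < \<infinity>")
  case True
  note f = coupling_finite[OF \<rho> i True]
  have "2 * v i * (neg_entropy i + c i - (\<integral>x. pair_cost x \<partial>\<rho>) / (2 * v i)) \<le>
      2 * v i * (\<integral>x. ln (ldens \<rho> x) \<partial>\<rho>)"
    using coupling_gibbs(2)[OF \<rho> i f] v_pos[OF i] by (intro mult_left_mono) auto
  then show ?thesis
    using v_pos[OF i] unfolding reg_cost_eq[OF \<rho> f] w_v[OF i] by (simp add: right_diff_distrib)
qed auto

lemma W2_reg_sq_ge:
  "i \<in> {1..l} \<Longrightarrow> ereal (\<epsilon> / w i * (neg_entropy i + c i)) \<le> W2_reg_sq (\<epsilon> / w i) \<nu> (\<mu> i)"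
  unfolding W2_reg_sq_def by (intro INF_greatest reg_cost_ge)

lemma obtain_near_optimal_coupling:
  assumes i: "i \<in> {1..l}" and W: "W2_reg_sq (\<epsilon> / w i) \<nu> (\<mu> i) = ereal W" and "\<delta> > 0"
  obtains \<rho> where "\<rho> \<in> couplings \<nu> (\<mu> i)" "reg_cost (\<epsilon> / w i) \<rho> < ereal (W + \<delta>)"
proof -
  have "(INF \<rho>\<in>couplings \<nu> (\<mu> i). reg_cost (\<epsilon> / w i) \<rho>) < ereal (W + \<delta>)"
    using W \<open>\<delta> > 0\<close> unfolding W2_reg_sq_def by simp
  then show thesis using that by (auto simp: INF_less_iff)
qed

lemma gluing_couplings:
  assumes \<nu>: "prob_on borel \<nu>" "absolutely_continuous lborel \<nu>"
    and \<rho>: "\<And>i. i \<in> {1..l} \<Longrightarrow> \<rho> i \<in> couplings \<nu> (\<mu> i)"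
    and ac: "\<And>i. i \<in> {1..l} \<Longrightarrow> absolutely_continuous lborel (\<rho> i)"
  shows "gluing l (ldens \<nu>) (\<lambda>i. ldens (\<rho> i))"
proof
  show "distr (density lborel (\<lambda>x. ennreal (ldens (\<rho> i) x))) borel fst =
      density lborel (\<lambda>x. ennreal (ldens \<nu> x))" if "i \<in> {1..l}" for i
    using couplingsD[OF \<rho>[OF that]] ac[OF that] \<nu> by (simp add: density_lebesgue_density)
qed (use l in auto)

text \<open>Positivity almost everywhere is inherited from the marginals, so \<open>\<pi>\<close>
  may be any measure with these pair marginals, not only the glued one; \<open>objective_le\<close>
  needs this for an arbitrary competitor.\<close>

lemma AE_ln_glued_density:
  assumes \<nu>: "prob_on borel \<nu>" "absolutely_continuous lborel \<nu>"
    and \<rho>: "\<And>i. i \<in> {1..l} \<Longrightarrow> \<rho> i \<in> couplings \<nu> (\<mu> i)"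
    and ac: "\<And>i. i \<in> {1..l} \<Longrightarrow> absolutely_continuous lborel (\<rho> i)"
    and sets: "sets \<pi> = sets (star_space l)"
    and pair: "\<And>i. i \<in> {1..l} \<Longrightarrow> distr \<pi> borel (\<lambda>x. (x 0, x i)) = \<rho> i"
  shows "AE x in \<pi>. ldens \<nu> (x 0) > 0 \<and> (\<forall>i\<in>{1..l}. ldens (\<rho> i) (x 0, x i) > 0)"
    and "AE x in \<pi>. glued_density l (ldens \<nu>) (\<lambda>i. ldens (\<rho> i)) x > 0"
    and "AE x in \<pi>. (\<Sum>i\<in>{1..l}. ln (ldens (\<rho> i) (x 0, x i))) - (l - 1) * ln (ldens \<nu> (x 0)) =
      ln (glued_density l (ldens \<nu>) (\<lambda>i. ldens (\<rho> i)) x)"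
proof -
  have m: "(\<lambda>x. (x 0, x i)) \<in> borel_measurable \<pi>" if "i \<in> {1..l}" for i
    unfolding measurable_cong_sets[OF sets refl] using that by (intro measurable_star_pair) auto
  have p: "AE x in \<pi>. ldens (\<rho> i) (x 0, x i) > 0" if i: "i \<in> {1..l}" for i
    using AE_lebesgue_density_pos[OF couplingsD(1)[OF \<rho>[OF i]] ac[OF i]]
    unfolding pair[OF i, symmetric] by (rule AE_distrD[OF m[OF i]])
  have "AE x in distr (\<rho> r) borel fst. ldens \<nu> x > 0"
    using AE_lebesgue_density_pos[OF \<nu>] unfolding couplingsD(4)[OF \<rho>[OF r]] .
  from AE_distrD[OF couplingsD(6)[OF \<rho>[OF r]] this]
  have "AE x in distr \<pi> borel (\<lambda>x. (x 0, x r)). ldens \<nu> (fst x) > 0"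
    unfolding pair[OF r] .
  from AE_distrD[OF m[OF r] this] have n: "AE x in \<pi>. ldens \<nu> (x 0) > 0" by simp
  have "AE x in \<pi>. \<forall>i\<in>{1..l}. ldens (\<rho> i) (x 0, x i) > 0"
    using p by (intro AE_finite_allI) auto
  with n show pos: "AE x in \<pi>. ldens \<nu> (x 0) > 0 \<and> (\<forall>i\<in>{1..l}. ldens (\<rho> i) (x 0, x i) > 0)"
    by eventually_elim simp
  show "AE x in \<pi>. glued_density l (ldens \<nu>) (\<lambda>i. ldens (\<rho> i)) x > 0"
    using pos
  proof eventually_elim
    case (elim x)
    then show ?case unfolding glued_density_def by (intro mult_pos_pos prod_pos) auto
  qed
  show "AE x in \<pi>. (\<Sum>i\<in>{1..l}. ln (ldens (\<rho> i) (x 0, x i))) - (l - 1) * ln (ldens \<nu> (x 0)) =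
      ln (glued_density l (ldens \<nu>) (\<lambda>i. ldens (\<rho> i)) x)"
    using pos
  proof eventually_elim
    case (elim x)
    have "ln (glued_density l (ldens \<nu>) (\<lambda>i. ldens (\<rho> i)) x) =
      ln (inverse (ldens \<nu> (x 0) ^ (l - 1))) + ln (\<Prod>i\<in>{1..l}. ldens (\<rho> i) (x 0, x i))"
      unfolding glued_density_def using elim by (intro ln_mult_pos prod_pos) auto
    also have "ln (\<Prod>i\<in>{1..l}. ldens (\<rho> i) (x 0, x i)) = (\<Sum>i\<in>{1..l}. ln (ldens (\<rho> i) (x 0, x i)))"
      using elim by (intro ln_prod) (simp, metis less_irrefl)
    finally show ?case by (simp add: ln_inverse ln_realpow)
  qed
qed

text \<open>The logarithm is a sum of functions of the centre and at most one leaf, so its integral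
  sees \<open>\<pi>\<close> only through the pair marginals. This is why Gibbs' inequality against
  the glued density compares a competitor with its own gluing.\<close>

lemma integral_ln_glued_density:
  assumes \<nu>: "prob_on borel \<nu>" "absolutely_continuous lborel \<nu>"
    and \<rho>: "\<And>i. i \<in> {1..l} \<Longrightarrow> \<rho> i \<in> couplings \<nu> (\<mu> i)"
    and ac: "\<And>i. i \<in> {1..l} \<Longrightarrow> absolutely_continuous lborel (\<rho> i)"
    and sets: "sets \<pi> = sets (star_space l)"
    and pair: "\<And>i. i \<in> {1..l} \<Longrightarrow> distr \<pi> borel (\<lambda>x. (x 0, x i)) = \<rho> i"
    and lnd: "\<And>i. i \<in> {1..l} \<Longrightarrow> integrable \<pi> (\<lambda>x. ln (ldens (\<rho> i) (x 0, x i)))"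
    and lnn: "integrable \<pi> (\<lambda>x. ln (ldens \<nu> (x 0)))"
  shows "integrable \<pi> (\<lambda>x. ln (glued_density l (ldens \<nu>) (\<lambda>i. ldens (\<rho> i)) x))"
    and "(\<integral>x. ln (glued_density l (ldens \<nu>) (\<lambda>i. ldens (\<rho> i)) x) \<partial>\<pi>) =
      (\<Sum>i\<in>{1..l}. \<integral>x. ln (ldens (\<rho> i) (x 0, x i)) \<partial>\<pi>) -
      real (l - 1) * (\<integral>x. ln (ldens \<nu> (x 0)) \<partial>\<pi>)"
proof -
  let ?u = "\<lambda>x. (\<Sum>i\<in>{1..l}. ln (ldens (\<rho> i) (x 0, x i))) - (l - 1) * ln (ldens \<nu> (x 0))"
  define q where "q = glued_density l (ldens \<nu>) (\<lambda>i. ldens (\<rho> i))"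
  have intu: "integrable \<pi> ?u" by (intro integrable_arith lnd lnn)
  have "q \<in> borel_measurable (star_space l)"
    unfolding q_def by (intro glued_density_measurable) auto
  then have lnqm: "(\<lambda>x. ln (q x)) \<in> borel_measurable \<pi>"
    unfolding measurable_cong_sets[OF sets refl] by measurable
  have lnq: "AE x in \<pi>. ?u x = ln (q x)"
    unfolding q_def using \<nu> \<rho> ac sets pair by (rule AE_ln_glued_density(3))
  show "integrable \<pi> (\<lambda>x. ln (glued_density l (ldens \<nu>) (\<lambda>i. ldens (\<rho> i)) x))"
    using integrable_cong_AE_imp[OF intu lnqm lnq] unfolding q_def .
  have "(\<integral>x. ln (q x) \<partial>\<pi>) = (\<integral>x. ?u x \<partial>\<pi>)"
    using lnq lnqm intu by (intro integral_cong_AE) auto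
  also have "\<dots> = (\<integral>x. (\<Sum>i\<in>{1..l}. ln (ldens (\<rho> i) (x 0, x i))) \<partial>\<pi>) -
    (\<integral>x. (l - 1) * ln (ldens \<nu> (x 0)) \<partial>\<pi>)"
    by (intro Bochner_Integration.integral_diff integrable_arith lnd lnn)
  also have "\<dots> = (\<Sum>i\<in>{1..l}. \<integral>x. ln (ldens (\<rho> i) (x 0, x i)) \<partial>\<pi>) -
      real (l - 1) * (\<integral>x. ln (ldens \<nu> (x 0)) \<partial>\<pi>)"
    using lnd by (subst Bochner_Integration.integral_sum) auto
  finally show "(\<integral>x. ln (glued_density l (ldens \<nu>) (\<lambda>i. ldens (\<rho> i)) x) \<partial>\<pi>) =
      (\<Sum>i\<in>{1..l}. \<integral>x. ln (ldens (\<rho> i) (x 0, x i)) \<partial>\<pi>) -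
      real (l - 1) * (\<integral>x. ln (ldens \<nu> (x 0)) \<partial>\<pi>)"
    unfolding q_def .
qed

lemma pair_marginal_integral:
  assumes sets: "sets \<pi> = sets (star_space l)" and i: "i \<in> {1..l}"
    and pair: "distr \<pi> borel (\<lambda>x. (x 0, x i)) = \<rho>"
    and f [measurable]: "f \<in> borel_measurable borel"
  shows "integrable \<pi> (\<lambda>x. f (x 0, x i)) \<longleftrightarrow> integrable \<rho> f"
    "(\<integral>x. f (x 0, x i) \<partial>\<pi>) = (\<integral>x. f x \<partial>\<rho> :: real)"
    "upper_int \<pi> (\<lambda>x. f (x 0, x i)) \<longleftrightarrow> upper_int \<rho> f"
proof -
  have m: "(\<lambda>x. (x 0, x i)) \<in> borel_measurable \<pi>"
    unfolding measurable_cong_sets[OF sets refl] using i by (intro measurable_star_pair) auto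
  show "integrable \<pi> (\<lambda>x. f (x 0, x i)) \<longleftrightarrow> integrable \<rho> f"
    "(\<integral>x. f (x 0, x i) \<partial>\<pi>) = (\<integral>x. f x \<partial>\<rho>)"
    "upper_int \<pi> (\<lambda>x. f (x 0, x i)) \<longleftrightarrow> upper_int \<rho> f"
    unfolding pair[symmetric] using m by (auto simp: integrable_distr_eq integral_distr upper_int_distr)
qed

lemma pair_cost_measurable: "(\<lambda>x. (norm (snd x - fst x :: real ^ 'd))\<^sup>2) \<in> borel_measurable borel"
  by (rule borel_measurable_prodI) measurable

lemma centre_integral:
  assumes \<rho>: "\<rho> \<in> couplings \<nu> (\<mu> r)" and sets: "sets \<pi> = sets (star_space l)"
    and pair: "distr \<pi> borel (\<lambda>x. (x 0, x r)) = \<rho>"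
    and f [measurable]: "f \<in> borel_measurable borel"
  shows "integrable \<pi> (\<lambda>x. f (x 0)) \<longleftrightarrow> integrable \<nu> f"
    "(\<integral>x. f (x 0) \<partial>\<pi>) = (\<integral>x. f x \<partial>\<nu> :: real)"
proof -
  have fst: "(fst :: (real ^ 'd) \<times> (real ^ 'd) \<Rightarrow> _) \<in> borel_measurable borel"
    by (rule borel_measurable_prodI) measurable
  have "(\<lambda>x. f (fst x)) \<in> borel_measurable (borel :: ((real ^ 'd) \<times> (real ^ 'd)) measure)"
    using fst by measurable
  note m = pair_marginal_integral[OF sets r pair this]
  note D = couplingsD(4,6)[OF \<rho>]
  show "integrable \<pi> (\<lambda>x. f (x 0)) \<longleftrightarrow> integrable \<nu> f"
    "(\<integral>x. f (x 0) \<partial>\<pi>) = (\<integral>x. f x \<partial>\<nu>)"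
    using m D(2) unfolding D(1)[symmetric] by (simp_all add: integrable_distr_eq integral_distr)
qed

end

section \<open>Gluing couplings: from the objective to the divergence\<close>

context star_problem
begin

text \<open>The barycenter functional of a family of couplings equals \<open>\<epsilon> KL(\<pi> | P) + K\<close> for the glued \<open>\<pi>\<close>.\<close>

definition K :: real where "K = \<epsilon> * (neg_entropy r + (\<Sum>i\<in>{1..l}. c i))"

lemma eps_v: "i \<in> {1..l} \<Longrightarrow> \<epsilon> * (x / (2 * v i)) = w i * x"
  using eps w[of i] by (simp add: v_def)

lemma glue_couplings:
  assumes \<nu>: "prob_on borel \<nu>" "absolutely_continuous lborel \<nu>" "integrable \<nu> (\<lambda>x. ln (ldens \<nu> x))"
    and \<rho>: "\<And>i. i \<in> {1..l} \<Longrightarrow> \<rho> i \<in> couplings \<nu> (\<mu> i)"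
    and ac: "\<And>i. i \<in> {1..l} \<Longrightarrow> absolutely_continuous lborel (\<rho> i)"
    and cost: "\<And>i. i \<in> {1..l} \<Longrightarrow> integrable (\<rho> i) (\<lambda>x. pair_cost x)"
    and ln: "\<And>i. i \<in> {1..l} \<Longrightarrow> integrable (\<rho> i) (\<lambda>x. ln (ldens (\<rho> i) x))"
  obtains \<pi> where "leaf_constrained l \<mu> \<pi>" "marginal \<pi> 0 = \<nu>"
    "ereal \<epsilon> * KL \<pi> P + ereal K = (\<Sum>i\<in>{1..l}. ereal (w i) * reg_cost (\<epsilon> / w i) (\<rho> i)) +
      ereal ((real l - 1) * \<epsilon>) * diff_entropy \<nu>"
proof -
  interpret G: gluing l "ldens \<nu>" "\<lambda>i. ldens (\<rho> i)"
    by (rule gluing_couplings[OF \<nu>(1,2) \<rho> ac])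
  define q where "q = glued_density l (ldens \<nu>) (\<lambda>i. ldens (\<rho> i))"
  define \<pi> where "\<pi> = density (star_lborel l) (\<lambda>x. ennreal (q x))"
  have sets: "sets \<pi> = sets (star_space l)" by (simp add: \<pi>_def)
  have pair: "distr \<pi> borel (\<lambda>x. (x 0, x i)) = \<rho> i" if "i \<in> {1..l}" for i
    using G.glued_pair_marginal[OF that] density_lebesgue_density[OF couplingsD(1)[OF \<rho>[OF that]] ac[OF that]]
    by (simp add: \<pi>_def q_def)
  have prob: "prob_space \<pi>"
  proof (rule prob_spaceI)
    have "emeasure \<pi> (space \<pi>) = emeasure (\<rho> r) UNIV"
      using G.emeasure_glued[OF r] density_lebesgue_density[OF couplingsD(1)[OF \<rho>[OF r]] ac[OF r]]
      by (simp add: \<pi>_def q_def)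
    also have "\<dots> = 1"
      using prob_space.emeasure_space_1[OF couplingsD(2)[OF \<rho>[OF r]]]
        sets_eq_imp_space_eq[OF couplingsD(3)[OF \<rho>[OF r]]] by simp
    finally show "emeasure \<pi> (space \<pi>) = 1" .
  qed
  have m: "(\<lambda>x. (x 0, x i)) \<in> borel_measurable \<pi>" if "i \<in> {1..l}" for i
    unfolding measurable_cong_sets[OF sets refl] using that by (intro measurable_star_pair) auto
  have fs: "(fst :: (real ^ 'd) \<times> (real ^ 'd) \<Rightarrow> _) \<in> borel_measurable borel"
    "(snd :: (real ^ 'd) \<times> (real ^ 'd) \<Rightarrow> _) \<in> borel_measurable borel"
    by (auto intro!: borel_measurable_prodI)
  have marg: "marginal \<pi> i = \<mu> i" if i: "i \<in> {1..l}" for i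
    using couplingsD(5)[OF \<rho>[OF i]] unfolding pair[OF i, symmetric]
    by (subst (asm) distr_distr[OF fs(2) m[OF i]]) (simp add: marginal_def comp_def)
  have marg0: "marginal \<pi> 0 = \<nu>"
    using couplingsD(4)[OF \<rho>[OF r]] unfolding pair[OF r, symmetric]
    by (subst (asm) distr_distr[OF fs(1) m[OF r]]) (simp add: marginal_def comp_def)
  have leaf: "leaf_constrained l \<mu> \<pi>"
    using prob sets marg by (simp add: leaf_constrained_def prob_on_def)
  have cost': "integrable \<pi> (\<lambda>x. edge_cost i x)" if "i \<in> {1..l}" for i
    using pair_marginal_integral(1)[OF sets that pair[OF that] pair_cost_measurable] cost[OF that] by simp
  define C where "C i = (\<integral>x. pair_cost x \<partial>\<rho> i)" for i
  define L where "L i = (\<integral>x. ln (ldens (\<rho> i) x) \<partial>\<rho> i)" for i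
  define N where "N = (\<integral>x. ln (ldens \<nu> x) \<partial>\<nu>)"
  have C: "(\<integral>x. edge_cost i x \<partial>\<pi>) = C i" if "i \<in> {1..l}" for i
    using pair_marginal_integral(2)[OF sets that pair[OF that] pair_cost_measurable] by (simp add: C_def)
  have lnm: "(\<lambda>x. ln (ldens (\<rho> i) x)) \<in> borel_measurable borel" for i by measurable
  have intL: "integrable \<pi> (\<lambda>x. ln (ldens (\<rho> i) (x 0, x i)))" if "i \<in> {1..l}" for i
    using pair_marginal_integral(1)[OF sets that pair[OF that] lnm] ln[OF that] by simp
  have L: "(\<integral>x. ln (ldens (\<rho> i) (x 0, x i)) \<partial>\<pi>) = L i" if "i \<in> {1..l}" for i
    using pair_marginal_integral(2)[OF sets that pair[OF that] lnm] by (simp add: L_def)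
  have lnn: "(\<lambda>x. ln (ldens \<nu> x)) \<in> borel_measurable borel" by measurable
  note cN = centre_integral[OF \<rho>[OF r] sets pair[OF r] lnn]
  have intN: "integrable \<pi> (\<lambda>x. ln (ldens \<nu> (x 0)))" using cN(1) \<nu>(3) by simp
  have qm: "q \<in> borel_measurable (star_space l)"
    unfolding q_def by (intro glued_density_measurable) auto
  have intq: "integrable \<pi> (\<lambda>x. ln (q x))"
    unfolding q_def using \<nu>(1,2) \<rho> ac sets pair intL intN by (rule integral_ln_glued_density(1))
  have "(\<integral>x. ln (q x) \<partial>\<pi>) = (\<Sum>i\<in>{1..l}. \<integral>x. ln (ldens (\<rho> i) (x 0, x i)) \<partial>\<pi>) -
      real (l - 1) * (\<integral>x. ln (ldens \<nu> (x 0)) \<partial>\<pi>)"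
    unfolding q_def using \<nu>(1,2) \<rho> ac sets pair intL intN by (rule integral_ln_glued_density(2))
  also have "\<dots> = (\<Sum>i\<in>{1..l}. L i) - real (l - 1) * N"
    using L cN(2) by (simp add: N_def)
  finally have lnq_int: "(\<integral>x. ln (q x) \<partial>\<pi>) = (\<Sum>i\<in>{1..l}. L i) - real (l - 1) * N" .
  have q_nonneg: "q x \<ge> 0" for x
    unfolding q_def glued_density_def by (intro mult_nonneg_nonneg prod_nonneg) auto
  note ref = integral_ln_ref_density[OF leaf cost']
  have KL: "KL \<pi> P = ereal ((\<Sum>i\<in>{1..l}. L i) - real (l - 1) * N -
      (neg_entropy r + (\<Sum>i\<in>{1..l}. c i - C i / (2 * v i))))"
    using KL_eq_of_density[OF qm q_nonneg \<pi>_def intq ref(1)] lnq_int ref(2) C by simp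
  have "reg_cost (\<epsilon> / w i) (\<rho> i) = ereal (C i + \<epsilon> / w i * L i)" if "i \<in> {1..l}" for i
    unfolding C_def L_def by (rule reg_cost_eq[OF \<rho> ac cost ln]) (use that in auto)
  then have "(\<Sum>i\<in>{1..l}. ereal (w i) * reg_cost (\<epsilon> / w i) (\<rho> i)) = (\<Sum>i\<in>{1..l}. ereal (w i * C i + \<epsilon> * L i))"
  proof (intro sum.cong refl)
    fix i assume *: "\<And>i. i \<in> {1..l} \<Longrightarrow> reg_cost (\<epsilon> / w i) (\<rho> i) = ereal (C i + \<epsilon> / w i * L i)" and i: "i \<in> {1..l}"
    show "ereal (w i) * reg_cost (\<epsilon> / w i) (\<rho> i) = ereal (w i * C i + \<epsilon> * L i)"
      using w[OF i] by (simp add: *[OF i] distrib_left)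
  qed
  also have "\<dots> = ereal ((\<Sum>i\<in>{1..l}. w i * C i) + \<epsilon> * (\<Sum>i\<in>{1..l}. L i))"
    by (simp add: sum.distrib sum_distrib_left)
  finally have reg: "(\<Sum>i\<in>{1..l}. ereal (w i) * reg_cost (\<epsilon> / w i) (\<rho> i)) = \<dots>" .
  have ent: "diff_entropy \<nu> = ereal (- N)"
    using diff_entropy_integrable(1)[OF \<nu>] by (simp add: N_def)
  have wC: "\<epsilon> * (\<Sum>i\<in>{1..l}. C i / (2 * v i)) = (\<Sum>i\<in>{1..l}. w i * C i)"
    unfolding sum_distrib_left by (intro sum.cong eps_v) auto
  \<comment> \<open>The constants \<open>neg_entropy r\<close> and \<open>c i\<close> are exactly
    those collected in \<open>K\<close>. By \<open>l \<ge> 2\<close> the truncated difference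
    \<open>l - 1\<close> agrees with \<open>real l - 1\<close>.\<close>
  have "\<epsilon> * ((\<Sum>i\<in>{1..l}. L i) - real (l - 1) * N - (neg_entropy r + (\<Sum>i\<in>{1..l}. c i - C i / (2 * v i)))) + K =
    (\<Sum>i\<in>{1..l}. w i * C i) + \<epsilon> * (\<Sum>i\<in>{1..l}. L i) + (real l - 1) * \<epsilon> * (- N)"
    using l unfolding wC[symmetric] K_def by (simp add: sum_subtractf of_nat_diff algebra_simps)
  then have "ereal \<epsilon> * KL \<pi> P + ereal K = (\<Sum>i\<in>{1..l}. ereal (w i) * reg_cost (\<epsilon> / w i) (\<rho> i)) +
      ereal ((real l - 1) * \<epsilon>) * diff_entropy \<nu>"
    unfolding KL reg ent by simp
  with leaf marg0 show thesis using that by blast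
qed

text \<open>A finite objective already forces what gluing requires: each edge term is finite, so
  near-optimal couplings exist and are absolutely continuous with integrable log-densities,
  \<open>\<nu>\<close> inherits absolute continuity from them, and its entropy turns out
  finite.\<close>

lemma near_optimal_gluing:
  assumes \<nu>: "prob_on borel \<nu>" and fin: "barycenter_objective \<epsilon> l w \<mu> \<nu> < \<infinity>" and \<delta>: "\<delta> > 0"
  obtains \<pi> where "leaf_constrained l \<mu> \<pi>" "marginal \<pi> 0 = \<nu>"
    "ereal \<epsilon> * KL \<pi> P + ereal K \<le> barycenter_objective \<epsilon> l w \<mu> \<nu> + ereal \<delta>"
proof -
  define H where "H = diff_entropy \<nu>"
  define W where "W i = real_of_ereal (W2_reg_sq (\<epsilon> / w i) \<nu> (\<mu> i))" for i
  have obj: "barycenter_objective \<epsilon> l w \<mu> \<nu> =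
    (\<Sum>i\<in>{1..l}. ereal (w i) * W2_reg_sq (\<epsilon> / w i) \<nu> (\<mu> i)) + ereal ((real l - 1) * \<epsilon>) * H"
    using fin by (auto simp: barycenter_objective_def H_def split: if_splits)
  have W: "W2_reg_sq (\<epsilon> / w i) \<nu> (\<mu> i) = ereal (W i)" if i: "i \<in> {1..l}" for i
  proof -
    have "(\<Sum>i\<in>{1..l}. ereal (w i) * W2_reg_sq (\<epsilon> / w i) \<nu> (\<mu> i)) \<noteq> \<infinity>"
      using fin unfolding obj by auto
    then have "ereal (w i) * W2_reg_sq (\<epsilon> / w i) \<nu> (\<mu> i) \<noteq> \<infinity>"
      using i by (subst (asm) sum_Pinfty) auto
    then have "W2_reg_sq (\<epsilon> / w i) \<nu> (\<mu> i) \<noteq> \<infinity>" using w[OF i] by auto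
    moreover have "W2_reg_sq (\<epsilon> / w i) \<nu> (\<mu> i) \<noteq> - \<infinity>"
      using W2_reg_sq_ge[OF i, of \<nu>] by auto
    ultimately show ?thesis unfolding W_def by (cases "W2_reg_sq (\<epsilon> / w i) \<nu> (\<mu> i)") auto
  qed
  \<comment> \<open>Edge \<open>i\<close> enters with the factor \<open>w i\<close>, so a slack
    \<open>\<delta>'\<close> in every coupling adds up to exactly \<open>\<delta>\<close>.\<close>
  define \<delta>' where "\<delta>' = \<delta> / (\<Sum>i\<in>{1..l}. w i)"
  have wsum: "(\<Sum>i\<in>{1..l}. w i) > 0" using w l by (intro sum_pos) auto
  then have \<delta>': "\<delta>' > 0" using \<delta> by (simp add: \<delta>'_def)
  have "\<forall>i\<in>{1..l}. \<exists>\<rho>. \<rho> \<in> couplings \<nu> (\<mu> i) \<and> reg_cost (\<epsilon> / w i) \<rho> < ereal (W i + \<delta>')"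
    using obtain_near_optimal_coupling[OF _ W \<delta>'] by blast
  then obtain \<rho> where \<rho>: "\<And>i. i \<in> {1..l} \<Longrightarrow> \<rho> i \<in> couplings \<nu> (\<mu> i)"
    and reg: "\<And>i. i \<in> {1..l} \<Longrightarrow> reg_cost (\<epsilon> / w i) (\<rho> i) < ereal (W i + \<delta>')"
    by metis
  have "reg_cost (\<epsilon> / w i) (\<rho> i) < \<infinity>" if "i \<in> {1..l}" for i
    using reg[OF that] by (rule order.strict_trans) simp
  note cf = coupling_finite[OF \<rho> _ this]
  have ac: "absolutely_continuous lborel \<nu>"
    by (rule absolutely_continuous_fst_marginal[OF \<rho>[OF r] cf(1)[OF r r r]])
  \<comment> \<open>The test density on pairs is \<open>ldens \<nu>\<close> at the centre times the
    Gaussian of edge \<open>r\<close>; its mass is that of \<open>\<nu>\<close>. Removing the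
    integrable logarithms of the Gaussian and of \<open>ldens (\<rho> r)\<close> leaves
    \<open>ln (ldens \<nu>)\<close>.\<close>
  have up: "upper_int \<nu> (\<lambda>x. ln (ldens \<nu> x))"
  proof -
    note D = couplingsD[OF \<rho>[OF r]]
    interpret prob_space "\<rho> r" by (rule D(2))
    note \<rho>_eq = density_lebesgue_density[OF D(1) cf(1)[OF r r r]]
    define q where "q x = ldens \<nu> (fst x) * g r (fst x) (snd x)" for x
    have qm: "q \<in> borel_measurable borel"
      unfolding q_def by (rule borel_measurable_prodI) measurable
    have "(\<integral>\<^sup>+x. ennreal (q x) \<partial>lborel) = (\<integral>\<^sup>+y. ennreal (ldens \<nu> y) * (\<integral>\<^sup>+z. ennreal (g r y z) \<partial>lborel) \<partial>lborel)"
      unfolding nn_integral_lborel_pair(1)[OF measurable_compose[OF qm measurable_ennreal]]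
      by (intro nn_integral_cong) (simp add: q_def ennreal_mult nn_integral_cmult)
    also have "\<dots> = 1"
      using v_pos[OF r] by (simp add: nn_integral_gauss_density nn_integral_lebesgue_density[OF \<nu> ac])
    finally have q1: "(\<integral>\<^sup>+x. ennreal (q x) \<partial>lborel) < \<infinity>" by simp
    have "AE x in distr (\<rho> r) borel fst. ldens \<nu> x > 0"
      using AE_lebesgue_density_pos[OF \<nu> ac] unfolding D(4) .
    from AE_distrD[OF D(6) this] have npos: "AE x in \<rho> r. ldens \<nu> (fst x) > 0" .
    then have "AE x in \<rho> r. q x > 0"
      by eventually_elim (auto simp: q_def intro!: mult_pos_pos gauss_density_pos v_pos r)
    then have "upper_int (\<rho> r) (\<lambda>x. ln (q x) - ln (ldens (\<rho> r) x))"
      using upper_int_ln_ratio[of "ldens (\<rho> r)" lborel q] qm q1 unfolding \<rho>_eq by simp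
    moreover have "upper_int (\<rho> r) (\<lambda>x. ln (ldens (\<rho> r) x))"
      using cf(3)[OF r r r] unfolding integrable_iff_upper_int by blast
    ultimately have 1: "upper_int (\<rho> r) (\<lambda>x. (ln (q x) - ln (ldens (\<rho> r) x)) + ln (ldens (\<rho> r) x))"
      by (rule upper_int_add)
    have "integrable (\<rho> r) (\<lambda>x. c r - pair_cost x / (2 * v r))"
      by (intro integrable_arith integrable_const cf(2) r)
    then have 2: "upper_int (\<rho> r) (\<lambda>x. - (c r - pair_cost x / (2 * v r)))"
      unfolding integrable_iff_upper_int by blast
    have lm: "(\<lambda>x. ln (ldens \<nu> x)) \<in> borel_measurable borel" by measurable
    have "upper_int (\<rho> r) (\<lambda>x. ln (ldens \<nu> (fst x)))"
    proof (rule upper_int_mono[OF upper_int_add[OF 1 2]])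
      show "(\<lambda>x. ln (ldens \<nu> (fst x))) \<in> borel_measurable (\<rho> r)"
        using measurable_compose[OF D(6) lm] .
      show "AE x in \<rho> r. ln (ldens \<nu> (fst x)) \<le>
        ln (q x) - ln (ldens (\<rho> r) x) + ln (ldens (\<rho> r) x) +
        - (c r - pair_cost x / (2 * v r))"
        using npos
      proof eventually_elim
        case (elim x)
        then show ?case
          using gauss_density_pos[OF v_pos[OF r], of "fst x" "snd x"]
          by (simp add: q_def ln_mult_pos ln_g[OF r])
      qed
    qed
    then show ?thesis
      unfolding upper_int_distr[OF D(6) lm, symmetric] D(4) .
  qed
  \<comment> \<open>The other half comes from the objective itself: as
    \<open>(real l - 1) * \<epsilon>\<close> is positive, an entropy \<open>\<infinity>\<close>
    would make it infinite.\<close>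
  have "H \<noteq> \<infinity>"
  proof
    assume "H = \<infinity>"
    then have "ereal ((real l - 1) * \<epsilon>) * H = \<infinity>" using l eps by simp
    then show False using fin unfolding obj by simp
  qed
  then have "ext_integral \<nu> (\<lambda>x. ln (ldens \<nu> x)) \<noteq> - \<infinity>"
    using ac by (auto simp: H_def diff_entropy_def ext_integral_lebesgue_density[OF \<nu> ac])
  then have int: "integrable \<nu> (\<lambda>x. ln (ldens \<nu> x))"
    using up by (rule ext_integral_gt_minus_infty_imp_integrable)
  obtain \<pi> where \<pi>: "leaf_constrained l \<mu> \<pi>" "marginal \<pi> 0 = \<nu>"
    "ereal \<epsilon> * KL \<pi> P + ereal K = (\<Sum>i\<in>{1..l}. ereal (w i) * reg_cost (\<epsilon> / w i) (\<rho> i)) +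
      ereal ((real l - 1) * \<epsilon>) * H"
    unfolding H_def using glue_couplings[OF \<nu> ac int \<rho> cf] by blast
  obtain h where h: "H = ereal h"
    using diff_entropy_integrable(1)[OF \<nu> ac int] by (auto simp: H_def)
  have "(\<Sum>i\<in>{1..l}. ereal (w i) * reg_cost (\<epsilon> / w i) (\<rho> i)) \<le> (\<Sum>i\<in>{1..l}. ereal (w i) * ereal (W i + \<delta>'))"
    using reg w by (intro sum_mono ereal_mult_left_mono) (auto intro: less_imp_le)
  also have "\<dots> = ereal ((\<Sum>i\<in>{1..l}. w i * W i) + \<delta>)"
  proof -
    have "(\<Sum>i\<in>{1..l}. w i * \<delta>') = \<delta>" using wsum unfolding sum_distrib_right[symmetric] \<delta>'_def by simp
    then show ?thesis by (simp add: distrib_left sum.distrib)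
  qed
  finally have "ereal \<epsilon> * KL \<pi> P + ereal K \<le> ereal ((\<Sum>i\<in>{1..l}. w i * W i) + \<delta>) + ereal ((real l - 1) * \<epsilon>) * H"
    unfolding \<pi>(3) by (intro add_right_mono)
  also have "\<dots> = barycenter_objective \<epsilon> l w \<mu> \<nu> + ereal \<delta>"
    unfolding obj h using W by simp
  finally show thesis using that \<pi> by blast
qed

end

lemma upper_int_cancel_integrable:
  assumes "upper_int M (\<lambda>x. a x + b x)" "integrable M b"
  shows "upper_int M a"
proof -
  have "upper_int M (\<lambda>x. - b x)" using assms(2) unfolding integrable_iff_upper_int by blast
  from upper_int_add[OF assms(1) this] show ?thesis by simp
qed

section \<open>Pair marginals of a competitor: from the divergence to the objective\<close>

context star_problem
begin

text \<open>A template for the comparisons with \<open>p\<close> in \<open>objective_le\<close>: the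
  test density is a centre factor times one factor per edge, and its mass reduces to an integral
  over the centre. If all but one factor have integrable logarithms, these can be cancelled and the
  remaining logarithm is bounded above.\<close>

lemma upper_int_ln_star_product:
  assumes p: "p \<in> borel_measurable (star_space l)" and \<pi>: "\<pi> = density (star_lborel l) (\<lambda>x. ennreal (p x))"
    and lnp: "integrable \<pi> (\<lambda>x. ln (p x :: real))"
    and f: "f \<in> borel_measurable borel" "\<And>y. f y \<ge> (0 :: real)"
    and h: "\<And>i. i \<in> {1..l} \<Longrightarrow> (\<lambda>(y, z). h i y z) \<in> borel_measurable (borel \<Otimes>\<^sub>M borel)"
      "\<And>i y z. i \<in> {1..l} \<Longrightarrow> h i y z \<ge> (0 :: real)"
    and fin: "(\<integral>\<^sup>+y. ennreal (f y) * (\<Prod>i\<in>{1..l}. \<integral>\<^sup>+z. ennreal (h i y z) \<partial>lborel) \<partial>(lborel :: (real ^ 'd) measure)) < \<infinity>"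
    and pos: "AE x in \<pi>. f (x 0) > 0" "\<And>i. i \<in> {1..l} \<Longrightarrow> AE x in \<pi>. h i (x 0) (x i) > 0"
  shows "upper_int \<pi> (\<lambda>x. ln (f (x 0)) + (\<Sum>i\<in>{1..l}. ln (h i (x 0) (x i))))"
proof -
  define q where "q x = f (x 0) * (\<Prod>i\<in>{1..l}. h i (x 0) (x i))" for x
  note m = star_product_measurable[OF f(1) h(1)]
  have qm: "q \<in> borel_measurable (star_lborel l)"
    unfolding q_def measurable_cong_sets[OF sets_star_lborel refl] by (rule m(3))
  have pm: "p \<in> borel_measurable (star_lborel l)"
    unfolding measurable_cong_sets[OF sets_star_lborel refl] by (rule p)
  have "AE x in \<pi>. \<forall>i\<in>{1..l}. h i (x 0) (x i) > 0"
    using pos(2) by (intro AE_finite_allI) auto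
  with pos(1) have pos': "AE x in \<pi>. f (x 0) > 0 \<and> (\<forall>i\<in>{1..l}. h i (x 0) (x i) > 0)"
    by eventually_elim simp
  then have qpos: "AE x in \<pi>. q x > 0"
  proof eventually_elim
    case (elim x)
    then show ?case unfolding q_def by (intro mult_pos_pos prod_pos) auto
  qed
  have "(\<integral>\<^sup>+x. ennreal (q x) \<partial>star_lborel l) < \<infinity>"
    unfolding q_def using fin by (subst nn_integral_star_product[OF f(1) h(1) f(2) h(2)]) auto
  then have "upper_int \<pi> (\<lambda>x. ln (q x) - ln (p x))"
    using qpos unfolding \<pi> by (intro upper_int_ln_ratio pm qm)
  moreover have "upper_int \<pi> (\<lambda>x. ln (p x))"
    using lnp unfolding integrable_iff_upper_int by blast
  ultimately have *: "upper_int \<pi> (\<lambda>x. (ln (q x) - ln (p x)) + ln (p x))" by (rule upper_int_add)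
  show ?thesis
  proof (rule upper_int_mono[OF *])
    have sets: "sets \<pi> = sets (star_space l)" by (simp add: \<pi>)
    have "(\<lambda>x. ln (f (x 0))) \<in> borel_measurable (star_space l)" using m(1) by measurable
    moreover have "(\<lambda>x. ln (h i (x 0) (x i))) \<in> borel_measurable (star_space l)" if "i \<in> {1..l}" for i
      using m(2)[OF _ that] by measurable
    ultimately show "(\<lambda>x. ln (f (x 0)) + (\<Sum>i\<in>{1..l}. ln (h i (x 0) (x i)))) \<in> borel_measurable \<pi>"
      unfolding measurable_cong_sets[OF sets refl] by (intro borel_measurable_add borel_measurable_sum)
    show "AE x in \<pi>. ln (f (x 0)) + (\<Sum>i\<in>{1..l}. ln (h i (x 0) (x i))) \<le> ln (q x) - ln (p x) + ln (p x)"
      using pos'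
    proof eventually_elim
      case (elim x)
      have "ln (q x) = ln (f (x 0)) + ln (\<Prod>i\<in>{1..l}. h i (x 0) (x i))"
        unfolding q_def using elim by (intro ln_mult_pos prod_pos) auto
      also have "ln (\<Prod>i\<in>{1..l}. h i (x 0) (x i)) = (\<Sum>i\<in>{1..l}. ln (h i (x 0) (x i)))"
        using elim by (intro ln_prod) (simp, metis less_irrefl)
      finally show ?case by simp
    qed
  qed
qed

text \<open>Two estimates enter: the pair marginals of \<open>\<pi>\<close> are competitors in the
  transport problems, and by Gibbs' inequality their glued density has a log-integral under
  \<open>\<pi>\<close> no larger than that of \<open>p\<close>. Most of the proof makes the
  logarithms of pair and centre densities integrable, so that all terms may be separated.\<close>

lemma objective_le:
  assumes \<pi>: "leaf_constrained l \<mu> \<pi>" and KL: "KL \<pi> P < \<infinity>"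
  shows "prob_on borel (marginal \<pi> 0)"
    and "barycenter_objective \<epsilon> l w \<mu> (marginal \<pi> 0) \<le> ereal \<epsilon> * KL \<pi> P + ereal K"
proof -
  note leaf = leaf_constrainedD[OF \<pi>]
  note sets = leaf(2)
  interpret prob_space \<pi> by (rule leaf(1))
  obtain p where p: "p \<in> borel_measurable (star_space l)" "\<And>x. p x \<ge> 0"
    and \<pi>_eq: "\<pi> = density (star_lborel l) (\<lambda>x. ennreal (p x))" and lnp: "integrable \<pi> (\<lambda>x. ln (p x))"
    and cost: "\<And>i. i \<in> {1..l} \<Longrightarrow> integrable \<pi> (\<lambda>x. edge_cost i x)"
    using KL_finite_obtain_density[OF \<pi> KL] by blast
  have pm: "p \<in> borel_measurable (star_lborel l)"
    unfolding measurable_cong_sets[OF sets_star_lborel refl] by (rule p)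
  define \<nu> where "\<nu> = marginal \<pi> 0"
  define \<rho> where "\<rho> i = distr \<pi> borel (\<lambda>x. (x 0, x i))" for i
  define n where "n = ldens \<nu>"
  define d where "d i = ldens (\<rho> i)" for i
  have m0: "(\<lambda>x. x 0) \<in> borel_measurable \<pi>" by (rule leaf(4)) simp
  have m: "(\<lambda>x. (x 0, x i)) \<in> borel_measurable \<pi>" if "i \<in> {1..l}" for i
    unfolding measurable_cong_sets[OF sets refl] using that by (intro measurable_star_pair) auto
  have fs: "(fst :: (real ^ 'd) \<times> (real ^ 'd) \<Rightarrow> _) \<in> borel_measurable borel"
    "(snd :: (real ^ 'd) \<times> (real ^ 'd) \<Rightarrow> _) \<in> borel_measurable borel"
    by (auto intro!: borel_measurable_prodI)
  have \<nu>: "prob_on borel \<nu>"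
    unfolding \<nu>_def marginal_def prob_on_def using m0 by (simp add: prob_space_distr)
  then show "prob_on borel (marginal \<pi> 0)" by (simp add: \<nu>_def)
  have \<rho>: "\<rho> i \<in> couplings \<nu> (\<mu> i)" if i: "i \<in> {1..l}" for i
  proof -
    have "distr (\<rho> i) borel fst = \<nu>" "distr (\<rho> i) borel snd = \<mu> i"
      unfolding \<rho>_def \<nu>_def marginal_def leaf(3)[OF i, symmetric]
      by (subst distr_distr[OF _ m[OF i]], use fs in \<open>simp_all add: comp_def\<close>)+
    then show ?thesis
      using m[OF i] by (simp add: couplings_def prob_on_def \<rho>_def prob_space_distr)
  qed
  have ac: "absolutely_continuous lborel (\<rho> i)" if i: "i \<in> {1..l}" for i
  proof (rule absolutely_continuous_trans[OF absolutely_continuous_star_pair[OF i]])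
    have "absolutely_continuous (star_lborel l) \<pi>"
      unfolding \<pi>_eq using pm by (intro absolutely_continuousI_density) auto
    moreover have "(\<lambda>x. (x 0, x i)) \<in> star_lborel l \<rightarrow>\<^sub>M (borel :: ((real ^ 'd) \<times> (real ^ 'd)) measure)"
      unfolding measurable_cong_sets[OF sets_star_lborel refl] using i by (intro measurable_star_pair) auto
    ultimately show "absolutely_continuous (distr (star_lborel l) borel (\<lambda>x. (x 0, x i))) (\<rho> i)"
      unfolding \<rho>_def using sets by (intro absolutely_continuous_distr) auto
  qed
  have ac\<nu>: "absolutely_continuous lborel \<nu>"
    by (rule absolutely_continuous_fst_marginal[OF \<rho>[OF r] ac[OF r]])
  interpret G: gluing l n d
    unfolding n_def d_def by (rule gluing_couplings[OF \<nu> ac\<nu> \<rho> ac])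
  have pos: "AE x in \<pi>. n (x 0) > 0 \<and> (\<forall>i\<in>{1..l}. d i (x 0, x i) > 0)"
    unfolding n_def d_def using \<nu> ac\<nu> \<rho> ac sets \<rho>_def[symmetric] by (rule AE_ln_glued_density(1))
  have npos: "AE x in \<pi>. n (x 0) > 0" using pos by eventually_elim simp
  have dpos: "AE x in \<pi>. d i (x 0, x i) > 0" if "i \<in> {1..l}" for i
    using pos by eventually_elim (use that in simp)
  have gpos: "g i y z > 0" if "i \<in> {1..l}" for i y z by (rule gauss_density_pos[OF v_pos[OF that]])
  have [simp]: "d i x \<ge> 0" "n y \<ge> 0" for i x y by (auto simp: d_def n_def)
  have [measurable]: "n \<in> borel_measurable borel" "\<And>i. d i \<in> borel_measurable borel"
    by (auto simp: n_def d_def)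
  have d_pair: "(\<lambda>(y, z). d i (y, z)) \<in> borel_measurable (borel \<Otimes>\<^sub>M borel)" for i
    unfolding borel_prod by simp
  have lnd_m: "(\<lambda>x. ln (d i x)) \<in> borel_measurable borel" for i by measurable
  have lnn_m: "(\<lambda>x. ln (n x)) \<in> borel_measurable borel" by measurable
  have lnnm: "(\<lambda>x. ln (n (x 0))) \<in> borel_measurable \<pi>" by (rule measurable_compose[OF m0 lnn_m])
  have cost\<rho>: "integrable (\<rho> i) (\<lambda>x. pair_cost x)" if "i \<in> {1..l}" for i
    using pair_marginal_integral(1)[OF sets that \<rho>_def[symmetric] pair_cost_measurable] cost[OF that] by simp
  have lng: "integrable \<pi> (\<lambda>x. ln (g i (x 0) (x i)))" if "i \<in> {1..l}" for i
    unfolding ln_g[OF that]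
    by (intro integrable_arith integrable_const cost that)
  have sum_lng: "integrable \<pi> (\<lambda>x. \<Sum>i\<in>{1..l} - {j}. ln (g i (x 0) (x i)))" for j
    by (intro integrable_arith lng) auto
  have d_mass: "(\<integral>\<^sup>+y. \<integral>\<^sup>+z. ennreal (d i (y, z)) \<partial>lborel \<partial>lborel) = 1" if i: "i \<in> {1..l}" for i
    using nn_integral_lebesgue_density[OF couplingsD(1)[OF \<rho>[OF i]] ac[OF i]]
    by (subst (asm) nn_integral_lborel_pair(1)) (auto simp: d_def)
  have n_mass: "(\<integral>\<^sup>+y. ennreal (n y) \<partial>lborel) = 1"
    unfolding n_def by (rule nn_integral_lebesgue_density[OF \<nu> ac\<nu>])
  note star = upper_int_ln_star_product[OF p(1) \<pi>_eq lnp]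
  \<comment> \<open>The lower half is \<open>coupling_gibbs\<close>. For the upper half the Gaussian
    of edge \<open>i\<close> is exchanged for \<open>d i\<close>; the other edges still integrate to
    1, so the test density has the mass of \<open>d i\<close>.\<close>
  have lnd: "integrable \<pi> (\<lambda>x. ln (d i (x 0, x i)))" if i: "i \<in> {1..l}" for i
    unfolding integrable_iff_upper_int
  proof
    show "upper_int \<pi> (\<lambda>x. - ln (d i (x 0, x i)))"
      using pair_marginal_integral(3)[OF sets i \<rho>_def[symmetric], of "\<lambda>x. - ln (d i x)"]
        coupling_gibbs(1)[OF \<rho>[OF i] i ac[OF i] cost\<rho>[OF i]] by (simp add: d_def)
    define h where "h j y z = (if j = i then d i (y, z) else g j y z)" for j y z
    have "upper_int \<pi> (\<lambda>x. ln 1 + (\<Sum>j\<in>{1..l}. ln (h j (x 0) (x j))))"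
    proof (rule star)
      show "(\<lambda>(y, z). h j y z) \<in> borel_measurable (borel \<Otimes>\<^sub>M borel)" for j
        using d_pair unfolding h_def by (cases "j = i") auto
      have "(\<Prod>j\<in>{1..l}. \<integral>\<^sup>+z. ennreal (h j y z) \<partial>lborel) = (\<integral>\<^sup>+z. ennreal (d i (y, z)) \<partial>lborel)" for y
      proof -
        have "(\<Prod>j\<in>{1..l}. \<integral>\<^sup>+z. ennreal (h j y z) \<partial>lborel) =
          (\<Prod>j\<in>{1..l}. if j = i then \<integral>\<^sup>+z. ennreal (d i (y, z)) \<partial>lborel else 1)"
          by (intro prod.cong) (auto simp: h_def nn_integral_gauss_density v_pos)
        then show ?thesis using i by (simp add: prod.delta)
      qed
      then show "(\<integral>\<^sup>+y. ennreal 1 * (\<Prod>j\<in>{1..l}. \<integral>\<^sup>+z. ennreal (h j y z) \<partial>lborel) \<partial>lborel) < \<infinity>"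
        using d_mass[OF i] by simp
      show "AE x in \<pi>. 0 < h j (x 0) (x j)" if "j \<in> {1..l}" for j
        using dpos[OF i] gpos[OF that] by (cases "j = i") (auto simp: h_def)
    qed (auto simp: h_def)
    moreover have "(\<Sum>j\<in>{1..l}. ln (h j (x 0) (x j))) =
      ln (d i (x 0, x i)) + (\<Sum>j\<in>{1..l} - {i}. ln (g j (x 0) (x j)))" for x
      using i by (subst sum.remove[of _ i]) (auto simp: h_def)
    ultimately have "upper_int \<pi> (\<lambda>x. ln (d i (x 0, x i)) + (\<Sum>j\<in>{1..l} - {i}. ln (g j (x 0) (x j))))"
      by simp
    then show "upper_int \<pi> (\<lambda>x. ln (d i (x 0, x i)))"
      by (rule upper_int_cancel_integrable[OF _ sum_lng])
  qed
  have lnn: "integrable \<pi> (\<lambda>x. ln (n (x 0)))"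
    unfolding integrable_iff_upper_int
  proof
    \<comment> \<open>The test law has centre marginal \<open>\<nu>\<close> and independent Gaussian
      leaves around the centre.\<close>
    have "upper_int \<pi> (\<lambda>x. ln (n (x 0)) + (\<Sum>j\<in>{1..l}. ln (g j (x 0) (x j))))"
    proof (rule star)
      show "(\<integral>\<^sup>+y. ennreal (n y) * (\<Prod>j\<in>{1..l}. \<integral>\<^sup>+z. ennreal (g j y z) \<partial>lborel) \<partial>lborel) < \<infinity>"
        using n_mass by (simp add: nn_integral_gauss_density v_pos)
    qed (use npos gpos in auto)
    then show "upper_int \<pi> (\<lambda>x. ln (n (x 0)))"
      by (rule upper_int_cancel_integrable[OF _ Bochner_Integration.integrable_sum[OF lng]])
    (* The lower bound on n uses a second leaf k: compare p with the density
       d r * \<phi> k * g k * (remaining Gaussians) / n, whose integral is at most 1. *)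
    obtain k where k: "k \<in> {1..l}" "k \<noteq> r"
      using l r that[of "if r = 1 then 2 else 1"] by auto
    note \<phi>k = leaf_constrained_\<phi>[OF \<pi> k(1)]
    define h where "h j y z = (if j = r then d r (y, z) else if j = k then \<phi> k z * g k y z else g j y z)" for j y z
    have "upper_int \<pi> (\<lambda>x. ln (inverse (n (x 0))) + (\<Sum>j\<in>{1..l}. ln (h j (x 0) (x j))))"
    proof (rule star)
      show "(\<lambda>(y, z). h j y z) \<in> borel_measurable (borel \<Otimes>\<^sub>M borel)" for j
        using d_pair unfolding h_def by (cases "j = r"; cases "j = k") auto
      have prod: "(\<Prod>j\<in>{1..l}. \<integral>\<^sup>+z. ennreal (h j y z) \<partial>lborel) =
        (\<integral>\<^sup>+z. ennreal (d r (y, z)) \<partial>lborel) * (\<integral>\<^sup>+z. ennreal (\<phi> k z * g k y z) \<partial>lborel)" for y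
      proof -
        have "(\<Prod>j\<in>{1..l}. \<integral>\<^sup>+z. ennreal (h j y z) \<partial>lborel) =
          (\<Prod>j\<in>{1..l}. (if j = r then \<integral>\<^sup>+z. ennreal (d r (y, z)) \<partial>lborel else 1) *
            (if j = k then \<integral>\<^sup>+z. ennreal (\<phi> k z * g k y z) \<partial>lborel else 1))"
          using k by (intro prod.cong) (auto simp: h_def nn_integral_gauss_density v_pos)
        then show ?thesis using k r by (simp add: prod.distrib prod.delta)
      qed
      have "(\<integral>\<^sup>+y. ennreal (inverse (n y)) * (\<Prod>j\<in>{1..l}. \<integral>\<^sup>+z. ennreal (h j y z) \<partial>lborel) \<partial>lborel) \<le>
        (\<integral>\<^sup>+y. (\<integral>\<^sup>+z. ennreal (\<phi> k z * g k y z) \<partial>lborel) \<partial>lborel)"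
      proof (rule nn_integral_mono_AE)
        show "AE y in lborel. ennreal (inverse (n y)) * (\<Prod>j\<in>{1..l}. \<integral>\<^sup>+z. ennreal (h j y z) \<partial>lborel) \<le>
          (\<integral>\<^sup>+z. ennreal (\<phi> k z * g k y z) \<partial>lborel)"
          using G.AE_marginal
        proof eventually_elim
          case (elim y)
          then have dn: "(\<integral>\<^sup>+z. ennreal (d r (y, z)) \<partial>lborel) = ennreal (n y)" using r by blast
          \<comment> \<open>Where \<open>n y = 0\<close> the inverse is 0 by convention and the
            product is 0, not 1.\<close>
          have "ennreal (inverse (n y)) * ennreal (n y) \<le> 1"
            by (cases "n y = 0") (auto simp: ennreal_mult[symmetric])
          then have "ennreal (inverse (n y)) * ennreal (n y) * (\<integral>\<^sup>+z. ennreal (\<phi> k z * g k y z) \<partial>lborel) \<le>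
            1 * (\<integral>\<^sup>+z. ennreal (\<phi> k z * g k y z) \<partial>lborel)"
            by (rule mult_right_mono) simp
          then show ?case unfolding prod dn by (simp add: mult.assoc)
        qed
      qed
      also have "\<dots> = 1" by (rule nn_integral_\<phi>_gauss[OF k(1) v_pos[OF k(1)]])
      finally show "(\<integral>\<^sup>+y. ennreal (inverse (n y)) * (\<Prod>j\<in>{1..l}. \<integral>\<^sup>+z. ennreal (h j y z) \<partial>lborel) \<partial>lborel) < \<infinity>"
        by (rule le_less_trans) simp
      show "AE x in \<pi>. 0 < h j (x 0) (x j)" if "j \<in> {1..l}" for j
        using dpos[OF r] \<phi>k(1)
      proof eventually_elim
        case (elim x)
        then show ?case using gpos[OF that, of "x 0" "x j"] by (auto simp: h_def)
      qed
      show "AE x in \<pi>. 0 < inverse (n (x 0))" using npos by eventually_elim simp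
    qed (auto simp: h_def)
    note up = this
    \<comment> \<open>What the test logarithm contains besides \<open>- ln (n (x 0))\<close>. It is
      integrable by \<open>lnd\<close> for leaf \<open>r\<close>, the finite entropy of
      \<open>\<mu> k\<close>, and the finite costs.\<close>
    define s where "s x = ln (d r (x 0, x r)) + ln (\<phi> k (x k)) + (\<Sum>j\<in>{1..l} - {r}. ln (g j (x 0) (x j)))" for x
    have ints: "integrable \<pi> s"
      unfolding s_def by (intro integrable_arith lnd[OF r] \<phi>k(2) sum_lng)
    have eq: "AE x in \<pi>. - ln (n (x 0)) + s x \<le> ln (inverse (n (x 0))) + (\<Sum>j\<in>{1..l}. ln (h j (x 0) (x j)))"
      using \<phi>k(1)
    proof eventually_elim
      case (elim x)
      have "(\<Sum>j\<in>{1..l}. ln (h j (x 0) (x j))) =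
        ln (d r (x 0, x r)) + (\<Sum>j\<in>{1..l} - {r}. ln (h j (x 0) (x j)))"
        using r by (subst sum.remove[of _ r]) (auto simp: h_def)
      also have "(\<Sum>j\<in>{1..l} - {r}. ln (h j (x 0) (x j))) =
        (\<Sum>j\<in>{1..l} - {r}. ln (g j (x 0) (x j)) + (if j = k then ln (\<phi> k (x k)) else 0))"
      proof (rule sum.cong)
        fix j assume j: "j \<in> {1..l} - {r}"
        then have "g j (x 0) (x j) > 0" by (intro gpos) auto
        then show "ln (h j (x 0) (x j)) = ln (g j (x 0) (x j)) + (if j = k then ln (\<phi> k (x k)) else 0)"
          using j elim by (auto simp: h_def ln_mult_pos)
      qed simp
      finally show ?case using k by (simp add: s_def sum.distrib sum.delta ln_inverse)
    qed
    have "upper_int \<pi> (\<lambda>x. - ln (n (x 0)) + s x)"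
      by (rule upper_int_mono[OF up _ eq]) (use lnnm ints in auto)
    then show "upper_int \<pi> (\<lambda>x. - ln (n (x 0)))"
      by (rule upper_int_cancel_integrable[OF _ ints])
  qed
  define q where "q = glued_density l n d"
  have q_pos: "AE x in \<pi>. q x > 0"
    unfolding q_def n_def d_def using \<nu> ac\<nu> \<rho> ac sets \<rho>_def[symmetric] by (rule AE_ln_glued_density(2))
  have qm: "q \<in> borel_measurable (star_space l)"
    unfolding q_def by (intro glued_density_measurable) auto
  have intq: "integrable \<pi> (\<lambda>x. ln (q x))"
    unfolding q_def n_def d_def
    using \<nu> ac\<nu> \<rho> ac sets \<rho>_def[symmetric] lnd[unfolded d_def] lnn[unfolded n_def] by (rule integral_ln_glued_density(1))
  have "(\<integral>\<^sup>+x. ennreal (q x) \<partial>star_lborel l) = emeasure (density (star_lborel l) q) (space (density (star_lborel l) q))"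
    unfolding space_density using qm
    by (subst emeasure_density[OF _ sets.top]) (auto intro!: nn_integral_cong simp: measurable_cong_sets[OF sets_star_lborel refl])
  also have "\<dots> = emeasure (density lborel (d r)) UNIV"
    unfolding q_def by (rule G.emeasure_glued[OF r])
  also have "\<dots> = 1"
    using d_mass[OF r] by (simp add: emeasure_density nn_integral_lborel_pair(1))
  finally have q1: "(\<integral>\<^sup>+x. ennreal (q x) \<partial>star_lborel l) \<le> 1" by simp
  \<comment> \<open>By \<open>integral_ln_glued_density\<close> the left side involves only the
    marginals of \<open>\<pi>\<close>; this is where gluing them improves on
    \<open>\<pi>\<close>.\<close>
  have gibbs: "(\<integral>x. ln (q x) \<partial>\<pi>) \<le> (\<integral>x. ln (p x) \<partial>\<pi>)"
    using gibbs_inequality[of p "star_lborel l" q] pm qm q1 q_pos intq lnp prob_space_axioms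
    unfolding \<pi>_eq[symmetric] by (simp add: measurable_cong_sets[OF sets_star_lborel refl])
  define C where "C i = (\<integral>x. edge_cost i x \<partial>\<pi>)" for i
  define L where "L i = (\<integral>x. ln (d i (x 0, x i)) \<partial>\<pi>)" for i
  define N where "N = (\<integral>x. ln (n (x 0)) \<partial>\<pi>)"
  have lnq_int: "(\<integral>x. ln (q x) \<partial>\<pi>) = (\<Sum>i\<in>{1..l}. L i) - real (l - 1) * N"
    unfolding q_def L_def N_def n_def d_def
    using \<nu> ac\<nu> \<rho> ac sets \<rho>_def[symmetric] lnd[unfolded d_def] lnn[unfolded n_def] by (rule integral_ln_glued_density(2))
  note ref = integral_ln_ref_density[OF \<pi> cost]
  have KL_eq: "KL \<pi> P = ereal ((\<integral>x. ln (p x) \<partial>\<pi>) - (neg_entropy r + (\<Sum>i\<in>{1..l}. c i - C i / (2 * v i))))"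
    using KL_eq_of_density[OF p \<pi>_eq lnp ref(1)] ref(2) by (simp add: C_def)
  have int\<nu>: "integrable \<nu> (\<lambda>x. ln (ldens \<nu> x))"
    and N: "(\<integral>x. ln (ldens \<nu> x) \<partial>\<nu>) = N"
    using centre_integral[OF \<rho>[OF r] sets \<rho>_def[symmetric] lnn_m] lnn by (simp_all add: N_def n_def)
  note ent = diff_entropy_integrable[OF \<nu> ac\<nu> int\<nu>, unfolded N]
  have W: "ereal (w i) * W2_reg_sq (\<epsilon> / w i) \<nu> (\<mu> i) \<le> ereal (w i * C i + \<epsilon> * L i)" if i: "i \<in> {1..l}" for i
  proof -
    have int\<rho>: "integrable (\<rho> i) (\<lambda>x. ln (ldens (\<rho> i) x))"
      and L: "(\<integral>x. ln (ldens (\<rho> i) x) \<partial>\<rho> i) = L i"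
      using pair_marginal_integral(1,2)[OF sets i \<rho>_def[symmetric] lnd_m[of i]] lnd[OF i]
      by (simp_all add: L_def d_def)
    have C: "(\<integral>x. pair_cost x \<partial>\<rho> i) = C i"
      using pair_marginal_integral(2)[OF sets i \<rho>_def[symmetric] pair_cost_measurable] by (simp add: C_def)
    have "W2_reg_sq (\<epsilon> / w i) \<nu> (\<mu> i) \<le> reg_cost (\<epsilon> / w i) (\<rho> i)"
      unfolding W2_reg_sq_def by (rule INF_lower[OF \<rho>[OF i]])
    also have "\<dots> = ereal (C i + \<epsilon> / w i * L i)"
      using reg_cost_eq[OF \<rho>[OF i] ac[OF i] cost\<rho>[OF i] int\<rho>] by (simp add: C L)
    finally have "ereal (w i) * W2_reg_sq (\<epsilon> / w i) \<nu> (\<mu> i) \<le> ereal (w i) * ereal (C i + \<epsilon> / w i * L i)"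
      using w[OF i] by (intro ereal_mult_left_mono) auto
    also have "\<dots> = ereal (w i * C i + \<epsilon> * L i)" using w[OF i] by (simp add: distrib_left)
    finally show ?thesis .
  qed
  have "barycenter_objective \<epsilon> l w \<mu> \<nu> =
    (\<Sum>i\<in>{1..l}. ereal (w i) * W2_reg_sq (\<epsilon> / w i) \<nu> (\<mu> i)) + ereal ((real l - 1) * \<epsilon>) * ereal (- N)"
    using ent by (simp add: barycenter_objective_def)
  also have "\<dots> \<le> (\<Sum>i\<in>{1..l}. ereal (w i * C i + \<epsilon> * L i)) + ereal ((real l - 1) * \<epsilon>) * ereal (- N)"
    by (intro add_right_mono sum_mono W)
  also have "\<dots> = ereal ((\<Sum>i\<in>{1..l}. w i * C i) + \<epsilon> * ((\<Sum>i\<in>{1..l}. L i) - real (l - 1) * N))"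
    using l by (simp add: sum.distrib sum_distrib_left[symmetric] of_nat_diff algebra_simps)
  also have "\<dots> \<le> ereal ((\<Sum>i\<in>{1..l}. w i * C i) + \<epsilon> * (\<integral>x. ln (p x) \<partial>\<pi>))"
    using gibbs eps unfolding lnq_int by simp
  also have "(\<Sum>i\<in>{1..l}. w i * C i) = \<epsilon> * (\<Sum>i\<in>{1..l}. C i / (2 * v i))"
    unfolding sum_distrib_left by (intro sum.cong eps_v[symmetric]) auto
  also have "ereal (\<epsilon> * (\<Sum>i\<in>{1..l}. C i / (2 * v i)) + \<epsilon> * (\<integral>x. ln (p x) \<partial>\<pi>)) = ereal \<epsilon> * KL \<pi> P + ereal K"
    unfolding KL_eq K_def by (simp add: sum_subtractf algebra_simps)
  finally show "barycenter_objective \<epsilon> l w \<mu> (marginal \<pi> 0) \<le> ereal \<epsilon> * KL \<pi> P + ereal K"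
    unfolding \<nu>_def .
qed

end

section \<open>Leaf constraints, existence of the projection, and the conclusion\<close>

lemma prob_space_eqI_close:
  assumes \<mu>: "prob_space \<mu>" "sets \<mu> = sets M" and \<nu>: "prob_space \<nu>" "sets \<nu> = sets M"
    and close: "\<And>A \<delta>. A \<in> sets M \<Longrightarrow> \<delta> > 0 \<Longrightarrow> \<bar>measure \<mu> A - measure \<nu> A\<bar> \<le> b * \<delta>" and "b > 0"
  shows "\<mu> = \<nu>"
proof (rule measure_eqI)
  interpret M: prob_space \<mu> by fact
  interpret N: prob_space \<nu> by fact
  fix A assume "A \<in> sets \<mu>"
  then have A: "A \<in> sets M" using \<mu> by simp
  have "\<bar>measure \<mu> A - measure \<nu> A\<bar> \<le> 0 + e" if "e > 0" for e
    using close[OF A, of "e / b"] that \<open>b > 0\<close> by simp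
  then have "\<bar>measure \<mu> A - measure \<nu> A\<bar> \<le> 0" by (rule field_le_epsilon)
  then show "emeasure \<mu> A = emeasure \<nu> A"
    by (simp add: M.emeasure_eq_measure N.emeasure_eq_measure)
qed (use assms in simp)

lemma ereal_affine_le_cancel:
  fixes x :: ereal
  assumes "ereal e * x + ereal k \<le> ereal (e * y + k)" "e > 0"
  shows "x \<le> ereal y"
  using assms by (cases x) auto

context star_problem
begin

lemma measure_leaf_marginal:
  assumes "sets \<pi> = sets (star_space l)" "i \<in> {0..l}" "A \<in> sets borel"
  shows "measure (marginal \<pi> i) A = measure \<pi> ((\<lambda>x. x i) -` A \<inter> space (star_space l))"
proof -
  have "(\<lambda>x. x i) \<in> borel_measurable \<pi>"
    unfolding measurable_cong_sets[OF assms(1) refl] using assms(2) by (rule measurable_component_singleton)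
  then show ?thesis
    using assms sets_eq_imp_space_eq[OF assms(1)] by (simp add: marginal_def measure_distr)
qed

lemma prob_on_marginal:
  assumes "prob_space \<pi>" "sets \<pi> = sets (star_space l)" "i \<in> {0..l}"
  shows "prob_on borel (marginal \<pi> i)"
proof -
  have "(\<lambda>x. x i) \<in> borel_measurable \<pi>"
    unfolding measurable_cong_sets[OF assms(2) refl] using assms(3) by (rule measurable_component_singleton)
  then show ?thesis
    using assms(1) by (simp add: prob_on_def marginal_def prob_space.prob_space_distr)
qed

text \<open>Equality of marginals becomes a family of equalities of numbers, one per cylinder set.
  In this form the constraint passes to midpoints and setwise limits, as
  \<open>information_projection\<close> asks.\<close>

lemma leaf_constrained_iff:
  "leaf_constrained l \<mu> \<pi> \<longleftrightarrow> prob_on P \<pi> \<and> (\<forall>i\<in>{1..l}. \<forall>A\<in>sets borel.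
    measure \<pi> ((\<lambda>x. x i) -` A \<inter> space (star_space l)) = measure (\<mu> i) A)"
proof (cases "prob_on P \<pi>")
  case True
  then have \<pi>: "prob_space \<pi>" "sets \<pi> = sets (star_space l)" by (auto simp: prob_on_def)
  have "marginal \<pi> i = \<mu> i \<longleftrightarrow>
    (\<forall>A\<in>sets borel. measure \<pi> ((\<lambda>x. x i) -` A \<inter> space (star_space l)) = measure (\<mu> i) A)"
    if i: "i \<in> {1..l}" for i
  proof -
    have i0: "i \<in> {0..l}" using i by auto
    note m = measure_leaf_marginal[OF \<pi>(2) i0]
    have "marginal \<pi> i = \<mu> i" if "\<forall>A\<in>sets borel. measure (marginal \<pi> i) A = measure (\<mu> i) A"
      using prob_on_marginal[OF \<pi> i0] \<mu>_prob[OF i] that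
      by (intro prob_space_eqI_close[where M=borel and b=1]) (auto simp: prob_on_def)
    then show ?thesis using m by auto
  qed
  then show ?thesis using True \<pi> by (auto simp: leaf_constrained_def prob_on_def)
qed (auto simp: leaf_constrained_def prob_on_def)

lemma information_projection_leaf:
  assumes "\<exists>\<pi>. leaf_constrained l \<mu> \<pi> \<and> KL \<pi> P < \<infinity>"
  obtains \<pi>' V where "leaf_constrained l \<mu> \<pi>'" "KL \<pi>' P = ereal V"
    "\<And>\<pi>. leaf_constrained l \<mu> \<pi> \<Longrightarrow> ereal V \<le> KL \<pi> P"
    "\<And>\<pi> A \<delta>. leaf_constrained l \<mu> \<pi> \<Longrightarrow> \<delta> > 0 \<Longrightarrow> KL \<pi> P \<le> ereal (V + \<delta>\<^sup>2) \<Longrightarrow> A \<in> sets (star_space l) \<Longrightarrow>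
      \<bar>measure \<pi> A - measure \<pi>' A\<bar> \<le> 17 * \<delta>"
proof -
  interpret P: prob_space P by (rule prob_space_P)
  have pre: "(\<lambda>x. x i) -` A \<inter> space (star_space l) \<in> sets P"
    if "i \<in> {1..l}" "A \<in> sets borel" for i and A :: "(real ^ 'd) set"
  proof -
    have "(\<lambda>x. x i) \<in> borel_measurable (star_space l)"
      using that(1) by (intro measurable_component_singleton) auto
    from measurable_sets[OF this that(2)] show ?thesis by simp
  qed
  show thesis
  proof (rule P.information_projection[where C="leaf_constrained l \<mu>"])
    show "leaf_constrained l \<mu> \<pi> \<Longrightarrow> prob_on P \<pi>" for \<pi> by (simp add: leaf_constrained_iff)
  next
    fix \<pi>1 \<pi>2 \<pi>
    assume *: "leaf_constrained l \<mu> \<pi>1" "leaf_constrained l \<mu> \<pi>2" "prob_on P \<pi>"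
      and avg: "\<And>A. A \<in> sets P \<Longrightarrow> measure \<pi> A = (measure \<pi>1 A + measure \<pi>2 A) / 2"
    have "measure \<pi> ((\<lambda>x. x i) -` A \<inter> space (star_space l)) = measure (\<mu> i) A"
      if "i \<in> {1..l}" "A \<in> sets borel" for i A
      using avg[OF pre[OF that]] *(1,2) that by (simp add: leaf_constrained_iff)
    then show "leaf_constrained l \<mu> \<pi>" using *(3) by (simp add: leaf_constrained_iff)
  next
    fix \<pi>s :: "nat \<Rightarrow> (nat \<Rightarrow> real ^ 'd) measure" and \<pi>
    assume *: "\<And>n. leaf_constrained l \<mu> (\<pi>s n)" "prob_on P \<pi>"
      and lim: "\<And>A. A \<in> sets P \<Longrightarrow> (\<lambda>n. measure (\<pi>s n) A) \<longlonglongrightarrow> measure \<pi> A"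
    have "measure \<pi> ((\<lambda>x. x i) -` A \<inter> space (star_space l)) = measure (\<mu> i) A"
      if "i \<in> {1..l}" "A \<in> sets borel" for i A
      using lim[OF pre[OF that]] *(1) that by (simp add: leaf_constrained_iff LIMSEQ_const_iff)
    then show "leaf_constrained l \<mu> \<pi>" using *(2) by (simp add: leaf_constrained_iff)
  qed (use assms that in auto)
qed

end

theorem proposition7:
  fixes \<epsilon> :: real and l r :: nat and w :: "nat \<Rightarrow> real"
    and \<mu> :: "nat \<Rightarrow> (real ^ 'd) measure"
  assumes "\<epsilon> > 0" and "l \<ge> 2"
    and "\<And>i. i \<in> {1..l} \<Longrightarrow> w i > 0"
    and "\<And>i. i \<in> {1..l} \<Longrightarrow> prob_on borel (\<mu> i)"
    and "\<And>i. i \<in> {1..l} \<Longrightarrow> absolutely_continuous lborel (\<mu> i)"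
    and "\<And>i. i \<in> {1..l} \<Longrightarrow> \<bar>diff_entropy (\<mu> i)\<bar> \<noteq> \<infinity>"
    and "r \<in> {1..l}"
    and "AE x in lborel. RN_deriv lborel (\<mu> r) x > 0"
    and "\<exists>\<pi>. leaf_constrained l \<mu> \<pi> \<and> KL \<pi> (star_reference \<epsilon> l w r (\<mu> r)) < \<infinity>"
  shows "\<exists>\<pi>star.
    (\<forall>\<pi>. is_arg_min (\<lambda>\<pi>. KL \<pi> (star_reference \<epsilon> l w r (\<mu> r))) (leaf_constrained l \<mu>) \<pi>
          \<longleftrightarrow> \<pi> = \<pi>star) \<and>
    (\<forall>\<nu>. is_arg_min (barycenter_objective \<epsilon> l w \<mu>) (prob_on borel) \<nu>
          \<longleftrightarrow> \<nu> = marginal \<pi>star 0)"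
proof -
  interpret star_problem \<epsilon> l r w \<mu>
    by unfold_locales (use assms in auto)
  let ?obj = "barycenter_objective \<epsilon> l w \<mu>"
  obtain \<pi>' V where \<pi>': "leaf_constrained l \<mu> \<pi>'" "KL \<pi>' P = ereal V"
    and V: "\<And>\<pi>. leaf_constrained l \<mu> \<pi> \<Longrightarrow> ereal V \<le> KL \<pi> P"
    and close: "\<And>\<pi> A \<delta>. leaf_constrained l \<mu> \<pi> \<Longrightarrow> \<delta> > 0 \<Longrightarrow> KL \<pi> P \<le> ereal (V + \<delta>\<^sup>2) \<Longrightarrow>
      A \<in> sets (star_space l) \<Longrightarrow> \<bar>measure \<pi> A - measure \<pi>' A\<bar> \<le> 17 * \<delta>"
    using information_projection_leaf[OF assms(9)] by metis
  note D' = leaf_constrainedD(1,2)[OF \<pi>'(1)]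
  have KL_iff: "is_arg_min (\<lambda>\<pi>. KL \<pi> P) (leaf_constrained l \<mu>) \<pi> \<longleftrightarrow> \<pi> = \<pi>'" for \<pi>
  proof
    assume "is_arg_min (\<lambda>\<pi>. KL \<pi> P) (leaf_constrained l \<mu>) \<pi>"
    then have \<pi>: "leaf_constrained l \<mu> \<pi>" "KL \<pi> P \<le> ereal V"
      using \<pi>' by (auto simp: is_arg_min_def not_less)
    \<comment> \<open>A minimizer is a near-minimizer for every \<open>\<delta>\<close>, so
      \<open>close\<close> makes it agree with \<open>\<pi>'\<close> on each set.\<close>
    have "KL \<pi> P \<le> ereal (V + \<delta>\<^sup>2)" for \<delta>
      using \<pi>(2) by (rule order_trans) simp
    then show "\<pi> = \<pi>'"
      using leaf_constrainedD(1,2)[OF \<pi>(1)] D' close[OF \<pi>(1)]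
      by (intro prob_space_eqI_close[where M="star_space l" and b=17]) auto
  next
    assume "\<pi> = \<pi>'"
    then show "is_arg_min (\<lambda>\<pi>. KL \<pi> P) (leaf_constrained l \<mu>) \<pi>"
      using \<pi>' V by (auto simp: is_arg_min_def not_less)
  qed
  have obj_le: "?obj (marginal \<pi>' 0) \<le> ereal (\<epsilon> * V + K)"
    using objective_le(2)[OF \<pi>'(1)] \<pi>'(2) by simp
  have obj_ge: "ereal (\<epsilon> * V + K) \<le> ?obj \<nu>" if \<nu>: "prob_on borel \<nu>" for \<nu>
  proof (cases "?obj \<nu> < \<infinity>")
    case True
    show ?thesis
    \<comment> \<open>Couplings approach the infimum only up to a slack, so the bound is shown with
      an arbitrary \<open>\<delta>\<close> added.\<close>
    proof (rule ereal_le_epsilon2)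
      fix \<delta> :: real assume "\<delta> > 0"
      from near_optimal_gluing[OF \<nu> True this] obtain \<pi> where
        \<pi>: "leaf_constrained l \<mu> \<pi>" "ereal \<epsilon> * KL \<pi> P + ereal K \<le> ?obj \<nu> + ereal \<delta>" by metis
      have "ereal (\<epsilon> * V + K) = ereal \<epsilon> * ereal V + ereal K" by simp
      also have "\<dots> \<le> ereal \<epsilon> * KL \<pi> P + ereal K"
        using V[OF \<pi>(1)] eps by (intro add_right_mono ereal_mult_left_mono) auto
      finally show "ereal (\<epsilon> * V + K) \<le> ?obj \<nu> + ereal \<delta>" using \<pi>(2) by (rule order_trans)
    qed
  qed auto
  have obj_iff: "is_arg_min ?obj (prob_on borel) \<nu> \<longleftrightarrow> \<nu> = marginal \<pi>' 0" for \<nu>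
  proof
    assume "is_arg_min ?obj (prob_on borel) \<nu>"
    then have \<nu>: "prob_on borel \<nu>" and "?obj \<nu> \<le> ?obj (marginal \<pi>' 0)"
      using prob_on_marginal[OF D', of 0] by (auto simp: is_arg_min_def not_less)
    from this(2) obj_le have le: "?obj \<nu> \<le> ereal (\<epsilon> * V + K)" by (rule order_trans)
    then have fin: "?obj \<nu> < \<infinity>" by (rule le_less_trans) simp
    show "\<nu> = marginal \<pi>' 0"
    proof (rule prob_space_eqI_close[where M=borel and b=17])
      fix A :: "(real ^ 'd) set" and \<delta> :: real assume A: "A \<in> sets borel" and \<delta>: "\<delta> > 0"
      \<comment> \<open>With this slack, cancelling \<open>K\<close> and dividing by
        \<open>\<epsilon>\<close> leaves an excess of at most \<open>\<delta>\<^sup>2\<close> in the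
        divergence, the form that \<open>close\<close> requires.\<close>
      then have "\<epsilon> * \<delta>\<^sup>2 > 0" using eps by simp
      from near_optimal_gluing[OF \<nu> fin this] obtain \<pi> where \<pi>: "leaf_constrained l \<mu> \<pi>" "marginal \<pi> 0 = \<nu>"
        "ereal \<epsilon> * KL \<pi> P + ereal K \<le> ?obj \<nu> + ereal (\<epsilon> * \<delta>\<^sup>2)" by metis
      note \<pi>(3)
      also have "?obj \<nu> + ereal (\<epsilon> * \<delta>\<^sup>2) \<le> ereal (\<epsilon> * V + K) + ereal (\<epsilon> * \<delta>\<^sup>2)"
        using le by (rule add_right_mono)
      also have "\<dots> = ereal (\<epsilon> * (V + \<delta>\<^sup>2) + K)" by (simp add: distrib_left)
      finally have KL: "KL \<pi> P \<le> ereal (V + \<delta>\<^sup>2)" using eps by (rule ereal_affine_le_cancel)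
      have "(\<lambda>x. x 0) \<in> borel_measurable (star_space l)" by (rule measurable_component_singleton) simp
      from close[OF \<pi>(1) \<delta> KL measurable_sets[OF this A]]
      show "\<bar>measure \<nu> A - measure (marginal \<pi>' 0) A\<bar> \<le> 17 * \<delta>"
        using A D'(2) leaf_constrainedD(2)[OF \<pi>(1)]
        by (simp add: \<pi>(2)[symmetric] measure_leaf_marginal)
    qed (use \<nu> prob_on_marginal[OF D', of 0] in \<open>auto simp: prob_on_def\<close>)
  next
    assume "\<nu> = marginal \<pi>' 0"
    then show "is_arg_min ?obj (prob_on borel) \<nu>"
      using prob_on_marginal[OF D', of 0] order_trans[OF obj_le obj_ge]
      by (auto simp: is_arg_min_def not_less)
  qed
  show ?thesis using KL_iff obj_iff by blast
qed

end
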